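(* Let $(M,\mathcal F)$ be a foliated manifold, $F=T\mathcal F$, and let $(\Lambda,E)$ be a pair (bivector field, vector field) on $M$ that is $\mathcal F$-coupling of the second kind, with normal bundle $H=\sharp_\Lambda(\mathrm{ann}\,F)$, $\Lambda=\Lambda'_{2,0}+\Lambda''_{0,2}$, and $\sigma$ the $2$-form equivalent to $\Lambda'$ modulo $F$. Then $(\Lambda,E)$ is a Jacobi structure if and only if $\Lambda''$ is a leaf-tangent Poisson structure, the conditions $$(L_E\Lambda')(\alpha,\beta)=0,\quad (L_E\Lambda'')(\lambda,\mu)=0,\quad (L_E\Lambda')(\alpha,\lambda)=(L_E\Lambda'')(\lambda,\alpha)$$ hold for all $\alpha,\beta\in\Omega^{1,0}(M)$, $\lambda,\mu\in\Omega^{0,1}(M)$, and $$d'\sigma=(\flat_\sigma E)\wedge\sigma,\qquad L_X\Lambda''=\sigma(X,E)\Lambda'',\qquad -p_F[X,Y]=\sharp_{\Lambda''}\{d[\sigma(X,Y)]\}$$ for all projectable vector fields $X,Y$ in $H$.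
   Context: Everything is $C^\infty$. $\mathcal F$ is a regular foliation of $M$; $\mathrm{ann}$ denotes annihilator in $T^*M$. A normal bundle of $\mathcal F$ is a subbundle $H$ with $TM=H\oplus F$; $p_F$ is the projection onto $F$ along $H$. Given $H$, multivector fields have bidegrees $(a,b)$ (sections of $\wedge^aH\otimes\wedge^bF$), $\Omega^{a,b}(M)=\Gamma(\wedge^a(\mathrm{ann}\,F)\otimes\wedge^b(\mathrm{ann}\,H))$, and $d=d'_{1,0}+d''_{0,1}+\partial_{2,-1}$ is the decomposition of the exterior differential. For a bivector field $\Lambda$, $\beta(\sharp_\Lambda\alpha)=\Lambda(\alpha,\beta)$; $\flat_\sigma X=i(X)\sigma$. A Jacobi structure on $M$ is a pair $(\Lambda,E)$ such that $\{f,g\}=\Lambda(df,dg)+f(Eg)-g(Ef)$ is a Lie bracket on $C^\infty(M)$; equivalently $[\Lambda,\Lambda]=2E\wedge\Lambda$ and $L_E\Lambda=0$, where the Schouten-Nijenhuis bracket is normalized so that $[\Lambda,\Lambda](df,dg,dh)=2\sum_{Cycl(f,g,h)}\Lambda(d(\Lambda(df,dg)),dh)$ and $(E\wedge\Lambda)(\alpha,\beta,\gamma)=\sum_{Cycl}\alpha(E)\Lambda(\beta,\gamma)$. A leaf-tangent Poisson structure is a Poisson bivector field in $\Gamma\wedge^2F$. $(\Lambda,E)$ is $\mathcal F$-coupling of the second kind if $\sharp_\Lambda(\mathrm{ann}\,F)$ is a normal bundle $H$ of $\mathcal F$ that contains $E$, and (as for coupling of the second kind the paper takes the normal type) $E$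 is never tangent to $\mathcal F$. The $(1,1)$-component of $\Lambda$ with respect to $H$ then vanishes. The $2$-form $\sigma$ equivalent to $\Lambda'$ modulo $F$ is the section of $\wedge^2(\mathrm{ann}\,F)$ with $\sigma(\sharp_{\Lambda'}\alpha,\sharp_{\Lambda'}\beta)=\Lambda'(\alpha,\beta)$ for $\alpha,\beta\in\mathrm{ann}\,F$. A section $X$ of $H$ is projectable if $[Y,X]$ is tangent to $\mathcal F$ for every $Y$ tangent to $\mathcal F$; projectable sections over arbitrary open subsets of $M$ are considered. *)

theory Defs
  imports "HOL-Analysis.Analysis"
begin

section \<open>Smooth maps between Euclidean spaces\<close>

text \<open>Meaningful for open sets \<open>S\<close> only. In finite dimension, \<open>f\<close> is $C^{k+1}$ iff it is
  differentiable and all its directional derivatives are $C^k$.\<close>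

primrec Ck_on :: "nat \<Rightarrow> 'a::euclidean_space set \<Rightarrow> ('a \<Rightarrow> 'b::real_normed_vector) \<Rightarrow> bool" where
  "Ck_on 0 S f \<longleftrightarrow> continuous_on S f"
| "Ck_on (Suc k) S f \<longleftrightarrow> (\<forall>x\<in>S. f differentiable (at x)) \<and>
     (\<forall>v. Ck_on k S (\<lambda>x. frechet_derivative f (at x) v))"

definition smooth_on :: "'a::euclidean_space set \<Rightarrow> ('a \<Rightarrow> 'b::real_normed_vector) \<Rightarrow> bool" where
  "smooth_on S f \<longleftrightarrow> (\<forall>k. Ck_on k S f)"


section \<open>Smooth manifolds\<close>

text \<open>The manifold \<open>M\<close> is the whole type \<open>'a\<close>, with its (Hausdorff, second countable) topology and
  an atlas of charts with values in the Euclidean space \<open>'e\<close>. A chart is a pair of a domain and a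
  coordinate map; the values of the coordinate map outside the domain are irrelevant.\<close>

type_synonym ('a, 'e) chart = "'a set \<times> ('a \<Rightarrow> 'e)"

abbreviation cdom :: "('a, 'e) chart \<Rightarrow> 'a set" where
  "cdom c \<equiv> fst c"

abbreviation cmap :: "('a, 'e) chart \<Rightarrow> 'a \<Rightarrow> 'e" where
  "cmap c \<equiv> snd c"

definition cinv :: "('a, 'e) chart \<Rightarrow> 'e \<Rightarrow> 'a" where
  "cinv c = inv_into (cdom c) (cmap c)"

definition is_chart :: "('a::topological_space, 'e::euclidean_space) chart \<Rightarrow> bool" where
  "is_chart c \<longleftrightarrow> open (cdom c) \<and> open (cmap c ` cdom c) \<and>
     homeomorphism (cdom c) (cmap c ` cdom c) (cmap c) (cinv c)"

definition transition :: "('a, 'e) chart \<Rightarrow> ('a, 'e) chart \<Rightarrow> 'e \<Rightarrow> 'e" where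
  "transition c d = cmap d \<circ> cinv c"

definition compatible ::
    "('a, 'e::euclidean_space) chart \<Rightarrow> ('a, 'e) chart \<Rightarrow> bool" where
  "compatible c d \<longleftrightarrow> smooth_on (cmap c ` (cdom c \<inter> cdom d)) (transition c d) \<and>
     smooth_on (cmap d ` (cdom c \<inter> cdom d)) (transition d c)"

definition smooth_atlas ::
    "('a::{t2_space,second_countable_topology}, 'e::euclidean_space) chart set \<Rightarrow> bool" where
  "smooth_atlas A \<longleftrightarrow> (\<forall>c\<in>A. is_chart c) \<and> (\<Union>c\<in>A. cdom c) = UNIV \<and>
     (\<forall>c\<in>A. \<forall>d\<in>A. compatible c d)"

text \<open>The charts of the maximal atlas generated by \<open>A\<close>.\<close>

definition smooth_chart ::
    "('a::topological_space, 'e::euclidean_space) chart set \<Rightarrow> ('a, 'e) chart \<Rightarrow> bool" where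
  "smooth_chart A c \<longleftrightarrow> is_chart c \<and> (\<forall>d\<in>A. compatible c d)"

definition smooth_fun ::
    "('a, 'e::euclidean_space) chart set \<Rightarrow> 'a set \<Rightarrow> ('a \<Rightarrow> real) \<Rightarrow> bool" where
  "smooth_fun A U f \<longleftrightarrow> (\<forall>c\<in>A. smooth_on (cmap c ` (U \<inter> cdom c)) (f \<circ> cinv c))"


section \<open>Tensor fields\<close>

text \<open>A preferred chart is chosen at every point, and the tangent space at \<open>p\<close> is \<open>'e\<close>: a tangent
  vector at \<open>p\<close> is identified with its coordinate vector in the preferred chart at \<open>p\<close>. Accordingly
  the cotangent space at \<open>p\<close> is \<open>'e \<Rightarrow>\<^sub>L real\<close>, and bivectors at \<open>p\<close> are alternating bilinear
  forms on it. The coordinates of a tangent vector in any other chart, and hence the coordinate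
  representations of tensor fields and their smoothness, are obtained from the derivatives of the
  transition maps. Fields on an open set \<open>U\<close> are total functions with irrelevant values outside
  \<open>U\<close>.\<close>

definition chart_at :: "('a, 'e) chart set \<Rightarrow> 'a \<Rightarrow> ('a, 'e) chart" where
  "chart_at A p = (SOME c. c \<in> A \<and> p \<in> cdom c)"

definition tangent_change ::
    "('a, 'e::euclidean_space) chart \<Rightarrow> ('a, 'e) chart \<Rightarrow> 'a \<Rightarrow> ('e \<Rightarrow>\<^sub>L 'e)" where
  "tangent_change c d p = Blinfun (frechet_derivative (transition c d) (at (cmap c p)))"

definition to_chart ::
    "('a, 'e::euclidean_space) chart set \<Rightarrow> ('a, 'e) chart \<Rightarrow> 'a \<Rightarrow> ('e \<Rightarrow>\<^sub>L 'e)" where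
  "to_chart A c p = tangent_change (chart_at A p) c p"

definition from_chart ::
    "('a, 'e::euclidean_space) chart set \<Rightarrow> ('a, 'e) chart \<Rightarrow> 'a \<Rightarrow> ('e \<Rightarrow>\<^sub>L 'e)" where
  "from_chart A c p = tangent_change c (chart_at A p) p"

type_synonym ('a, 'e) vfield = "'a \<Rightarrow> 'e"
type_synonym ('a, 'e) form1 = "'a \<Rightarrow> ('e \<Rightarrow>\<^sub>L real)"
type_synonym ('a, 'e) form2 = "'a \<Rightarrow> 'e \<Rightarrow> 'e \<Rightarrow> real"
type_synonym ('a, 'e) form3 = "'a \<Rightarrow> 'e \<Rightarrow> 'e \<Rightarrow> 'e \<Rightarrow> real"
type_synonym ('a, 'e) bivfield = "'a \<Rightarrow> ('e \<Rightarrow>\<^sub>L real) \<Rightarrow> ('e \<Rightarrow>\<^sub>L real) \<Rightarrow> real"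
type_synonym ('a, 'e) distribution = "'a \<Rightarrow> 'e set"

text \<open>Coordinate representations, as functions of the point \<open>y\<close> in the image of the chart.\<close>

definition vf_in :: "('a, 'e::euclidean_space) chart set \<Rightarrow> ('a, 'e) chart \<Rightarrow>
    ('a, 'e) vfield \<Rightarrow> 'e \<Rightarrow> 'e" where
  "vf_in A c X y = to_chart A c (cinv c y) (X (cinv c y))"

definition form1_in :: "('a, 'e::euclidean_space) chart set \<Rightarrow> ('a, 'e) chart \<Rightarrow>
    ('a, 'e) form1 \<Rightarrow> 'e \<Rightarrow> 'e \<Rightarrow> real" where
  "form1_in A c \<alpha> y v = \<alpha> (cinv c y) (from_chart A c (cinv c y) v)"

definition form2_in :: "('a, 'e::euclidean_space) chart set \<Rightarrow> ('a, 'e) chart \<Rightarrow>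
    ('a, 'e) form2 \<Rightarrow> 'e \<Rightarrow> 'e \<Rightarrow> 'e \<Rightarrow> real" where
  "form2_in A c \<omega> y v w =
     \<omega> (cinv c y) (from_chart A c (cinv c y) v) (from_chart A c (cinv c y) w)"

definition biv_in :: "('a, 'e::euclidean_space) chart set \<Rightarrow> ('a, 'e) chart \<Rightarrow>
    ('a, 'e) bivfield \<Rightarrow> 'e \<Rightarrow> ('e \<Rightarrow>\<^sub>L real) \<Rightarrow> ('e \<Rightarrow>\<^sub>L real) \<Rightarrow> real" where
  "biv_in A c B y a b =
     B (cinv c y) (a o\<^sub>L to_chart A c (cinv c y)) (b o\<^sub>L to_chart A c (cinv c y))"

definition vector_field ::
    "('a, 'e::euclidean_space) chart set \<Rightarrow> 'a set \<Rightarrow> ('a, 'e) vfield \<Rightarrow> bool" where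
  "vector_field A U X \<longleftrightarrow> (\<forall>c\<in>A. smooth_on (cmap c ` (U \<inter> cdom c)) (vf_in A c X))"

definition one_form :: "('a, 'e::euclidean_space) chart set \<Rightarrow> ('a, 'e) form1 \<Rightarrow> bool" where
  "one_form A \<alpha> \<longleftrightarrow> (\<forall>c\<in>A. \<forall>v. smooth_on (cmap c ` cdom c) (\<lambda>y. form1_in A c \<alpha> y v))"

definition two_form :: "('a, 'e::euclidean_space) chart set \<Rightarrow> ('a, 'e) form2 \<Rightarrow> bool" where
  "two_form A \<omega> \<longleftrightarrow> (\<forall>p. bilinear (\<omega> p) \<and> (\<forall>v. \<omega> p v v = 0)) \<and>
     (\<forall>c\<in>A. \<forall>v w. smooth_on (cmap c ` cdom c) (\<lambda>y. form2_in A c \<omega> y v w))"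

definition bivector_field ::
    "('a, 'e::euclidean_space) chart set \<Rightarrow> ('a, 'e) bivfield \<Rightarrow> bool" where
  "bivector_field A B \<longleftrightarrow> (\<forall>p. bilinear (B p) \<and> (\<forall>a. B p a a = 0)) \<and>
     (\<forall>c\<in>A. \<forall>a b. smooth_on (cmap c ` cdom c) (\<lambda>y. biv_in A c B y a b))"


section \<open>Differential operators\<close>

text \<open>All operators are given at \<open>p\<close> by the usual local formulas in the preferred chart at \<open>p\<close>,
  in which the vectors and covectors at \<open>p\<close> are their own coordinates.\<close>

definition fun_differential ::
    "('a, 'e::euclidean_space) chart set \<Rightarrow> ('a \<Rightarrow> real) \<Rightarrow> ('a, 'e) form1" where
  "fun_differential A f p =
     (let c = chart_at A p in Blinfun (frechet_derivative (f \<circ> cinv c) (at (cmap c p))))"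

definition vf_bracket :: "('a, 'e::euclidean_space) chart set \<Rightarrow>
    ('a, 'e) vfield \<Rightarrow> ('a, 'e) vfield \<Rightarrow> ('a, 'e) vfield" where
  "vf_bracket A X Y p =
     (let c = chart_at A p in
        frechet_derivative (vf_in A c Y) (at (cmap c p)) (X p)
      - frechet_derivative (vf_in A c X) (at (cmap c p)) (Y p))"

text \<open>$(L_X B)(a,b) = X(B(a,b)) - B(L_X a, b) - B(a, L_X b)$, where \<open>a\<close>, \<open>b\<close> are extended to
  1-forms with constant coefficients in the chart, so that $L_X a = a \circ DX$.\<close>

definition lie_deriv_biv :: "('a, 'e::euclidean_space) chart set \<Rightarrow>
    ('a, 'e) vfield \<Rightarrow> ('a, 'e) bivfield \<Rightarrow> ('a, 'e) bivfield" where
  "lie_deriv_biv A X B p a b =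
     (let c = chart_at A p;
          DX = Blinfun (frechet_derivative (vf_in A c X) (at (cmap c p)))
      in frechet_derivative (\<lambda>y. biv_in A c B y a b) (at (cmap c p)) (X p)
         - B p (a o\<^sub>L DX) b - B p a (b o\<^sub>L DX))"

definition ext_deriv2 ::
    "('a, 'e::euclidean_space) chart set \<Rightarrow> ('a, 'e) form2 \<Rightarrow> ('a, 'e) form3" where
  "ext_deriv2 A \<omega> p u v w =
     (let c = chart_at A p;
          D = (\<lambda>x y z. frechet_derivative (\<lambda>t. form2_in A c \<omega> t y z) (at (cmap c p)) x)
      in D u v w + D v w u + D w u v)"

definition wedge12 :: "('a \<Rightarrow> 'e \<Rightarrow> real) \<Rightarrow> ('a, 'e) form2 \<Rightarrow> ('a, 'e) form3" where
  "wedge12 \<theta> \<omega> p u v w = \<theta> p u * \<omega> p v w + \<theta> p v * \<omega> p w u + \<theta> p w * \<omega> p u v"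

definition flat :: "('a, 'e) form2 \<Rightarrow> ('a, 'e) vfield \<Rightarrow> 'a \<Rightarrow> 'e \<Rightarrow> real" where
  "flat \<sigma> X p = \<sigma> p (X p)"

definition sharp ::
    "(('e::euclidean_space \<Rightarrow>\<^sub>L real) \<Rightarrow> ('e \<Rightarrow>\<^sub>L real) \<Rightarrow> real) \<Rightarrow> ('e \<Rightarrow>\<^sub>L real) \<Rightarrow> 'e" where
  "sharp B a = (THE v. \<forall>b. blinfun_apply b v = B a b)"


section \<open>Foliations and normal bundles\<close>

text \<open>A regular foliation is given by a foliated atlas \<open>\<Phi>\<close>: smooth charts covering \<open>M\<close> whose
  plaques are cut out by the translates of a fixed subspace \<open>V\<close> (of dimension the rank of the
  foliation), and whose transition maps locally send plaques into plaques, i.e. have the form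
  $(x,y) \mapsto (h(x), g(x,y))$ with \<open>y\<close> the coordinate along \<open>V\<close>.\<close>

definition foliated_atlas :: "('a::topological_space, 'e::euclidean_space) chart set \<Rightarrow>
    'e set \<Rightarrow> ('a, 'e) chart set \<Rightarrow> bool" where
  "foliated_atlas A V \<Phi> \<longleftrightarrow> subspace V \<and> (\<forall>c\<in>\<Phi>. smooth_chart A c) \<and> (\<Union>c\<in>\<Phi>. cdom c) = UNIV \<and>
     (\<forall>c\<in>\<Phi>. \<forall>d\<in>\<Phi>. \<forall>p\<in>cdom c \<inter> cdom d. \<exists>W. open W \<and> p \<in> W \<and> W \<subseteq> cdom c \<inter> cdom d \<and>
        (\<forall>x\<in>W. \<forall>y\<in>W. cmap c x - cmap c y \<in> V \<longrightarrow> cmap d x - cmap d y \<in> V))"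

definition tangent_distribution :: "('a, 'e::euclidean_space) chart set \<Rightarrow>
    'e set \<Rightarrow> ('a, 'e) chart set \<Rightarrow> ('a, 'e) distribution" where
  "tangent_distribution A V \<Phi> p = {v. \<forall>c\<in>\<Phi>. p \<in> cdom c \<longrightarrow> blinfun_apply (to_chart A c p) v \<in> V}"

definition ann :: "'e::real_normed_vector set \<Rightarrow> ('e \<Rightarrow>\<^sub>L real) set" where
  "ann S = {a. \<forall>v\<in>S. blinfun_apply a v = 0}"

definition smooth_subbundle ::
    "('a::topological_space, 'e::euclidean_space) chart set \<Rightarrow> ('a, 'e) distribution \<Rightarrow> bool" where
  "smooth_subbundle A H \<longleftrightarrow> (\<forall>p. subspace (H p)) \<and>
     (\<forall>p. \<exists>U k. \<exists>X :: nat \<Rightarrow> ('a, 'e) vfield. open U \<and> p \<in> U \<and> (\<forall>i<k. vector_field A U (X i)) \<and>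
        (\<forall>q\<in>U. dim (H q) = k \<and> span ((\<lambda>i. X i q) ` {..<k}) = H q))"

definition normal_bundle :: "('a::topological_space, 'e::euclidean_space) chart set \<Rightarrow>
    ('a, 'e) distribution \<Rightarrow> ('a, 'e) distribution \<Rightarrow> bool" where
  "normal_bundle A F H \<longleftrightarrow> smooth_subbundle A H \<and>
     (\<forall>p. H p \<inter> F p = {0} \<and> {u + v | u v. u \<in> H p \<and> v \<in> F p} = UNIV)"

text \<open>The projection onto the subspace \<open>S\<close> along the complementary subspace \<open>T\<close>.\<close>

definition proj_along :: "'e::euclidean_space set \<Rightarrow> 'e set \<Rightarrow> ('e \<Rightarrow>\<^sub>L 'e)" where
  "proj_along S T = Blinfun (\<lambda>v. THE x. x \<in> S \<and> v - x \<in> T)"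

text \<open>\<open>biv_part S T B\<close> is the component of \<open>B\<close> in $\Gamma(\wedge^2 S)$ for the splitting $TM = S \oplus T$; thus
  the components of bidegree $(2,0)$ and $(0,2)$ are \<open>biv_part H F B\<close> and \<open>biv_part F H B\<close>.\<close>

definition biv_part :: "('a, 'e::euclidean_space) distribution \<Rightarrow> ('a, 'e) distribution \<Rightarrow>
    ('a, 'e) bivfield \<Rightarrow> ('a, 'e) bivfield" where
  "biv_part S T B p a b = B p (a o\<^sub>L proj_along (S p) (T p)) (b o\<^sub>L proj_along (S p) (T p))"

text \<open>On 2-forms of bidegree $(2,0)$, \<open>d'\<close> is the $(3,0)$-component of the exterior
  differential.\<close>

definition d_prime2 :: "('a, 'e::euclidean_space) chart set \<Rightarrow> ('a, 'e) distribution \<Rightarrow>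
    ('a, 'e) distribution \<Rightarrow> ('a, 'e) form2 \<Rightarrow> ('a, 'e) form3" where
  "d_prime2 A H F \<omega> p u v w =
     (let P = blinfun_apply (proj_along (H p) (F p)) in ext_deriv2 A \<omega> p (P u) (P v) (P w))"

definition projectable :: "('a::topological_space, 'e::euclidean_space) chart set \<Rightarrow>
    ('a, 'e) distribution \<Rightarrow> ('a, 'e) distribution \<Rightarrow> 'a set \<Rightarrow> ('a, 'e) vfield \<Rightarrow> bool" where
  "projectable A F H U X \<longleftrightarrow> vector_field A U X \<and> (\<forall>p\<in>U. X p \<in> H p) \<and>
     (\<forall>Y. vector_field A U Y \<and> (\<forall>p\<in>U. Y p \<in> F p) \<longrightarrow> (\<forall>p\<in>U. vf_bracket A Y X p \<in> F p))"

text \<open>$\Omega^{1,0}(M)$ and $\Omega^{0,1}(M)$ are \<open>one_forms_ann A F\<close> and \<open>one_forms_ann A H\<close>.\<close>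

definition one_forms_ann :: "('a, 'e::euclidean_space) chart set \<Rightarrow>
    ('a, 'e) distribution \<Rightarrow> ('a, 'e) form1 set" where
  "one_forms_ann A D = {\<alpha>. one_form A \<alpha> \<and> (\<forall>p. \<alpha> p \<in> ann (D p))}"


section \<open>Jacobi and Poisson structures, coupling\<close>

definition lie_bracket_on ::
    "('a \<Rightarrow> real) set \<Rightarrow> (('a \<Rightarrow> real) \<Rightarrow> ('a \<Rightarrow> real) \<Rightarrow> 'a \<Rightarrow> real) \<Rightarrow> bool" where
  "lie_bracket_on C br \<longleftrightarrow>
     (\<forall>f\<in>C. \<forall>g\<in>C. br f g \<in> C) \<and>
     (\<forall>f\<in>C. \<forall>g\<in>C. \<forall>h\<in>C. \<forall>r s. \<forall>p. br (\<lambda>q. r * f q + s * g q) h p = r * br f h p + s * br g h p) \<and>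
     (\<forall>f\<in>C. \<forall>g\<in>C. \<forall>p. br f g p = - br g f p) \<and>
     (\<forall>f\<in>C. \<forall>g\<in>C. \<forall>h\<in>C. \<forall>p. br (br f g) h p + br (br g h) f p + br (br h f) g p = 0)"

definition jacobi_bracket :: "('a, 'e::euclidean_space) chart set \<Rightarrow> ('a, 'e) bivfield \<Rightarrow>
    ('a, 'e) vfield \<Rightarrow> ('a \<Rightarrow> real) \<Rightarrow> ('a \<Rightarrow> real) \<Rightarrow> 'a \<Rightarrow> real" where
  "jacobi_bracket A \<Lambda> E f g p =
     \<Lambda> p (fun_differential A f p) (fun_differential A g p)
     + f p * fun_differential A g p (E p) - g p * fun_differential A f p (E p)"

definition jacobi_structure :: "('a, 'e::euclidean_space) chart set \<Rightarrow> ('a, 'e) bivfield \<Rightarrow>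
    ('a, 'e) vfield \<Rightarrow> bool" where
  "jacobi_structure A \<Lambda> E \<longleftrightarrow> bivector_field A \<Lambda> \<and> vector_field A UNIV E \<and>
     lie_bracket_on {f. smooth_fun A UNIV f} (jacobi_bracket A \<Lambda> E)"

definition poisson_structure ::
    "('a, 'e::euclidean_space) chart set \<Rightarrow> ('a, 'e) bivfield \<Rightarrow> bool" where
  "poisson_structure A \<Lambda> \<longleftrightarrow> bivector_field A \<Lambda> \<and>
     lie_bracket_on {f. smooth_fun A UNIV f}
       (\<lambda>f g p. \<Lambda> p (fun_differential A f p) (fun_differential A g p))"

definition leaf_tangent_poisson :: "('a, 'e::euclidean_space) chart set \<Rightarrow>
    ('a, 'e) distribution \<Rightarrow> ('a, 'e) bivfield \<Rightarrow> bool" where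
  "leaf_tangent_poisson A F \<Lambda> \<longleftrightarrow> poisson_structure A \<Lambda> \<and>
     (\<forall>p. \<forall>a\<in>ann (F p). \<forall>b. \<Lambda> p a b = 0)"

definition sharp_ann :: "('a, 'e::euclidean_space) distribution \<Rightarrow> ('a, 'e) bivfield \<Rightarrow>
    ('a, 'e) distribution" where
  "sharp_ann F \<Lambda> p = sharp (\<Lambda> p) ` ann (F p)"

text \<open>Coupling of the second kind, of normal type: \<open>E\<close> is nowhere tangent to the foliation.\<close>

definition coupling_second_kind :: "('a::topological_space, 'e::euclidean_space) chart set \<Rightarrow>
    ('a, 'e) distribution \<Rightarrow> ('a, 'e) bivfield \<Rightarrow> ('a, 'e) vfield \<Rightarrow> bool" where
  "coupling_second_kind A F \<Lambda> E \<longleftrightarrow> bivector_field A \<Lambda> \<and> vector_field A UNIV E \<and>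
     normal_bundle A F (sharp_ann F \<Lambda>) \<and> (\<forall>p. E p \<in> sharp_ann F \<Lambda> p) \<and> (\<forall>p. E p \<notin> F p)"

definition equivalent_form_mod :: "('a, 'e::euclidean_space) chart set \<Rightarrow>
    ('a, 'e) distribution \<Rightarrow> ('a, 'e) bivfield \<Rightarrow> ('a, 'e) form2 \<Rightarrow> bool" where
  "equivalent_form_mod A F B \<sigma> \<longleftrightarrow> two_form A \<sigma> \<and>
     (\<forall>p. \<forall>u\<in>F p. \<forall>v. \<sigma> p u v = 0) \<and>
     (\<forall>p. \<forall>a\<in>ann (F p). \<forall>b\<in>ann (F p). \<sigma> p (sharp (B p) a) (sharp (B p) b) = B p a b)"

end

theory Submission
  imports Defs
begin

text \<open>The Jacobi identity for the bracket of \<open>(\<Lambda>, E)\<close> amounts to the pointwise tensor equations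
  \<open>[\<Lambda>, \<Lambda>] = 2 E \<and> \<Lambda>\<close> and \<open>L_E \<Lambda> = 0\<close>: the second derivatives of the functions cancel by
  symmetry, and cut-off functions realize arbitrary differentials. The trivector equation splits
  into types with respect to \<open>TM = H \<oplus> F\<close>. All that enters at a point are the first-order jets of
  \<open>\<Lambda>\<close>, \<open>\<sigma>\<close> and of the projection \<open>P\<close> onto \<open>F\<close> along \<open>H\<close> (smooth, since the projection onto \<open>H\<close> is
  \<open>- \<sharp> \<circ> \<flat>\<close>), subject to three identities: the derivative of \<open>\<Lambda>(P\<^sup>*a, (1 - P)\<^sup>*b) = 0\<close>, that of
  \<open>\<sigma>(\<sharp>a, v) = - a(v)\<close>, and the involutivity of \<open>F\<close>, i.e. \<open>DP(u)v - DP(v)u \<in> F\<close> for \<open>u, v \<in> F\<close>.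
  A projectable field \<open>X\<close> in \<open>H\<close> satisfies \<open>(1 - P)(DX(u) - DP(X)u) = 0\<close> for \<open>u \<in> F\<close> and
  \<open>P(DX(v)) = - DP(v)X\<close>; with \<open>X = \<sharp>a\<close> at the point, the components of types (3,0), (2,1), (1,2)
  and (0,3) become the equations for \<open>d'\<sigma>\<close>, \<open>P[X,Y]\<close>, \<open>L_X \<Lambda>''\<close> and the Poisson condition.\<close>

section \<open>Calculus of smooth maps\<close>

text \<open>The preferred chart jumps from point to point, so raw values of a field cannot be
  differentiated; everything differentiated at \<open>p\<close> is first rewritten in the single
  chart chosen at \<open>p\<close>, where at \<open>p\<close> itself tensors equal their
  coordinates. Constants are test functions too: with one function equal to 1 the Jacobiator
  isolates \<open>L_E \<Lambda>\<close>, and only after that is disposed of does it give the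
  trivector equation. Since \<open>E\<close> is a section of \<open>H\<close>, the trivector
  \<open>E \<and> \<Lambda>\<close> has only components of types (3,0) and (1,2). Hence
  \<open>E\<close> enters the equations for \<open>d'\<sigma>\<close> and
  \<open>L_X \<Lambda>''\<close>, but neither the Poisson condition nor the one for
  \<open>[X,Y]\<close>. In \<open>L_E \<Lambda> = 0\<close> each pure type sees one summand only, as
  \<open>L_E \<Lambda>''\<close> vanishes on pairs from \<open>ann F\<close> and
  \<open>L_E \<Lambda>'\<close> on pairs from \<open>ann H\<close>; the mixed type compares the two.
  Conditions on all projectable fields become pointwise because such fields exist locally through
  every vector of \<open>H\<close> and only their jets at the point matter.\<close>

abbreviation fderiv ::
    "('a::real_normed_vector \<Rightarrow> 'b::real_normed_vector) \<Rightarrow> 'a \<Rightarrow> 'a \<Rightarrow> 'b" where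
  "fderiv f x \<equiv> frechet_derivative f (at x)"

lemma has_derivative_frechet:
  "f differentiable (at x) \<Longrightarrow> (f has_derivative fderiv f x) (at x)"
  by (simp add: frechet_derivative_works)

lemma frechet_derivative_eqI:
  "(f has_derivative f') (at x) \<Longrightarrow> fderiv f x v = f' v"
  by (metis frechet_derivative_at)

text \<open>\<open>frechet_derivative\<close> is a choice among all derivatives. Agreement near
  \<open>x\<close> gives the same predicate to choose from, hence the same value, differentiable or
  not.\<close>

lemma frechet_derivative_cong_open:
  assumes "open S" "x \<in> S" "\<And>y. y \<in> S \<Longrightarrow> f y = g y"
  shows "fderiv f x = fderiv g x"
proof -
  have "(f has_derivative f') (at x) \<longleftrightarrow> (g has_derivative f') (at x)" for f'
    using has_derivative_transform_within_open[of f f' x UNIV S g]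
      has_derivative_transform_within_open[of g f' x UNIV S f] assms by auto
  then show ?thesis
    by (simp add: frechet_derivative_def)
qed

lemma differentiable_cong_open:
  assumes "open S" "x \<in> S" "\<And>y. y \<in> S \<Longrightarrow> f y = g y" "f differentiable (at x)"
  shows "g differentiable (at x)"
  using assms unfolding differentiable_def by (metis has_derivative_transform_within_open)

lemma Ck_on_cong:
  assumes "open S" "\<And>x. x \<in> S \<Longrightarrow> f x = g x"
  shows "Ck_on k S f \<longleftrightarrow> Ck_on k S g"
  using assms
proof (induction k arbitrary: f g)
  case 0
  then show ?case by (simp cong: continuous_on_cong)
next
  case (Suc k)
  have "Ck_on k S (\<lambda>x. fderiv f x v) \<longleftrightarrow> Ck_on k S (\<lambda>x. fderiv g x v)" for v
    using Suc frechet_derivative_cong_open[OF Suc.prems(1) _ Suc.prems(2)]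
    by (intro Suc.IH) auto
  moreover have "(\<forall>x\<in>S. f differentiable (at x)) \<longleftrightarrow> (\<forall>x\<in>S. g differentiable (at x))"
    using differentiable_cong_open[OF Suc.prems(1)] Suc.prems(2) by metis
  ultimately show ?case by simp
qed

lemma Ck_on_subset: "Ck_on k S f \<Longrightarrow> T \<subseteq> S \<Longrightarrow> Ck_on k T f"
  by (induction k arbitrary: f) (auto intro: continuous_on_subset)

lemma Ck_on_local:
  assumes "\<And>x. x \<in> S \<Longrightarrow> \<exists>T. open T \<and> x \<in> T \<and> Ck_on k T f"
  shows "Ck_on k S f"
  using assms
proof (induction k arbitrary: f)
  case 0
  have "continuous (at x within S) f" if "x \<in> S" for x
    using 0[OF that] by (auto simp: continuous_on_eq_continuous_at intro: continuous_at_imp_continuous_at_within)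
  then show ?case by (simp add: continuous_on_eq_continuous_within)
next
  case (Suc k)
  have "f differentiable (at x)" if "x \<in> S" for x
    using Suc.prems[OF that] by auto
  moreover have "Ck_on k S (\<lambda>x. fderiv f x v)" for v
    using Suc.prems by (intro Suc.IH) (metis Ck_on.simps(2))
  ultimately show ?case by simp
qed

text \<open>At positive levels \<open>Ck_on\<close> speaks only of differentiability and
  derivatives; continuity is recovered from differentiability. Product and chain rules rely on this,
  since undifferentiated factors stand there beside derivatives.\<close>

lemma Ck_on_SucD: "Ck_on (Suc k) S f \<Longrightarrow> Ck_on k S f"
proof (induction k arbitrary: f)
  case 0
  then have "f differentiable_on S"
    by (auto simp: differentiable_on_def intro: differentiable_at_withinI)
  then show ?case by (simp add: differentiable_imp_continuous_on)
next
  case (Suc k)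
  then show ?case by (metis Ck_on.simps(2))
qed

lemma Ck_on_const [simp]: "Ck_on k S (\<lambda>x. c)"
  by (induction k arbitrary: c) (auto simp: frechet_derivative_const)

lemma Ck_on_add:
  assumes "open S" "Ck_on k S f" "Ck_on k S g"
  shows "Ck_on k S (\<lambda>x. f x + g x)"
  using assms(2,3)
proof (induction k arbitrary: f g)
  case 0
  then show ?case by (simp add: continuous_on_add)
next
  case (Suc k)
  have "fderiv (\<lambda>x. f x + g x) x v
      = fderiv f x v + fderiv g x v" if "x \<in> S" for x v
    using that Suc.prems by (intro frechet_derivative_eqI derivative_intros) (auto intro: has_derivative_frechet)
  then have "Ck_on k S (\<lambda>x. fderiv (\<lambda>x. f x + g x) x v)" for v
    using Suc by (subst Ck_on_cong[OF assms(1), where g = "\<lambda>x. fderiv f x v + fderiv g x v"]) auto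
  then show ?case using Suc.prems by auto
qed

lemma Ck_on_bounded_linear:
  assumes "open S" "bounded_linear B" "Ck_on k S f"
  shows "Ck_on k S (\<lambda>x. B (f x))"
  using assms(3)
proof (induction k arbitrary: f)
  case 0
  then show ?case by (simp add: bounded_linear.continuous_on[OF assms(2)])
next
  case (Suc k)
  have d: "((\<lambda>x. B (f x)) has_derivative (\<lambda>v. B (fderiv f x v))) (at x)" if "x \<in> S" for x
    using that Suc.prems by (intro bounded_linear.has_derivative[OF assms(2)]) (auto intro: has_derivative_frechet)
  then have "Ck_on k S (\<lambda>x. fderiv (\<lambda>x. B (f x)) x v)" for v
    using Suc frechet_derivative_eqI[OF d]
    by (subst Ck_on_cong[OF assms(1), where g = "\<lambda>x. B (fderiv f x v)"]) auto
  then show ?case using d by (auto simp: differentiable_def)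
qed

lemma Ck_on_bounded_bilinear:
  assumes "open S" "bounded_bilinear B" "Ck_on k S f" "Ck_on k S g"
  shows "Ck_on k S (\<lambda>x. B (f x) (g x))"
  using assms(3,4)
proof (induction k arbitrary: f g)
  case 0
  then show ?case by (simp add: bounded_bilinear.continuous_on[OF assms(2)])
next
  case (Suc k)
  have d: "((\<lambda>x. B (f x) (g x)) has_derivative
      (\<lambda>v. B (f x) (fderiv g x v) + B (fderiv f x v) (g x))) (at x)"
    if "x \<in> S" for x
    using that Suc.prems by (intro bounded_bilinear.FDERIV[OF assms(2)]) (auto intro: has_derivative_frechet)
  have "Ck_on k S (\<lambda>x. fderiv (\<lambda>x. B (f x) (g x)) x v)" for v
    using Suc.prems frechet_derivative_eqI[OF d] Ck_on_SucD[OF Suc.prems(1)] Ck_on_SucD[OF Suc.prems(2)]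
    by (subst Ck_on_cong[OF assms(1), where g = "\<lambda>x. B (f x) (fderiv g x v) + B (fderiv f x v) (g x)"])
      (auto intro!: Ck_on_add[OF assms(1)] Suc.IH)
  then show ?case using d by (auto simp: differentiable_def)
qed

lemma Ck_on_sum:
  assumes "open S" "\<And>i. i \<in> I \<Longrightarrow> Ck_on k S (f i)"
  shows "Ck_on k S (\<lambda>x. \<Sum>i\<in>I. f i x)"
  using assms(2) by (induction I rule: infinite_finite_induct) (auto intro: Ck_on_add[OF assms(1)])

text \<open>\<open>Ck_on\<close> controls derivatives in fixed directions, whereas the chain rule
  produces the moving direction \<open>fderiv g x v\<close>; the basis expansion trades it for
  scalar coefficients.\<close>

lemma frechet_derivative_basis:
  fixes f :: "'a::euclidean_space \<Rightarrow> 'b::real_normed_vector"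
  assumes "f differentiable (at x)"
  shows "fderiv f x v = (\<Sum>i\<in>Basis. (v \<bullet> i) *\<^sub>R fderiv f x i)"
proof -
  have "linear (fderiv f x)"
    by (rule linear_frechet_derivative[OF assms])
  then have "fderiv f x (\<Sum>i\<in>Basis. (v \<bullet> i) *\<^sub>R i)
      = (\<Sum>i\<in>Basis. (v \<bullet> i) *\<^sub>R fderiv f x i)"
    by (simp add: linear_sum linear_scale)
  then show ?thesis by (simp add: euclidean_representation)
qed

lemma Ck_on_compose:
  fixes f :: "'b::euclidean_space \<Rightarrow> 'c::real_normed_vector" and g :: "'a::euclidean_space \<Rightarrow> 'b"
  assumes "open S" "open T" "g ` S \<subseteq> T" "Ck_on k T f" "Ck_on k S g"
  shows "Ck_on k S (\<lambda>x. f (g x))"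
  using assms(4,5)
proof (induction k arbitrary: f)
  case 0
  then show ?case using assms(3) by (auto intro: continuous_on_compose2)
next
  case (Suc k)
  have d: "((\<lambda>x. f (g x)) has_derivative
      (\<lambda>v. fderiv f (g x) (fderiv g x v))) (at x)" if "x \<in> S" for x
    using that Suc.prems assms(3)
    by (intro has_derivative_compose[of g _ x UNIV f]) (auto intro!: has_derivative_frechet)
  have "Ck_on k S (\<lambda>x. \<Sum>i\<in>Basis. (fderiv g x v \<bullet> i) *\<^sub>R fderiv f (g x) i)" for v
    using Suc.prems Ck_on_SucD[OF Suc.prems(2)]
    by (intro Ck_on_sum Ck_on_bounded_bilinear[OF _ bounded_bilinear_scaleR]
        Suc.IH Ck_on_bounded_linear[OF _ bounded_linear_inner_left] assms(1)) auto
  moreover have "fderiv (\<lambda>x. f (g x)) x v =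
      (\<Sum>i\<in>Basis. (fderiv g x v \<bullet> i) *\<^sub>R fderiv f (g x) i)" if "x \<in> S" for x v
  proof -
    have "f differentiable (at (g x))" using that assms(3) Suc.prems(1) by auto
    then show ?thesis
      using frechet_derivative_eqI[OF d[OF that], of v] frechet_derivative_basis by metis
  qed
  ultimately have "Ck_on k S (\<lambda>x. fderiv (\<lambda>x. f (g x)) x v)" for v
    by (subst Ck_on_cong[OF assms(1)]) auto
  then show ?case using d by (auto simp: differentiable_def)
qed

lemma smooth_on_cong: "open S \<Longrightarrow> (\<And>x. x \<in> S \<Longrightarrow> f x = g x) \<Longrightarrow> smooth_on S f \<longleftrightarrow> smooth_on S g"
  by (simp add: smooth_on_def cong: Ck_on_cong)

lemma smooth_on_subset: "smooth_on S f \<Longrightarrow> T \<subseteq> S \<Longrightarrow> smooth_on T f"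
  by (auto simp: smooth_on_def intro: Ck_on_subset)

lemma smooth_on_local:
  "(\<And>x. x \<in> S \<Longrightarrow> \<exists>T. open T \<and> x \<in> T \<and> smooth_on T f) \<Longrightarrow> smooth_on S f"
  unfolding smooth_on_def by (metis Ck_on_local)

lemma smooth_on_const [simp]: "smooth_on S (\<lambda>x. c)"
  by (simp add: smooth_on_def)

lemma smooth_on_add: "open S \<Longrightarrow> smooth_on S f \<Longrightarrow> smooth_on S g \<Longrightarrow> smooth_on S (\<lambda>x. f x + g x)"
  by (simp add: smooth_on_def Ck_on_add)

lemma smooth_on_bounded_linear:
  "open S \<Longrightarrow> bounded_linear B \<Longrightarrow> smooth_on S f \<Longrightarrow> smooth_on S (\<lambda>x. B (f x))"
  by (simp add: smooth_on_def Ck_on_bounded_linear)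

lemma smooth_on_bounded_bilinear:
  "open S \<Longrightarrow> bounded_bilinear B \<Longrightarrow> smooth_on S f \<Longrightarrow> smooth_on S g \<Longrightarrow> smooth_on S (\<lambda>x. B (f x) (g x))"
  by (simp add: smooth_on_def Ck_on_bounded_bilinear)

lemmas smooth_on_mult = smooth_on_bounded_bilinear[OF _ bounded_bilinear_mult]
lemmas smooth_on_scaleR = smooth_on_bounded_bilinear[OF _ bounded_bilinear_scaleR]
lemmas smooth_on_inner_left = smooth_on_bounded_linear[OF _ bounded_linear_inner_left]
lemmas smooth_on_minus = smooth_on_bounded_linear[OF _ bounded_linear_minus[OF bounded_linear_ident]]

lemma smooth_on_diff: "open S \<Longrightarrow> smooth_on S f \<Longrightarrow> smooth_on S g \<Longrightarrow> smooth_on S (\<lambda>x. f x - g x)"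
  using smooth_on_add[of S f "\<lambda>x. - g x"] smooth_on_minus[of S g] by simp

lemma smooth_on_sum:
  "open S \<Longrightarrow> (\<And>i. i \<in> I \<Longrightarrow> smooth_on S (f i)) \<Longrightarrow> smooth_on S (\<lambda>x. \<Sum>i\<in>I. f i x)"
  by (simp add: smooth_on_def Ck_on_sum)

lemma smooth_on_compose:
  fixes f :: "'b::euclidean_space \<Rightarrow> 'c::real_normed_vector" and g :: "'a::euclidean_space \<Rightarrow> 'b"
  shows "open S \<Longrightarrow> open T \<Longrightarrow> g ` S \<subseteq> T \<Longrightarrow> smooth_on T f \<Longrightarrow> smooth_on S g \<Longrightarrow> smooth_on S (\<lambda>x. f (g x))"
  unfolding smooth_on_def by (blast intro: Ck_on_compose)

lemma smooth_on_ident: "smooth_on S (\<lambda>x. x)"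
proof -
  have "Ck_on k S (\<lambda>x. x)" for k
    by (cases k) (auto simp: frechet_derivative_ident)
  then show ?thesis by (simp add: smooth_on_def)
qed

lemma smooth_on_differentiable: "smooth_on S f \<Longrightarrow> x \<in> S \<Longrightarrow> f differentiable (at x)"
  by (metis Ck_on.simps(2) smooth_on_def)

lemma smooth_on_continuous: "smooth_on S f \<Longrightarrow> continuous_on S f"
  by (metis Ck_on.simps(1) smooth_on_def)

lemma smooth_on_frechet: "smooth_on S f \<Longrightarrow> smooth_on S (\<lambda>x. fderiv f x v)"
  by (metis Ck_on.simps(2) smooth_on_def)

section \<open>Symmetry of second derivatives\<close>

text \<open>Both mixed derivatives are limits of the same second difference quotient.\<close>

lemma second_difference_mvt:
  fixes f :: "'a::euclidean_space \<Rightarrow> real"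
  assumes f: "smooth_on (ball x r) f" and t: "0 < t" "t * norm u + t * norm v < r"
  obtains y where "norm (y - x) \<le> t * norm u + t * norm v"
    "f (x + t *\<^sub>R u + t *\<^sub>R v) - f (x + t *\<^sub>R u) - f (x + t *\<^sub>R v) + f x =
      t * t * fderiv (\<lambda>y. fderiv f y u) y v"
proof -
  define D where "D = (\<lambda>y w. fderiv f y w)"
  have inb: "x + a *\<^sub>R u + b *\<^sub>R v \<in> ball x r" if "0 \<le> a" "a \<le> t" "0 \<le> b" "b \<le> t" for a b
  proof -
    have "norm (a *\<^sub>R u + b *\<^sub>R v) \<le> t * norm u + t * norm v"
      using that by (intro norm_triangle_le) (simp add: add_mono mult_right_mono)
    moreover have "dist x (x + a *\<^sub>R u + b *\<^sub>R v) = norm (a *\<^sub>R u + b *\<^sub>R v)"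
      by (metis add.assoc add_diff_cancel_left' dist_commute dist_norm)
    ultimately show ?thesis using t by simp
  qed
  have df: "(f has_derivative D y) (at y)" if "y \<in> ball x r" for y
    unfolding D_def using smooth_on_differentiable[OF f that] by (auto intro: has_derivative_frechet)
  have dfu: "((\<lambda>y. D y u) has_derivative fderiv (\<lambda>y. D y u) y) (at y)" if "y \<in> ball x r" for y
    unfolding D_def using smooth_on_differentiable[OF smooth_on_frechet[OF f] that]
    by (auto intro: has_derivative_frechet)
  have lin: "D y (s *\<^sub>R w) = s * D y w" if "y \<in> ball x r" for y s w
    using linear_scale[OF has_derivative_linear[OF df[OF that]]] by simp
  have lin2: "fderiv (\<lambda>y. D y u) y (s *\<^sub>R w) = s * fderiv (\<lambda>y. D y u) y w"
    if "y \<in> ball x r" for y s w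
    using linear_scale[OF has_derivative_linear[OF dfu[OF that]]] by simp
  \<comment> \<open>The mean value theorem is applied twice: in direction \<open>u\<close> to the
    increment of \<open>f\<close> along \<open>v\<close>, then in direction \<open>v\<close> to the
    resulting derivative. The term \<open>0 *\<^sub>R v\<close> is kept so that both ends of the
    increment are instances of one formula.\<close>
  define g where "g = (\<lambda>s. f (x + s *\<^sub>R u + t *\<^sub>R v) - f (x + s *\<^sub>R u + 0 *\<^sub>R v))"
  have dg: "(g has_derivative (\<lambda>h. h * (D (x + s *\<^sub>R u + t *\<^sub>R v) u - D (x + s *\<^sub>R u + 0 *\<^sub>R v) u))) (at s)"
    if "0 \<le> s" "s \<le> t" for s
  proof -
    have *: "((\<lambda>s. f (x + s *\<^sub>R u + b *\<^sub>R v)) has_derivative (\<lambda>h. D (x + s *\<^sub>R u + b *\<^sub>R v) (h *\<^sub>R u))) (at s)"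
      if "0 \<le> b" "b \<le> t" for b
      using that \<open>0 \<le> s\<close> \<open>s \<le> t\<close>
      by (intro has_derivative_compose[of "\<lambda>s. x + s *\<^sub>R u + b *\<^sub>R v" _ s UNIV f] df inb)
        (auto intro!: derivative_eq_intros)
    have "(g has_derivative (\<lambda>h. D (x + s *\<^sub>R u + t *\<^sub>R v) (h *\<^sub>R u) - D (x + s *\<^sub>R u + 0 *\<^sub>R v) (h *\<^sub>R u))) (at s)"
      unfolding g_def using t by (intro has_derivative_diff *) auto
    then show ?thesis
      using lin[OF inb[OF that, of t]] lin[OF inb[OF that, of 0]] t by (simp add: algebra_simps)
  qed
  have "\<exists>s\<in>{0<..<t}. g t - g 0 = (t - 0) * (D (x + s *\<^sub>R u + t *\<^sub>R v) u - D (x + s *\<^sub>R u + 0 *\<^sub>R v) u)"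
    using t(1) mvt_simple[of 0 t g "\<lambda>s h. h * (D (x + s *\<^sub>R u + t *\<^sub>R v) u - D (x + s *\<^sub>R u + 0 *\<^sub>R v) u)"]
      has_derivative_at_withinI[OF dg] by auto
  then obtain s where s: "0 < s" "s < t"
    and gs: "g t - g 0 = t * (D (x + s *\<^sub>R u + t *\<^sub>R v) u - D (x + s *\<^sub>R u + 0 *\<^sub>R v) u)"
    by auto
  define k where "k = (\<lambda>b. D (x + s *\<^sub>R u + b *\<^sub>R v) u)"
  have dk: "(k has_derivative (\<lambda>h. h * fderiv (\<lambda>y. D y u) (x + s *\<^sub>R u + b *\<^sub>R v) v)) (at b)"
    if "0 \<le> b" "b \<le> t" for b
  proof -
    have "(k has_derivative (\<lambda>h. fderiv (\<lambda>y. D y u) (x + s *\<^sub>R u + b *\<^sub>R v) (h *\<^sub>R v))) (at b)"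
      unfolding k_def using that s
      by (intro has_derivative_compose[of "\<lambda>b. x + s *\<^sub>R u + b *\<^sub>R v" _ b UNIV "\<lambda>y. D y u"] dfu inb)
        (auto intro!: derivative_eq_intros)
    then show ?thesis
      using lin2[OF inb[of s b]] s that by (simp add: algebra_simps)
  qed
  have "\<exists>b\<in>{0<..<t}. k t - k 0 = (t - 0) * fderiv (\<lambda>y. D y u) (x + s *\<^sub>R u + b *\<^sub>R v) v"
    using t(1) mvt_simple[of 0 t k "\<lambda>b h. h * fderiv (\<lambda>y. D y u) (x + s *\<^sub>R u + b *\<^sub>R v) v"]
      has_derivative_at_withinI[OF dk] by auto
  then obtain b where b: "0 < b" "b < t"
    and kb: "k t - k 0 = t * fderiv (\<lambda>y. D y u) (x + s *\<^sub>R u + b *\<^sub>R v) v"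
    by auto
  have nb: "norm ((x + s *\<^sub>R u + b *\<^sub>R v) - x) \<le> t * norm u + t * norm v"
  proof -
    have "norm (s *\<^sub>R u + b *\<^sub>R v) \<le> t * norm u + t * norm v"
      using s b by (intro norm_triangle_le) (simp add: add_mono mult_right_mono)
    then show ?thesis by (simp add: add.assoc)
  qed
  have "f (x + t *\<^sub>R u + t *\<^sub>R v) - f (x + t *\<^sub>R u) - f (x + t *\<^sub>R v) + f x =
      t * t * fderiv (\<lambda>y. fderiv f y u) (x + s *\<^sub>R u + b *\<^sub>R v) v"
    using gs kb unfolding g_def k_def D_def by (simp add: algebra_simps)
  then show thesis using nb that by blast
qed

lemma symmetric_second_derivative:
  fixes f :: "'a::euclidean_space \<Rightarrow> real"
  assumes S: "open S" "x \<in> S" and f: "smooth_on S f"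
  shows "fderiv (\<lambda>y. fderiv f y u) x v =
         fderiv (\<lambda>y. fderiv f y v) x u"
proof -
  obtain r where r: "0 < r" "ball x r \<subseteq> S"
    using S openE by blast
  have fb: "smooth_on (ball x r) f" using f r smooth_on_subset by blast
  define DD where "DD = (\<lambda>u v y. fderiv (\<lambda>y. fderiv f y u) y v)"
  define N where "N = norm u + norm v + 1"
  define q where "q = (\<lambda>t. (f (x + t *\<^sub>R u + t *\<^sub>R v) - f (x + t *\<^sub>R u) - f (x + t *\<^sub>R v) + f x) / (t * t))"
  have N: "0 < N" by (simp add: N_def add_nonneg_pos)
  have small: "t * norm u + t * norm v < r" if "0 < t" "t < r / N" for t
  proof -
    have "t * norm u + t * norm v \<le> t * N" using that by (simp add: N_def algebra_simps)
    also have "\<dots> < r" using that N by (simp add: pos_less_divide_eq)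
    finally show ?thesis .
  qed
  \<comment> \<open>The quotient \<open>q\<close> is symmetric in \<open>u\<close> and
    \<open>v\<close>, so it serves both orders; the intermediate points tend to \<open>x\<close>,
    and continuity of the second derivative identifies the limit.\<close>
  have lim: "(q \<longlongrightarrow> DD a b x) (at_right 0)" if ab: "(a = u \<and> b = v) \<or> (a = v \<and> b = u)" for a b
  proof -
    have "\<exists>y. norm (y - x) \<le> t * norm u + t * norm v \<and> q t = DD a b y" if t: "0 < t" "t < r / N" for t
    proof -
      have s: "t * norm a + t * norm b < r" using small[OF t] ab by auto
      obtain y where "norm (y - x) \<le> t * norm a + t * norm b"
        "f (x + t *\<^sub>R a + t *\<^sub>R b) - f (x + t *\<^sub>R a) - f (x + t *\<^sub>R b) + f x = t * t * DD a b y"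
        unfolding DD_def using second_difference_mvt[OF fb t(1) s] by metis
      then show ?thesis using ab t(1)
        by (intro exI[of _ y]) (auto simp: q_def algebra_simps)
    qed
    then obtain Y where Y: "\<And>t. 0 < t \<Longrightarrow> t < r / N \<Longrightarrow> norm (Y t - x) \<le> t * norm u + t * norm v"
      "\<And>t. 0 < t \<Longrightarrow> t < r / N \<Longrightarrow> q t = DD a b (Y t)"
      by metis
    have ev: "\<forall>\<^sub>F t in at_right 0. 0 < t \<and> t < r / N"
      using r N by (auto simp: eventually_at_right_field intro!: exI[of _ "r / N"])
    have "((\<lambda>t. t * norm u + t * norm v) \<longlongrightarrow> 0 * norm u + 0 * norm v) (at_right (0::real))"
      by (intro tendsto_intros)
    then have t0: "((\<lambda>t. t * norm u + t * norm v) \<longlongrightarrow> 0) (at_right (0::real))" by simp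
    have "((\<lambda>t. norm (Y t - x)) \<longlongrightarrow> 0) (at_right 0)"
      by (rule tendsto_sandwich[OF _ _ tendsto_const t0]) (use ev Y(1) in \<open>auto elim: eventually_mono\<close>)
    then have Yx: "(Y \<longlongrightarrow> x) (at_right 0)"
      by (metis LIM_zero_iff tendsto_norm_zero_iff)
    have "smooth_on S (DD a b)"
      unfolding DD_def by (intro smooth_on_frechet f)
    then have "isCont (DD a b) x"
      using smooth_on_continuous S continuous_on_eq_continuous_at by blast
    then have "((\<lambda>t. DD a b (Y t)) \<longlongrightarrow> DD a b x) (at_right 0)"
      using Yx isCont_tendsto_compose by blast
    then show ?thesis
      by (rule Lim_transform_eventually) (use ev Y(2) in \<open>auto elim: eventually_mono\<close>)
  qed
  have "DD u v x = DD v u x"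
    using tendsto_unique[OF _ lim lim] by simp
  then show ?thesis by (simp add: DD_def)
qed

section \<open>A flat function and smooth bumps\<close>

text \<open>The linear span of this family is closed under differentiation.\<close>

definition flat_exp :: "nat \<Rightarrow> real \<Rightarrow> real" where
  "flat_exp n x = (if 0 < x then exp (- (1 / x)) / x ^ n else 0)"

lemma flat_exp_tendsto_0: "(flat_exp n \<longlongrightarrow> 0) (at 0)"
proof -
  have "((\<lambda>x. (inverse x) ^ n / exp (inverse x)) \<longlongrightarrow> 0) (at_right (0::real))"
    by (rule filterlim_compose[OF tendsto_power_div_exp_0 filterlim_inverse_at_top_right])
  then have r: "(flat_exp n \<longlongrightarrow> 0) (at_right 0)"
  proof (rule Lim_transform_eventually)
    show "\<forall>\<^sub>F x in at_right 0. inverse x ^ n / exp (inverse x) = flat_exp n x"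
      using eventually_at_right_less[of "0::real"]
      by eventually_elim (simp add: flat_exp_def exp_minus field_simps)
  qed
  have l: "(flat_exp n \<longlongrightarrow> 0) (at_left 0)"
    by (rule Lim_transform_eventually[OF tendsto_const])
      (auto simp: flat_exp_def eventually_at_filter)
  show ?thesis using l r by (simp add: filterlim_split_at)
qed

lemma flat_exp_has_derivative:
  "(flat_exp n has_field_derivative (flat_exp (n + 2) x - n * flat_exp (n + 1) x)) (at x)"
proof -
  consider "0 < x" | "x < 0" | "x = 0" by linarith
  then show ?thesis
  proof cases
    case 1
    have "((\<lambda>x. exp (- (1 / x)) / x ^ n) has_field_derivative (flat_exp (n + 2) x - n * flat_exp (n + 1) x)) (at x)"
    proof (cases n)
      case (Suc m)
      have *: "x ^ m = x * x ^ (m - Suc 0)" if "m \<noteq> 0"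
        using that by (cases m) auto
      show ?thesis using 1 Suc
        by (auto intro!: derivative_eq_intros simp: flat_exp_def field_simps power2_eq_square) (use * in blast)
    qed (use 1 in \<open>auto intro!: derivative_eq_intros simp: flat_exp_def field_simps power2_eq_square\<close>)
    then show ?thesis
      by (rule has_field_derivative_transform_within_open[of _ _ _ "{0<..}"]) (use 1 in \<open>auto simp: flat_exp_def\<close>)
  next
    case 2
    have "((\<lambda>x. 0) has_field_derivative (flat_exp (n + 2) x - n * flat_exp (n + 1) x)) (at x)"
      using 2 by (simp add: flat_exp_def)
    then show ?thesis
      by (rule has_field_derivative_transform_within_open[of _ _ _ "{..<0}"]) (use 2 in \<open>auto simp: flat_exp_def\<close>)
  next
    case 3
    \<comment> \<open>At 0 the difference quotient of \<open>flat_exp n\<close> is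
      \<open>flat_exp (n + 1)\<close>.\<close>
    have "((\<lambda>h. (flat_exp n (0 + h) - flat_exp n 0) / h) \<longlongrightarrow> 0) (at 0)"
      by (rule Lim_transform_eventually[OF flat_exp_tendsto_0[of "n + 1"]])
        (auto simp: flat_exp_def eventually_at_filter)
    then show ?thesis using 3 by (simp add: DERIV_def flat_exp_def)
  qed
qed

lemma smooth_on_flat_exp: "smooth_on UNIV (flat_exp n)"
proof -
  have "Ck_on k UNIV (flat_exp n)" for k n
  proof (induction k arbitrary: n)
    case 0
    show ?case
      using flat_exp_has_derivative by (auto intro!: continuous_at_imp_continuous_on DERIV_isCont)
  next
    case (Suc k)
    have d: "(flat_exp n has_derivative (\<lambda>v. v * (flat_exp (n + 2) x - n * flat_exp (n + 1) x))) (at x)" for n x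
      using flat_exp_has_derivative[of n x] by (simp add: has_field_derivative_def mult.commute[of _ "_ - _"])
    have "Ck_on k UNIV (\<lambda>x. fderiv (flat_exp n) x v)" for v
      unfolding frechet_derivative_eqI[OF d]
      using Ck_on_add[OF open_UNIV Ck_on_bounded_linear[OF open_UNIV bounded_linear_mult_right Suc.IH]
          Ck_on_bounded_linear[OF open_UNIV bounded_linear_mult_right Suc.IH], of v "n + 2" "- (v * n)" "n + 1"]
      by (simp add: algebra_simps)
    then show ?case using d by (auto simp: differentiable_def)
  qed
  then show ?thesis by (simp add: smooth_on_def)
qed

lemma exists_smooth_bump:
  fixes y0 :: "'e::euclidean_space"
  assumes "0 < r"
  obtains \<eta> :: "'e \<Rightarrow> real" where "smooth_on UNIV \<eta>" "\<eta> y0 = 1" "\<forall>y. y \<notin> cball y0 r \<longrightarrow> \<eta> y = 0"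
proof -
  \<comment> \<open>The argument of the second factor is positive exactly inside the ball of radius
    \<open>r\<close>; the first factor normalizes the value at the centre to 1.\<close>
  define \<eta> where "\<eta> = (\<lambda>y::'e. (1 / flat_exp 0 (r\<^sup>2)) * flat_exp 0 (r\<^sup>2 - (y - y0) \<bullet> (y - y0)))"
  have id: "smooth_on UNIV (\<lambda>y::'e. y - y0)"
    by (intro smooth_on_diff smooth_on_ident smooth_on_const open_UNIV)
  have "smooth_on UNIV (\<lambda>y. r\<^sup>2 - (y - y0) \<bullet> (y - y0))"
    by (intro smooth_on_diff smooth_on_const smooth_on_bounded_bilinear[OF _ bounded_bilinear_inner] id open_UNIV)
  then have "smooth_on UNIV \<eta>"
    unfolding \<eta>_def
    by (intro smooth_on_mult smooth_on_const open_UNIV smooth_on_compose[OF open_UNIV open_UNIV _ smooth_on_flat_exp]) auto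
  moreover have "\<eta> y0 = 1" using assms by (simp add: \<eta>_def flat_exp_def)
  moreover have "\<eta> y = 0" if "y \<notin> cball y0 r" for y
  proof -
    have "r < norm (y - y0)" using that by (simp add: dist_norm norm_minus_commute)
    then have "r\<^sup>2 \<le> (norm (y - y0))\<^sup>2" using assms by (intro power_mono) auto
    then show ?thesis by (simp add: \<eta>_def flat_exp_def dot_square_norm)
  qed
  ultimately show thesis using that by blast
qed

section \<open>Bilinear expressions with smooth coefficients\<close>

text \<open>Families of linear maps are differentiated argument by argument, so linearity in the
  argument has to be carried over to the derivative.\<close>

lemma linear_frechet_derivative_family:
  fixes B :: "'a::real_normed_vector \<Rightarrow> 'b::real_vector \<Rightarrow> 'c::real_normed_vector"
  assumes B: "\<And>y. linear (B y)" and d: "\<And>a. (\<lambda>y. B y a) differentiable (at y0)"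
  shows "linear (\<lambda>a. fderiv (\<lambda>y. B y a) y0 h)"
proof (rule linearI)
  note D = has_derivative_frechet[OF d]
  show "fderiv (\<lambda>y. B y (a + b)) y0 h = fderiv (\<lambda>y. B y a) y0 h + fderiv (\<lambda>y. B y b) y0 h" for a b
    unfolding linear_add[OF B] by (rule frechet_derivative_eqI[OF has_derivative_add[OF D D]])
  show "fderiv (\<lambda>y. B y (r *\<^sub>R a)) y0 h = r *\<^sub>R fderiv (\<lambda>y. B y a) y0 h" for r a
    unfolding linear_scale[OF B] by (rule frechet_derivative_eqI[OF has_derivative_scaleR_right[OF D]])
qed

lemma bilinear_frechet_derivative:
  fixes B :: "'a::real_normed_vector \<Rightarrow> 'b::real_vector \<Rightarrow> 'c::real_vector \<Rightarrow> real"
  assumes "\<And>y. bilinear (B y)" and "\<And>a b. (\<lambda>y. B y a b) differentiable (at y0)"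
  shows "bilinear (\<lambda>a b. fderiv (\<lambda>y. B y a b) y0 h)"
  using assms unfolding bilinear_def
  by (intro conjI allI linear_frechet_derivative_family) auto

lemma blinfun_sum_basis:
  fixes T :: "'e::euclidean_space \<Rightarrow>\<^sub>L 'b::real_normed_vector"
  shows "blinfun_apply T v = (\<Sum>i\<in>Basis. (v \<bullet> i) *\<^sub>R blinfun_apply T i)"
proof -
  have "blinfun_apply T v = blinfun_apply T (\<Sum>i\<in>Basis. (v \<bullet> i) *\<^sub>R i)"
    by (simp add: euclidean_representation)
  then show ?thesis by (simp add: blinfun.sum_right blinfun.scaleR_right)
qed

lemma covector_of_components:
  assumes "i \<in> Basis"
  shows "blinfun_apply (\<Sum>j\<in>Basis. f j *\<^sub>R blinfun_inner_right j) i = f i"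
proof -
  have "blinfun_apply (\<Sum>j\<in>Basis. f j *\<^sub>R blinfun_inner_right j) i = (\<Sum>j\<in>Basis. if j = i then f j else 0)"
    unfolding blinfun.sum_left by (intro sum.cong refl) (use assms in \<open>simp add: blinfun.scaleR_left inner_Basis\<close>)
  then show ?thesis using assms by simp
qed

text \<open>Finite coordinate systems, to treat vectors and covectors at once: there is no
  \<open>euclidean_space\<close> instance for \<open>'e \<Rightarrow>\<^sub>L real\<close>.\<close>

definition coord_system :: "'i set \<Rightarrow> ('i \<Rightarrow> 'b::real_vector \<Rightarrow> real) \<Rightarrow> ('i \<Rightarrow> 'b) \<Rightarrow> bool" where
  "coord_system I \<phi> e \<longleftrightarrow> finite I \<and> (\<forall>x. x = (\<Sum>i\<in>I. \<phi> i x *\<^sub>R e i))"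

lemma coord_system_vector:
  "coord_system Basis (\<lambda>i v. v \<bullet> i) (\<lambda>i::'e::euclidean_space. i)"
  by (simp add: coord_system_def euclidean_representation)

lemma coord_system_covector:
  "coord_system Basis (\<lambda>i a. blinfun_apply a i) (\<lambda>i::'e::euclidean_space. blinfun_inner_right i)"
proof -
  have "a = (\<Sum>i\<in>Basis. blinfun_apply a i *\<^sub>R blinfun_inner_right i)" for a :: "'e \<Rightarrow>\<^sub>L real"
  proof (rule blinfun_eqI)
    show "blinfun_apply a v = blinfun_apply (\<Sum>i\<in>Basis. blinfun_apply a i *\<^sub>R blinfun_inner_right i) v" for v
      unfolding blinfun_sum_basis[of a v]
      by (simp add: blinfun.sum_left blinfun.scaleR_left inner_commute mult.commute)
  qed
  then show ?thesis by (simp add: coord_system_def)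
qed

lemma bilinear_coord_expand:
  assumes "bilinear B" "coord_system I \<phi> e" "coord_system J \<psi> f"
  shows "B a b = (\<Sum>i\<in>I. \<Sum>j\<in>J. (\<phi> i a * \<psi> j b) * B (e i) (f j))"
proof -
  have "B a b = B (\<Sum>i\<in>I. \<phi> i a *\<^sub>R e i) (\<Sum>j\<in>J. \<psi> j b *\<^sub>R f j)"
    using assms(2,3) unfolding coord_system_def by metis
  also have "\<dots> = (\<Sum>(i,j)\<in>I \<times> J. B (\<phi> i a *\<^sub>R e i) (\<psi> j b *\<^sub>R f j))"
    using assms by (intro bilinear_sum) (auto simp: coord_system_def)
  also have "\<dots> = (\<Sum>(i,j)\<in>I \<times> J. (\<phi> i a * \<psi> j b) * B (e i) (f j))"
    using assms(1) by (simp add: bilinear_lmul bilinear_rmul algebra_simps)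
  finally show ?thesis by (simp add: sum.cartesian_product)
qed

lemma smooth_on_bilinear:
  fixes B :: "'a::euclidean_space \<Rightarrow> 'b::real_vector \<Rightarrow> 'c::real_vector \<Rightarrow> real"
  assumes "open S" "coord_system I \<phi> e" "coord_system J \<psi> f" "\<And>y. bilinear (B y)"
    and "\<And>a b. smooth_on S (\<lambda>y. B y a b)"
    and "\<And>i. i \<in> I \<Longrightarrow> smooth_on S (\<lambda>y. \<phi> i (a y))" "\<And>j. j \<in> J \<Longrightarrow> smooth_on S (\<lambda>y. \<psi> j (b y))"
  shows "smooth_on S (\<lambda>y. B y (a y) (b y))"
proof -
  have "(\<lambda>y. B y (a y) (b y)) = (\<lambda>y. \<Sum>i\<in>I. \<Sum>j\<in>J. (\<phi> i (a y) * \<psi> j (b y)) * B y (e i) (f j))"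
    by (intro ext bilinear_coord_expand assms)
  then show ?thesis
    by (simp only:) (intro smooth_on_sum smooth_on_mult assms)
qed

text \<open>Product rule for a tensor and two arguments that all vary. Expansion in coordinates
  reduces it to real functions, so covector-valued maps enter through their components only.\<close>

lemma has_derivative_bilinear:
  fixes B :: "'a::real_normed_vector \<Rightarrow> 'b::real_vector \<Rightarrow> 'c::real_vector \<Rightarrow> real"
  assumes \<phi>: "coord_system I \<phi> e" and \<psi>: "coord_system J \<psi> f" and bil: "\<And>y. bilinear (B y)"
    and d: "\<And>a b. (\<lambda>y. B y a b) differentiable (at y0)"
    and a: "\<And>i. i \<in> I \<Longrightarrow> ((\<lambda>y. \<phi> i (a y)) has_derivative (\<lambda>h. \<phi> i (a' h))) (at y0)"
    and b: "\<And>j. j \<in> J \<Longrightarrow> ((\<lambda>y. \<psi> j (b y)) has_derivative (\<lambda>h. \<psi> j (b' h))) (at y0)"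
  shows "((\<lambda>y. B y (a y) (b y)) has_derivative (\<lambda>h. fderiv (\<lambda>y. B y (a y0) (b y0)) y0 h
      + B y0 (a' h) (b y0) + B y0 (a y0) (b' h))) (at y0)"
proof -
  note ex = bilinear_coord_expand[OF _ \<phi> \<psi>]
  have "((\<lambda>y. \<Sum>i\<in>I. \<Sum>j\<in>J. (\<phi> i (a y) * \<psi> j (b y)) * B y (e i) (f j)) has_derivative
     (\<lambda>h. \<Sum>i\<in>I. \<Sum>j\<in>J. (\<phi> i (a y0) * \<psi> j (b y0)) * fderiv (\<lambda>y. B y (e i) (f j)) y0 h
       + (\<phi> i (a y0) * \<psi> j (b' h) + \<phi> i (a' h) * \<psi> j (b y0)) * B y0 (e i) (f j))) (at y0)"
    by (intro has_derivative_sum has_derivative_mult a b has_derivative_frechet d)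
  moreover have "(\<Sum>i\<in>I. \<Sum>j\<in>J. (\<phi> i (a y0) * \<psi> j (b y0)) * fderiv (\<lambda>y. B y (e i) (f j)) y0 h
       + (\<phi> i (a y0) * \<psi> j (b' h) + \<phi> i (a' h) * \<psi> j (b y0)) * B y0 (e i) (f j))
     = fderiv (\<lambda>y. B y (a y0) (b y0)) y0 h + B y0 (a' h) (b y0) + B y0 (a y0) (b' h)" for h
    using ex[OF bilinear_frechet_derivative[OF bil d, of h], of "a y0" "b y0"]
      ex[OF bil[of y0], of "a' h" "b y0"] ex[OF bil[of y0], of "a y0" "b' h"]
    by (simp add: sum.distrib algebra_simps)
  moreover have "(\<lambda>y. B y (a y) (b y)) = (\<lambda>y. \<Sum>i\<in>I. \<Sum>j\<in>J. (\<phi> i (a y) * \<psi> j (b y)) * B y (e i) (f j))"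
    by (intro ext ex bil)
  ultimately show ?thesis by simp
qed

lemmas has_derivative_bilinear_covectors =
  has_derivative_bilinear[OF coord_system_covector coord_system_covector]
lemmas has_derivative_bilinear_vectors =
  has_derivative_bilinear[OF coord_system_vector coord_system_vector]
lemmas smooth_on_bilinear_covectors =
  smooth_on_bilinear[OF _ coord_system_covector coord_system_covector]

lemma smooth_on_eqI: "open S \<Longrightarrow> smooth_on S g \<Longrightarrow> (\<And>x. x \<in> S \<Longrightarrow> f x = g x) \<Longrightarrow> smooth_on S f"
  by (simp cong: smooth_on_cong)

section \<open>Charts and changes of coordinates\<close>

abbreviation cimage :: "('a, 'e) chart \<Rightarrow> 'e set" where
  "cimage c \<equiv> cmap c ` cdom c"

lemma cmap_cinv: "y \<in> cimage c \<Longrightarrow> cmap c (cinv c y) = y"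
  unfolding cinv_def by (rule f_inv_into_f)

lemma cinv_mem: "y \<in> cimage c \<Longrightarrow> cinv c y \<in> cdom c"
  unfolding cinv_def by (rule inv_into_into)

lemma cinv_cmap: "is_chart c \<Longrightarrow> p \<in> cdom c \<Longrightarrow> cinv c (cmap c p) = p"
  by (auto simp: is_chart_def homeomorphism_def)

lemma open_chart_image:
  assumes "is_chart c" "open U" "U \<subseteq> cdom c"
  shows "open (cmap c ` U)"
proof -
  have "openin (top_of_set (cimage c)) (cmap c ` U)"
    using assms homeomorphism_imp_open_map[of "cdom c" "cimage c" "cmap c" "cinv c" U]
    by (auto simp: is_chart_def openin_open_eq)
  then show ?thesis
    using assms(1) openin_open_trans by (auto simp: is_chart_def)
qed

lemma smooth_chart_is_chart: "smooth_chart A c \<Longrightarrow> is_chart c"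
  by (simp add: smooth_chart_def)

lemma smooth_chart_open: "smooth_chart A c \<Longrightarrow> open (cdom c)"
  by (simp add: smooth_chart_def is_chart_def)

lemma smooth_chart_open_image:
  "smooth_chart A c \<Longrightarrow> open U \<Longrightarrow> U \<subseteq> cdom c \<Longrightarrow> open (cmap c ` U)"
  using open_chart_image smooth_chart_is_chart by blast

lemma smooth_chart_cinv: "smooth_chart A c \<Longrightarrow> p \<in> cdom c \<Longrightarrow> cinv c (cmap c p) = p"
  using cinv_cmap smooth_chart_is_chart by blast

locale smooth_manifold =
  fixes A :: "('a::{t2_space,second_countable_topology}, 'e::euclidean_space) chart set"
  assumes atlas: "smooth_atlas A"
begin

lemma chart_open [simp]: "smooth_chart A c \<Longrightarrow> open (cdom c)"
  by (rule smooth_chart_open)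

lemma atlas_smooth_chart: "c \<in> A \<Longrightarrow> smooth_chart A c"
  using atlas by (auto simp: smooth_atlas_def smooth_chart_def)

lemma chart_at: "chart_at A p \<in> A" "p \<in> cdom (chart_at A p)"
proof -
  have "\<exists>c. c \<in> A \<and> p \<in> cdom c"
    using atlas by (fastforce simp: smooth_atlas_def)
  from someI_ex[OF this] show "chart_at A p \<in> A" "p \<in> cdom (chart_at A p)"
    unfolding chart_at_def by blast+
qed

lemma chart_at_smooth: "smooth_chart A (chart_at A p)"
  using chart_at atlas_smooth_chart by blast

lemma transition_cmap: "smooth_chart A c \<Longrightarrow> p \<in> cdom c \<Longrightarrow> transition c d (cmap c p) = cmap d p"
  by (simp add: transition_def smooth_chart_cinv)

text \<open>Two charts of the maximal atlas are each known to be compatible with charts of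
  \<open>A\<close>; near every point the transition factors through one of those.\<close>

lemma transition_smooth:
  assumes c: "smooth_chart A c" and d: "smooth_chart A d"
  shows "smooth_on (cmap c ` (cdom c \<inter> cdom d)) (transition c d)"
proof (rule smooth_on_local)
  fix y assume "y \<in> cmap c ` (cdom c \<inter> cdom d)"
  then obtain p where p: "p \<in> cdom c" "p \<in> cdom d" "y = cmap c p" by auto
  define e where "e = chart_at A p"
  have e: "e \<in> A" "p \<in> cdom e" "smooth_chart A e"
    using chart_at chart_at_smooth by (auto simp: e_def)
  define N where "N = cdom c \<inter> cdom d \<inter> cdom e"
  have N: "open N" unfolding N_def using c d e(3) by (intro open_Int chart_open)
  have oc: "open (cmap c ` N)" and oe: "open (cmap e ` N)"
    using smooth_chart_open_image[OF c N] smooth_chart_open_image[OF e(3) N] by (auto simp: N_def)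
  have ce: "smooth_on (cmap c ` N) (transition c e)" and ed: "smooth_on (cmap e ` N) (transition e d)"
    using c d e(1) by (auto simp: smooth_chart_def compatible_def N_def intro: smooth_on_subset)
  have "smooth_on (cmap c ` N) (\<lambda>y. transition e d (transition c e y))"
    by (rule smooth_on_compose[OF oc oe _ ed ce])
      (auto simp: N_def transition_cmap[OF c])
  moreover have "transition e d (transition c e y) = transition c d y" if "y \<in> cmap c ` N" for y
    using that by (auto simp: N_def transition_cmap[OF c] transition_cmap[OF e(3)])
  ultimately have "smooth_on (cmap c ` N) (transition c d)"
    using smooth_on_cong[OF oc] by metis
  then show "\<exists>T. open T \<and> y \<in> T \<and> smooth_on T (transition c d)"
    using oc p e(2) by (intro exI[of _ "cmap c ` N"]) (auto simp: N_def)
qed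

lemma transition_open:
  "smooth_chart A c \<Longrightarrow> smooth_chart A d \<Longrightarrow> open (cmap c ` (cdom c \<inter> cdom d))"
  by (metis Int_lower1 open_Int smooth_chart_open smooth_chart_open_image)

lemma transition_has_derivative:
  assumes "smooth_chart A c" "smooth_chart A d" "p \<in> cdom c" "p \<in> cdom d"
  shows "(transition c d has_derivative blinfun_apply (tangent_change c d p)) (at (cmap c p))"
proof -
  have "transition c d differentiable (at (cmap c p))"
    using assms by (intro smooth_on_differentiable[OF transition_smooth]) auto
  then have D: "(transition c d has_derivative fderiv (transition c d) (cmap c p)) (at (cmap c p))"
    by (rule has_derivative_frechet)
  then show ?thesis
    by (simp add: tangent_change_def bounded_linear_Blinfun_apply has_derivative_bounded_linear)
qed

lemma frechet_derivative_transition: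
  assumes "smooth_chart A c" "smooth_chart A d" "p \<in> cdom c" "p \<in> cdom d"
  shows "fderiv (transition c d) (cmap c p) = blinfun_apply (tangent_change c d p)"
  using frechet_derivative_at[OF transition_has_derivative[OF assms]] by simp

lemma tangent_change_compose:
  assumes c: "smooth_chart A c" "p \<in> cdom c" and d: "smooth_chart A d" "p \<in> cdom d"
    and e: "smooth_chart A e" "p \<in> cdom e"
  shows "tangent_change d e p (tangent_change c d p v) = tangent_change c e p v"
proof -
  have N: "open (cdom c \<inter> cdom d)"
    using c d by auto
  have "((\<lambda>y. transition d e (transition c d y)) has_derivative
      (\<lambda>v. tangent_change d e p (tangent_change c d p v))) (at (cmap c p))"
    using transition_has_derivative[OF d(1) e(1) d(2) e(2)] c d
    by (intro has_derivative_compose[OF transition_has_derivative[OF c(1) d(1) c(2) d(2)]])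
      (auto simp: transition_cmap)
  then have "(transition c e has_derivative
      (\<lambda>v. tangent_change d e p (tangent_change c d p v))) (at (cmap c p))"
    by (rule has_derivative_transform_within_open[OF _ smooth_chart_open_image[OF c(1) N]])
      (use c d in \<open>auto simp: transition_cmap\<close>)
  then show ?thesis
    using frechet_derivative_eqI frechet_derivative_transition[OF c(1) e(1) c(2) e(2)] by metis
qed

lemma tangent_change_refl:
  assumes c: "smooth_chart A c" "p \<in> cdom c"
  shows "tangent_change c c p v = v"
proof -
  have "(transition c c has_derivative (\<lambda>v. v)) (at (cmap c p))"
    by (rule has_derivative_transform_within_open[OF has_derivative_ident
          smooth_chart_open_image[OF c(1) smooth_chart_open[OF c(1)]]])
      (use c in \<open>auto simp: transition_cmap\<close>)
  then show ?thesis
    using frechet_derivative_eqI frechet_derivative_transition[OF c(1) c(1) c(2) c(2)] by metis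
qed

lemma to_from_chart:
  assumes "smooth_chart A c" "p \<in> cdom c" "smooth_chart A d" "p \<in> cdom d"
  shows "to_chart A d p (from_chart A c p v) = tangent_change c d p v"
  unfolding to_chart_def from_chart_def
  using assms chart_at chart_at_smooth by (intro tangent_change_compose) auto

lemma to_from_chart_id [simp]:
  "smooth_chart A c \<Longrightarrow> p \<in> cdom c \<Longrightarrow> to_chart A c p (from_chart A c p v) = v"
  by (simp add: to_from_chart tangent_change_refl)

lemma from_to_chart_id [simp]:
  "smooth_chart A c \<Longrightarrow> p \<in> cdom c \<Longrightarrow> from_chart A c p (to_chart A c p v) = v"
  unfolding to_chart_def from_chart_def
  using chart_at chart_at_smooth by (simp add: tangent_change_compose tangent_change_refl)

lemma to_chart_change:
  assumes "smooth_chart A c" "p \<in> cdom c" "smooth_chart A d" "p \<in> cdom d"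
  shows "tangent_change c d p (to_chart A c p v) = to_chart A d p v"
  unfolding to_chart_def
  using assms chart_at chart_at_smooth by (intro tangent_change_compose) auto

lemma chart_at_id [simp]:
  "to_chart A (chart_at A p) p = id_blinfun" "from_chart A (chart_at A p) p = id_blinfun"
  unfolding to_chart_def from_chart_def
  using chart_at chart_at_smooth by (auto intro!: blinfun_eqI simp: tangent_change_refl)

text \<open>Lets smoothness be tested near each point in a chart suited to that point; the charts of
  \<open>A\<close> are then reached by transition maps.\<close>

lemma smooth_fun_localI:
  assumes "\<And>p. p \<in> U \<Longrightarrow> \<exists>c N. smooth_chart A c \<and> open N \<and> p \<in> N \<and> N \<subseteq> cdom c \<and> N \<subseteq> U \<and>
      smooth_on (cmap c ` N) (\<lambda>y. f (cinv c y))"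
  shows "smooth_fun A U f"
  unfolding smooth_fun_def
proof (intro ballI smooth_on_local)
  fix d y assume dA: "d \<in> A" and "y \<in> cmap d ` (U \<inter> cdom d)"
  then obtain p where p: "p \<in> U" "p \<in> cdom d" "y = cmap d p" by auto
  have d: "smooth_chart A d" using dA atlas_smooth_chart by blast
  obtain c N where c: "smooth_chart A c" and N: "open N" "p \<in> N" "N \<subseteq> cdom c" "N \<subseteq> U"
    and s: "smooth_on (cmap c ` N) (\<lambda>y. f (cinv c y))"
    using assms[OF p(1)] by auto
  have N': "open (N \<inter> cdom d)" using N d by auto
  have od: "open (cmap d ` (N \<inter> cdom d))" by (rule smooth_chart_open_image[OF d N']) auto
  have oc: "open (cmap c ` N)" by (rule smooth_chart_open_image[OF c N(1,3)])
  have "smooth_on (cmap d ` (N \<inter> cdom d)) (\<lambda>y. f (cinv c (transition d c y)))"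
    by (rule smooth_on_compose[OF od oc _ s smooth_on_subset[OF transition_smooth[OF d c]]])
      (use N in \<open>auto simp: transition_cmap[OF d]\<close>)
  moreover have "f (cinv c (transition d c y)) = (f \<circ> cinv d) y" if "y \<in> cmap d ` (N \<inter> cdom d)" for y
    using that N c d by (auto simp: transition_cmap[OF d] smooth_chart_cinv)
  ultimately have "smooth_on (cmap d ` (N \<inter> cdom d)) (f \<circ> cinv d)"
    using smooth_on_cong[OF od] by metis
  then show "\<exists>T. open T \<and> y \<in> T \<and> smooth_on T (f \<circ> cinv d)"
    using od p N by (intro exI[of _ "cmap d ` (N \<inter> cdom d)"]) auto
qed

lemma vf_in_change:
  assumes "smooth_chart A c" "p \<in> cdom c" "smooth_chart A d" "p \<in> cdom d"
  shows "vf_in A d X (cmap d p) = tangent_change c d p (vf_in A c X (cmap c p))"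
  using assms by (simp add: vf_in_def smooth_chart_cinv to_chart_change)

lemma vector_field_localI:
  assumes "\<And>p. p \<in> U \<Longrightarrow> \<exists>c N. smooth_chart A c \<and> open N \<and> p \<in> N \<and> N \<subseteq> cdom c \<and> N \<subseteq> U \<and>
      smooth_on (cmap c ` N) (vf_in A c X)"
  shows "vector_field A U X"
  unfolding vector_field_def
proof (intro ballI smooth_on_local)
  fix d y assume dA: "d \<in> A" and "y \<in> cmap d ` (U \<inter> cdom d)"
  then obtain p where p: "p \<in> U" "p \<in> cdom d" "y = cmap d p" by auto
  have d: "smooth_chart A d" using dA atlas_smooth_chart by blast
  obtain c N where c: "smooth_chart A c" and N: "open N" "p \<in> N" "N \<subseteq> cdom c" "N \<subseteq> U"
    and s: "smooth_on (cmap c ` N) (vf_in A c X)"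
    using assms[OF p(1)] by auto
  define M where "M = N \<inter> cdom d"
  have M: "open M" "M \<subseteq> cdom c" "M \<subseteq> cdom d" using N d by (auto simp: M_def)
  have yM: "y \<in> cmap d ` M" using p N by (simp add: M_def)
  have od: "open (cmap d ` M)" by (rule smooth_chart_open_image[OF d M(1,3)])
  have oc: "open (cmap c ` M)" by (rule smooth_chart_open_image[OF c M(1,2)])
  have t: "smooth_on (cmap c ` M) (transition c d)" "smooth_on (cmap d ` M) (transition d c)"
    using transition_smooth[OF c d] transition_smooth[OF d c] M by (auto intro: smooth_on_subset)
  have into: "transition d c ` cmap d ` M \<subseteq> cmap c ` M"
    using M by (auto simp: transition_cmap[OF d])
  have sX: "smooth_on (cmap c ` M) (vf_in A c X)"
    by (rule smooth_on_subset[OF s]) (auto simp: M_def)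
  have "smooth_on (cmap d ` M) (\<lambda>y. \<Sum>i\<in>Basis. (vf_in A c X (transition d c y) \<bullet> i) *\<^sub>R
      fderiv (transition c d) (transition d c y) i)"
    by (intro smooth_on_sum od smooth_on_scaleR smooth_on_inner_left smooth_on_compose[OF od oc into sX t(2)]
        smooth_on_compose[OF od oc into smooth_on_frechet[OF t(1)] t(2)])
  moreover have "vf_in A d X y = (\<Sum>i\<in>Basis. (vf_in A c X (transition d c y) \<bullet> i) *\<^sub>R
      fderiv (transition c d) (transition d c y) i)" if y: "y \<in> cmap d ` M" for y
  proof -
    obtain q where q: "q \<in> M" "y = cmap d q" using y by auto
    then have qc: "q \<in> cdom c" "q \<in> cdom d" using M by auto
    have "vf_in A d X y = fderiv (transition c d) (cmap c q) (vf_in A c X (cmap c q))"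
      unfolding q(2) vf_in_change[OF c qc(1) d qc(2)] frechet_derivative_transition[OF c d qc] ..
    also have "\<dots> = (\<Sum>i\<in>Basis. (vf_in A c X (cmap c q) \<bullet> i) *\<^sub>R fderiv (transition c d) (cmap c q) i)"
      using q by (intro frechet_derivative_basis smooth_on_differentiable[OF t(1)]) auto
    finally show ?thesis using q qc d by (simp add: transition_cmap)
  qed
  ultimately have "smooth_on (cmap d ` M) (vf_in A d X)"
    by (rule smooth_on_eqI[OF od])
  then show "\<exists>T. open T \<and> y \<in> T \<and> smooth_on T (vf_in A d X)"
    using od yM by blast
qed

text \<open>Chart independence of the differential: the chain rule applied to the transition from
  the preferred chart.\<close>

lemma fun_differential_chart:
  assumes c: "smooth_chart A c" "p \<in> cdom c" and f: "(f \<circ> cinv c) differentiable (at (cmap c p))"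
  shows "fun_differential A f p v = fderiv (f \<circ> cinv c) (cmap c p) (to_chart A c p v)"
proof -
  define b where "b = chart_at A p"
  have b: "smooth_chart A b" "p \<in> cdom b" using chart_at chart_at_smooth by (auto simp: b_def)
  have N: "open (cdom c \<inter> cdom b)" using b c by auto
  have "((\<lambda>y. (f \<circ> cinv c) (transition b c y)) has_derivative
      (\<lambda>v. fderiv (f \<circ> cinv c) (cmap c p) (tangent_change b c p v))) (at (cmap b p))"
    by (rule has_derivative_compose[OF transition_has_derivative[OF b(1) c(1) b(2) c(2)]])
      (simp only: transition_cmap[OF b] has_derivative_frechet[OF f])
  then have D: "((f \<circ> cinv b) has_derivative
      (\<lambda>v. fderiv (f \<circ> cinv c) (cmap c p) (tangent_change b c p v))) (at (cmap b p))"
    by (rule has_derivative_transform_within_open[OF _ smooth_chart_open_image[OF b(1) N]])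
      (use b c in \<open>auto simp: transition_cmap smooth_chart_cinv\<close>)
  have "fun_differential A f p = Blinfun (fderiv (f \<circ> cinv b) (cmap b p))"
    by (simp add: fun_differential_def b_def Let_def)
  then show ?thesis
    using frechet_derivative_at[OF D, symmetric] has_derivative_bounded_linear[OF D]
    by (simp add: bounded_linear_Blinfun_apply to_chart_def b_def)
qed

lemma chart_fun_differentiable:
  assumes "smooth_fun A U f" "open U" "p \<in> U" "c \<in> A" "p \<in> cdom c"
  shows "(f \<circ> cinv c) differentiable (at (cmap c p))"
  using assms by (intro smooth_on_differentiable[of "cmap c ` (U \<inter> cdom c)"]) (auto simp: smooth_fun_def)

section \<open>Cut-offs and global extensions\<close>

text \<open>\<open>K\<close> is closed because \<open>M\<close> is Hausdorff.\<close>

lemma exists_cutoff: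
  assumes c: "smooth_chart A c" "p \<in> cdom c"
  obtains \<eta> :: "'e \<Rightarrow> real" and K where "smooth_on UNIV \<eta>" "\<eta> (cmap c p) = 1" "closed K" "K \<subseteq> cdom c"
    "\<forall>q\<in>cdom c - K. \<eta> (cmap c q) = 0"
proof -
  have "open (cimage c)" using c by (auto simp: smooth_chart_def is_chart_def)
  then obtain r where r: "0 < r" "cball (cmap c p) r \<subseteq> cimage c"
    using c(2) open_contains_cball by blast
  obtain \<eta> :: "'e \<Rightarrow> real" where \<eta>: "smooth_on UNIV \<eta>" "\<eta> (cmap c p) = 1" "\<forall>y. y \<notin> cball (cmap c p) r \<longrightarrow> \<eta> y = 0"
    by (rule exists_smooth_bump[OF r(1), of "cmap c p"])
  define K where "K = cinv c ` cball (cmap c p) r"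
  have "continuous_on (cimage c) (cinv c)"
    using c by (auto simp: smooth_chart_def is_chart_def homeomorphism_def)
  then have "compact K"
    unfolding K_def using r by (intro compact_continuous_image) (auto intro: continuous_on_subset)
  then have "closed K" by (rule compact_imp_closed)
  moreover have "K \<subseteq> cdom c" using r by (auto simp: K_def intro: cinv_mem)
  moreover have "\<eta> (cmap c q) = 0" if "q \<in> cdom c" "q \<notin> K" for q
  proof (rule \<eta>(3)[rule_format])
    show "cmap c q \<notin> cball (cmap c p) r"
    proof
      assume "cmap c q \<in> cball (cmap c p) r"
      then have "cinv c (cmap c q) \<in> K" by (simp add: K_def)
      then show False using that c(1) by (simp add: smooth_chart_cinv)
    qed
  qed
  ultimately show thesis using that \<eta> by blast
qed

text \<open>With \<open>K\<close> containing the support of a cut-off, an object extended by zero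
  vanishes on these neighbourhoods, which settles its smoothness outside the chart.\<close>

lemma chart_off_closed:
  assumes "closed K" "q \<notin> K"
  obtains d N where "smooth_chart A d" "open N" "N \<subseteq> cdom d" "q \<in> N" "N \<inter> K = {}"
  using assms chart_at[of q] chart_at_smooth[of q]
  by (intro that[of "chart_at A q" "cdom (chart_at A q) - K"]) auto

text \<open>An affine coordinate function vanishing at \<open>p\<close>, times a cut-off equal to 1
  there: the derivative of the cut-off is multiplied by zero at \<open>p\<close>.\<close>

lemma exists_function_with_differential:
  obtains f where "smooth_fun A UNIV f" "fun_differential A f p = a"
proof -
  define c where "c = chart_at A p"
  have cA: "c \<in> A" and c: "smooth_chart A c" "p \<in> cdom c"
    using chart_at chart_at_smooth by (auto simp: c_def)
  obtain \<eta> :: "'e \<Rightarrow> real" and K where \<eta>: "smooth_on UNIV \<eta>" "\<eta> (cmap c p) = 1" and K: "closed K" "K \<subseteq> cdom c"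
    and \<eta>0: "\<forall>q\<in>cdom c - K. \<eta> (cmap c q) = 0"
    by (rule exists_cutoff[OF c])
  define g where "g = (\<lambda>y. \<eta> y * blinfun_apply a (y - cmap c p))"
  define f where "f = (\<lambda>q. if q \<in> cdom c then g (cmap c q) else 0)"
  have oc: "open (cimage c)" using c by (auto simp: smooth_chart_def is_chart_def)
  have lin: "smooth_on S (\<lambda>y. blinfun_apply a (y - cmap c p))" if "open S" for S
    by (intro smooth_on_bounded_linear[OF that blinfun.bounded_linear_right] smooth_on_diff
        smooth_on_ident smooth_on_const that)
  have g: "smooth_on (cimage c) g"
    unfolding g_def by (intro smooth_on_mult oc smooth_on_subset[OF \<eta>(1)] lin) auto
  have fg: "(f \<circ> cinv c) y = g y" if "y \<in> cimage c" for y
    using that c by (auto simp: f_def smooth_chart_cinv)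
  have "smooth_fun A UNIV f"
  proof (rule smooth_fun_localI)
    fix q
    show "\<exists>c N. smooth_chart A c \<and> open N \<and> q \<in> N \<and> N \<subseteq> cdom c \<and> N \<subseteq> UNIV \<and>
      smooth_on (cmap c ` N) (\<lambda>y. f (cinv c y))"
    proof (cases "q \<in> cdom c")
      case True
      have "smooth_on (cimage c) (\<lambda>y. f (cinv c y))"
        using g fg smooth_on_cong[OF oc, of "f \<circ> cinv c" g] by (simp add: comp_def)
      then show ?thesis using True c smooth_chart_open by blast
    next
      case False
      then obtain d N where d: "smooth_chart A d" and N: "open N" "N \<subseteq> cdom d" "q \<in> N" "N \<inter> K = {}"
        using chart_off_closed[OF K(1)] K(2) by blast
      have "f (cinv d y) = 0" if "y \<in> cmap d ` N" for y
        using that N d \<eta>0 by (auto simp: f_def g_def smooth_chart_cinv disjoint_iff)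
      then have "smooth_on (cmap d ` N) (\<lambda>y. f (cinv d y))"
        using smooth_on_cong[OF smooth_chart_open_image[OF d N(1,2)], of "\<lambda>y. f (cinv d y)" "\<lambda>y. 0"] by simp
      then show ?thesis using N d by blast
    qed
  qed
  moreover have "fun_differential A f p = a"
  proof (rule blinfun_eqI)
    fix v
    have "\<eta> differentiable (at (cmap c p))"
      using \<eta>(1) smooth_on_differentiable by blast
    from has_derivative_frechet[OF this]
    have "(g has_derivative (\<lambda>v. \<eta> (cmap c p) * blinfun_apply a v
        + fderiv \<eta> (cmap c p) v * blinfun_apply a (cmap c p - cmap c p))) (at (cmap c p))"
      unfolding g_def
      by (intro has_derivative_mult bounded_linear.has_derivative[OF blinfun.bounded_linear_right])
        (auto intro!: derivative_eq_intros)
    then have "(g has_derivative blinfun_apply a) (at (cmap c p))"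
      using \<eta>(2) by simp
    then have D: "((f \<circ> cinv c) has_derivative blinfun_apply a) (at (cmap c p))"
      by (rule has_derivative_transform_within_open[OF _ oc]) (use c fg in auto)
    then show "fun_differential A f p v = a v"
      using fun_differential_chart[OF c differentiableI[OF D], of v] frechet_derivative_eqI[OF D]
      by (simp add: c_def)
  qed
  ultimately show thesis using that by blast
qed

text \<open>A constant coordinate field, cut off. Projected to \<open>F\<close>, such fields are the
  test fields from which the jet condition for projectability is read off.\<close>

lemma exists_vector_field_through:
  obtains Y where "vector_field A UNIV Y" "Y p = v"
proof -
  define c where "c = chart_at A p"
  have cA: "c \<in> A" and c: "smooth_chart A c" "p \<in> cdom c"
    using chart_at chart_at_smooth by (auto simp: c_def)
  obtain \<eta> :: "'e \<Rightarrow> real" and K where \<eta>: "smooth_on UNIV \<eta>" "\<eta> (cmap c p) = 1" and K: "closed K" "K \<subseteq> cdom c"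
    and \<eta>0: "\<forall>q\<in>cdom c - K. \<eta> (cmap c q) = 0"
    by (rule exists_cutoff[OF c])
  define Y where "Y = (\<lambda>q. if q \<in> cdom c then from_chart A c q (\<eta> (cmap c q) *\<^sub>R v) else 0)"
  have oc: "open (cimage c)" using c by (auto simp: smooth_chart_def is_chart_def)
  have "vector_field A UNIV Y"
  proof (rule vector_field_localI)
    fix q
    show "\<exists>c N. smooth_chart A c \<and> open N \<and> q \<in> N \<and> N \<subseteq> cdom c \<and> N \<subseteq> UNIV \<and>
      smooth_on (cmap c ` N) (vf_in A c Y)"
    proof (cases "q \<in> cdom c")
      case True
      have "vf_in A c Y y = \<eta> y *\<^sub>R v" if "y \<in> cimage c" for y
        using that c by (auto simp: Y_def vf_in_def smooth_chart_cinv)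
      moreover have "smooth_on (cimage c) (\<lambda>y. \<eta> y *\<^sub>R v)"
        by (intro smooth_on_scaleR oc smooth_on_subset[OF \<eta>(1)] smooth_on_const) auto
      ultimately have "smooth_on (cimage c) (vf_in A c Y)"
        using smooth_on_cong[OF oc] by metis
      then show ?thesis using True c smooth_chart_open by blast
    next
      case False
      then obtain d N where d: "smooth_chart A d" and N: "open N" "N \<subseteq> cdom d" "q \<in> N" "N \<inter> K = {}"
        using chart_off_closed[OF K(1)] K(2) by blast
      have "vf_in A d Y y = 0" if "y \<in> cmap d ` N" for y
        using that N d \<eta>0 by (auto simp: Y_def vf_in_def smooth_chart_cinv disjoint_iff)
      then have "smooth_on (cmap d ` N) (vf_in A d Y)"
        using smooth_on_cong[OF smooth_chart_open_image[OF d N(1,2)], of "vf_in A d Y" "\<lambda>y. 0"] by simp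
      then show ?thesis using N d by blast
    qed
  qed
  moreover have "Y p = v" using c \<eta>(2) by (simp add: Y_def c_def)
  ultimately show thesis using that by blast
qed

end

section \<open>Bivectors\<close>

lemma covector_separates:
  fixes v w :: "'e::euclidean_space"
  assumes "\<And>b :: 'e \<Rightarrow>\<^sub>L real. blinfun_apply b v = blinfun_apply b w"
  shows "v = w"
  using assms[of "blinfun_inner_right _"] by (auto intro: euclidean_eqI simp: inner_commute)

text \<open>In finite dimension the functional \<open>B a\<close> on covectors is evaluation at a
  vector, whose components are its values on the dual basis. This resolves the \<open>THE\<close> in
  \<open>sharp\<close>.\<close>

lemma sharp_apply:
  fixes B :: "('e::euclidean_space \<Rightarrow>\<^sub>L real) \<Rightarrow> ('e \<Rightarrow>\<^sub>L real) \<Rightarrow> real"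
  assumes "bilinear B"
  shows "blinfun_apply b (sharp B a) = B a b"
proof -
  define v where "v = (\<Sum>i\<in>Basis. B a (blinfun_inner_right i) *\<^sub>R i)"
  have v: "blinfun_apply b v = B a b" for b
  proof -
    have "B a b = B a (\<Sum>i\<in>Basis. blinfun_apply b i *\<^sub>R blinfun_inner_right i)"
      by (rule arg_cong[of b]) (use coord_system_covector in \<open>unfold coord_system_def, blast\<close>)
    also have "\<dots> = (\<Sum>i\<in>Basis. blinfun_apply b i * B a (blinfun_inner_right i))"
      using assms by (simp add: bilinear_def linear_sum linear_scale)
    finally show ?thesis
      by (simp add: v_def blinfun.sum_right blinfun.scaleR_right mult.commute)
  qed
  have "sharp B a = v"
    unfolding sharp_def
  proof (rule the_equality)
    show "\<forall>b. blinfun_apply b v = B a b" using v by blast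
    show "w = v" if "\<forall>b. blinfun_apply b w = B a b" for w
      using that v covector_separates by metis
  qed
  then show ?thesis using v by simp
qed

lemma sharp_eqI: "bilinear B \<Longrightarrow> (\<And>b. blinfun_apply b v = B a b) \<Longrightarrow> sharp B a = v"
  by (rule covector_separates) (metis sharp_apply)

lemma bilinear_alternating_skew:
  assumes "bilinear B" "\<And>a. B a a = (0::real)"
  shows "B a b = - B b a"
  using assms(2)[of "a + b"] assms(2)[of a] assms(2)[of b]
  by (simp add: bilinear_ladd[OF assms(1)] bilinear_radd[OF assms(1)])

lemma bivector_fieldD:
  assumes "bivector_field A B"
  shows "bilinear (B p)" "B p a b = - B p b a"
  using assms bilinear_alternating_skew unfolding bivector_field_def by blast+

lemma blinfun_compose_linear:
  "linear (\<lambda>a :: 'b::real_normed_vector \<Rightarrow>\<^sub>L 'c::real_normed_vector. a o\<^sub>L (T :: 'a::real_normed_vector \<Rightarrow>\<^sub>L 'b))"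
  by (rule linearI) (auto intro!: blinfun_eqI simp: blinfun.add_left blinfun.scaleR_left)

lemma bilinear_compose:
  assumes "bilinear B" "linear f" "linear g"
  shows "bilinear (\<lambda>a b. B (f a) (g b))"
  unfolding bilinear_def
  by (auto intro!: linearI simp: linear_add[OF assms(2)] linear_add[OF assms(3)] linear_scale[OF assms(2)] linear_scale[OF assms(3)]
      bilinear_ladd[OF assms(1)] bilinear_radd[OF assms(1)] bilinear_lmul[OF assms(1)] bilinear_rmul[OF assms(1)])

lemma bilinear_biv_in:
  assumes "bivector_field A B"
  shows "bilinear (biv_in A c B y)"
proof -
  have "biv_in A c B y = (\<lambda>a b. B (cinv c y) (a o\<^sub>L to_chart A c (cinv c y)) (b o\<^sub>L to_chart A c (cinv c y)))"
    by (intro ext) (simp add: biv_in_def)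
  then show ?thesis
    using bilinear_compose[OF bivector_fieldD(1)[OF assms] blinfun_compose_linear blinfun_compose_linear] by simp
qed

lemma biv_in_skew: "bivector_field A B \<Longrightarrow> biv_in A c B y a b = - biv_in A c B y b a"
  unfolding biv_in_def by (rule bivector_fieldD)

lemma bilinear_apply: "bilinear (\<lambda>(a :: 'e::real_normed_vector \<Rightarrow>\<^sub>L real) v. blinfun_apply a v)"
  unfolding bilinear_def
  by (auto intro!: linearI simp: blinfun.add_left blinfun.add_right blinfun.scaleR_left blinfun.scaleR_right)

text \<open>Half the Schouten-Nijenhuis bracket of \<open>B\<close> with itself, as a trivector: the usual formula on
  functions, evaluated on covectors with constant coefficients in the preferred chart.\<close>

definition biv_deriv :: "('a, 'e::euclidean_space) chart set \<Rightarrow> ('a, 'e) bivfield \<Rightarrow> 'a \<Rightarrow> 'e \<Rightarrow>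
    ('e \<Rightarrow>\<^sub>L real) \<Rightarrow> ('e \<Rightarrow>\<^sub>L real) \<Rightarrow> real" where
  "biv_deriv A B p v a b =
     (let c = chart_at A p in fderiv (\<lambda>y. biv_in A c B y a b) (cmap c p) v)"

text \<open>The sign comes from \<open>\<Lambda>(dk, dh) = - dk(\<sharp>dh)\<close> with
  \<open>k = \<Lambda>(df, dg)\<close>.\<close>

definition half_schouten :: "('a, 'e::euclidean_space) chart set \<Rightarrow> ('a, 'e) bivfield \<Rightarrow> 'a \<Rightarrow>
    ('e \<Rightarrow>\<^sub>L real) \<Rightarrow> ('e \<Rightarrow>\<^sub>L real) \<Rightarrow> ('e \<Rightarrow>\<^sub>L real) \<Rightarrow> real" where
  "half_schouten A B p a b c = - (biv_deriv A B p (sharp (B p) c) a b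
     + biv_deriv A B p (sharp (B p) a) b c + biv_deriv A B p (sharp (B p) b) c a)"

definition vf_deriv :: "('a, 'e::euclidean_space) chart set \<Rightarrow> ('a, 'e) vfield \<Rightarrow> 'a \<Rightarrow> 'e \<Rightarrow> 'e" where
  "vf_deriv A X p = (let c = chart_at A p in fderiv (vf_in A c X) (cmap c p))"

context smooth_manifold
begin

abbreviation ch :: "'a \<Rightarrow> ('a, 'e) chart" where "ch p \<equiv> chart_at A p"

abbreviation org :: "'a \<Rightarrow> 'e" where "org p \<equiv> cmap (ch p) p"

lemma cinv_chart_at [simp]: "cinv (ch p) (org p) = p"
  by (rule smooth_chart_cinv[OF chart_at_smooth chart_at(2)])

lemma chart_image_open: "c \<in> A \<Longrightarrow> open (cimage c)"
  using atlas by (auto simp: smooth_atlas_def is_chart_def)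

lemma biv_in_smooth:
  "bivector_field A B \<Longrightarrow> c \<in> A \<Longrightarrow> smooth_on (cimage c) (\<lambda>y. biv_in A c B y a b)"
  by (auto simp: bivector_field_def)

lemma biv_in_at [simp]: "biv_in A (ch p) B (org p) a b = B p a b"
proof -
  have "x o\<^sub>L id_blinfun = x" for x :: "'e \<Rightarrow>\<^sub>L real"
    by (rule blinfun_eqI) simp
  then show ?thesis
    by (simp add: biv_in_def)
qed

lemma biv_in_differentiable:
  assumes "bivector_field A B"
  shows "(\<lambda>y. biv_in A (ch p) B y a b) differentiable (at (org p))"
  using smooth_on_differentiable[OF biv_in_smooth[OF assms chart_at(1)]] chart_at(2) by auto

lemma bilinear_biv_deriv:
  assumes "bivector_field A B"
  shows "bilinear (biv_deriv A B p v)"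
proof -
  have "biv_deriv A B p v = (\<lambda>a b. fderiv (\<lambda>y. biv_in A (ch p) B y a b) (org p) v)"
    by (intro ext) (simp add: biv_deriv_def Let_def)
  then show ?thesis
    using bilinear_frechet_derivative[OF bilinear_biv_in biv_in_differentiable] assms by metis
qed

lemma linear_biv_deriv:
  assumes "bivector_field A B"
  shows "linear (\<lambda>v. biv_deriv A B p v a b)"
  using linear_frechet_derivative[OF biv_in_differentiable[OF assms]] by (simp add: biv_deriv_def Let_def)

lemma biv_deriv_skew:
  assumes "bivector_field A B"
  shows "biv_deriv A B p v a b = - biv_deriv A B p v b a"
proof -
  have "((\<lambda>y. - biv_in A (ch p) B y b a) has_derivative (\<lambda>v. - biv_deriv A B p v b a))
      (at (org p))"
    unfolding biv_deriv_def Let_def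
    by (intro has_derivative_minus has_derivative_frechet biv_in_differentiable assms)
  then have "fderiv (\<lambda>y. - biv_in A (ch p) B y b a) (org p) v
      = - biv_deriv A B p v b a"
    by (rule frechet_derivative_eqI)
  moreover have "(\<lambda>y. biv_in A (ch p) B y a b) = (\<lambda>y. - biv_in A (ch p) B y b a)"
    using biv_in_skew[OF assms] by blast
  ultimately show ?thesis
    by (simp add: biv_deriv_def Let_def)
qed

lemma vf_in_at [simp]: "vf_in A (ch p) X (org p) = X p"
  by (simp add: vf_in_def)

lemma vf_in_has_derivative:
  assumes "vector_field A U X" "open U" "p \<in> U"
  shows "(vf_in A (ch p) X has_derivative vf_deriv A X p) (at (org p))"
proof -
  have "vf_in A (ch p) X differentiable (at (org p))"
    using assms chart_at
    by (intro smooth_on_differentiable[of "cmap (ch p) ` (U \<inter> cdom (ch p))"])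
      (auto simp: vector_field_def)
  from has_derivative_frechet[OF this] show ?thesis by (simp add: vf_deriv_def Let_def)
qed

text \<open>Skewness turns \<open>B (a o DX) b\<close> into \<open>- a (DX (\<sharp>b))\<close>, so
  the derivative of \<open>X\<close> is evaluated at sharps only, where its values are known for
  projectable fields.\<close>

lemma lie_deriv_biv_eq:
  assumes B: "bivector_field A B" and X: "vector_field A U X" "open U" "p \<in> U"
  shows "lie_deriv_biv A X B p a b = biv_deriv A B p (X p) a b
    + blinfun_apply a (vf_deriv A X p (sharp (B p) b)) - blinfun_apply b (vf_deriv A X p (sharp (B p) a))"
proof -
  have bl: "bounded_linear (vf_deriv A X p)"
    using vf_in_has_derivative[OF X] by (rule has_derivative_bounded_linear)
  have "B p (x o\<^sub>L Blinfun (vf_deriv A X p)) y = - blinfun_apply x (vf_deriv A X p (sharp (B p) y))"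
    and "B p y (x o\<^sub>L Blinfun (vf_deriv A X p)) = blinfun_apply x (vf_deriv A X p (sharp (B p) y))" for x y
    using sharp_apply[OF bivector_fieldD(1)[OF B], where b = "x o\<^sub>L Blinfun (vf_deriv A X p)" and a = y]
      bivector_fieldD(2)[OF B, of p "x o\<^sub>L Blinfun (vf_deriv A X p)" y]
    by (simp_all add: bounded_linear_Blinfun_apply[OF bl])
  then show ?thesis
    by (simp add: lie_deriv_biv_def biv_deriv_def vf_deriv_def Let_def)
qed

lemma half_schouten_cyclic: "half_schouten A B p a b c = half_schouten A B p b c a"
  by (simp add: half_schouten_def)

text \<open>With cyclic symmetry, additivity in one slot gives it in all three, which is what the
  splitting into types uses.\<close>

lemma half_schouten_add:
  assumes B: "bivector_field A B"
  shows "half_schouten A B p (a + a') b c = half_schouten A B p a b c + half_schouten A B p a' b c"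
proof -
  have "sharp (B p) (a + a') = sharp (B p) a + sharp (B p) a'"
    by (rule sharp_eqI[OF bivector_fieldD(1)[OF B]])
      (simp add: blinfun.add_right sharp_apply[OF bivector_fieldD(1)[OF B]] bilinear_ladd[OF bivector_fieldD(1)[OF B]])
  then show ?thesis
    by (simp add: half_schouten_def linear_add[OF linear_biv_deriv[OF B]] bilinear_ladd[OF bilinear_biv_deriv[OF B]]
        bilinear_radd[OF bilinear_biv_deriv[OF B]])
qed

section \<open>The Jacobi identity in terms of tensors\<close>

definition chart_diff :: "('a, 'e) chart \<Rightarrow> ('a \<Rightarrow> real) \<Rightarrow> 'e \<Rightarrow> 'e \<Rightarrow>\<^sub>L real" where
  "chart_diff c f y = Blinfun (fderiv (f \<circ> cinv c) y)"

text \<open>The derivative of \<open>chart_diff\<close> in direction \<open>v\<close>, assembled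
  from its components so that it is a covector by construction.\<close>

definition chart_hessian :: "('a, 'e) chart \<Rightarrow> ('a \<Rightarrow> real) \<Rightarrow> 'e \<Rightarrow> 'e \<Rightarrow> 'e \<Rightarrow>\<^sub>L real" where
  "chart_hessian c f y v = (\<Sum>i\<in>Basis.
     fderiv (\<lambda>y. fderiv (f \<circ> cinv c) y i) y v *\<^sub>R blinfun_inner_right i)"

context
  fixes c f
  assumes c: "c \<in> A" and f: "smooth_fun A UNIV f"
begin

lemma chart_fun_smooth: "smooth_on (cimage c) (f \<circ> cinv c)"
  using c f by (auto simp: smooth_fun_def)

lemma chart_diff_apply:
  assumes "y \<in> cimage c"
  shows "blinfun_apply (chart_diff c f y) = fderiv (f \<circ> cinv c) y"
  using has_derivative_bounded_linear[OF has_derivative_frechet[OF smooth_on_differentiable[OF chart_fun_smooth assms]]]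
  by (simp add: chart_diff_def bounded_linear_Blinfun_apply)

lemma chart_diff_smooth: "smooth_on (cimage c) (\<lambda>y. blinfun_apply (chart_diff c f y) v)"
  by (rule smooth_on_eqI[OF chart_image_open[OF c] smooth_on_frechet[OF chart_fun_smooth]])
    (simp add: chart_diff_apply)

lemma fun_differential_chart_diff:
  assumes "y \<in> cimage c"
  shows "fun_differential A f (cinv c y) = chart_diff c f y o\<^sub>L to_chart A c (cinv c y)"
proof (rule blinfun_eqI)
  fix v
  have "(f \<circ> cinv c) differentiable (at (cmap c (cinv c y)))"
    unfolding cmap_cinv[OF assms] by (rule smooth_on_differentiable[OF chart_fun_smooth assms])
  then show "blinfun_apply (fun_differential A f (cinv c y)) v
      = blinfun_apply (chart_diff c f y o\<^sub>L to_chart A c (cinv c y)) v"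
    using fun_differential_chart[OF atlas_smooth_chart[OF c] cinv_mem[OF assms]]
    by (simp add: chart_diff_apply[OF assms] cmap_cinv[OF assms])
qed

lemma chart_hessian_basis:
  assumes "y \<in> cimage c" "i \<in> Basis"
  shows "blinfun_apply (chart_hessian c f y v) i
    = fderiv (\<lambda>y. fderiv (f \<circ> cinv c) y i) y v"
  unfolding chart_hessian_def by (rule covector_of_components[OF assms(2)])

lemma chart_diff_has_derivative:
  assumes "y \<in> cimage c" "i \<in> Basis"
  shows "((\<lambda>y. blinfun_apply (chart_diff c f y) i) has_derivative
    (\<lambda>v. blinfun_apply (chart_hessian c f y v) i)) (at y)"
proof -
  have "((\<lambda>y. fderiv (f \<circ> cinv c) y i) has_derivative
      (\<lambda>v. blinfun_apply (chart_hessian c f y v) i)) (at y)"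
    unfolding chart_hessian_basis[OF assms]
    by (intro has_derivative_frechet smooth_on_differentiable[OF smooth_on_frechet[OF chart_fun_smooth] assms(1)])
  then show ?thesis
    by (rule has_derivative_transform_within_open[OF _ chart_image_open[OF c] assms(1)])
      (simp add: chart_diff_apply)
qed

lemma chart_hessian_symmetric:
  assumes y: "y \<in> cimage c"
  shows "blinfun_apply (chart_hessian c f y v) w = blinfun_apply (chart_hessian c f y w) v"
proof -
  define H where "H = (\<lambda>v i. fderiv (\<lambda>y. fderiv (f \<circ> cinv c) y i) y v)"
  have d: "(\<lambda>y. fderiv (f \<circ> cinv c) y i) differentiable (at y)" for i
    using smooth_on_differentiable[OF smooth_on_frechet[OF chart_fun_smooth] y] .
  have e: "blinfun_apply (chart_hessian c f y v) w
      = (\<Sum>i\<in>Basis. \<Sum>j\<in>Basis. (w \<bullet> i) * (v \<bullet> j) * H j i)" for v w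
  proof -
    have "blinfun_apply (chart_hessian c f y v) w = (\<Sum>i\<in>Basis. (w \<bullet> i) * H v i)"
      unfolding blinfun_sum_basis[of _ w]
      by (intro sum.cong refl) (simp add: chart_hessian_basis[OF y] H_def)
    also have "\<dots> = (\<Sum>i\<in>Basis. (w \<bullet> i) * (\<Sum>j\<in>Basis. (v \<bullet> j) * H j i))"
      unfolding H_def using frechet_derivative_basis[OF d, of _ v] by simp
    finally show ?thesis by (simp add: sum_distrib_left mult.assoc)
  qed
  have s: "H j i = H i j" for i j
    unfolding H_def by (rule symmetric_second_derivative[OF chart_image_open[OF c] y chart_fun_smooth])
  show ?thesis
    unfolding e by (rule trans[OF sum.swap]) (intro sum.cong refl, subst s, simp)
qed

end

section \<open>The bracket in a chart and its Jacobiator\<close>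

lemma jacobi_bracket_chart:
  assumes c: "c \<in> A" and f: "smooth_fun A UNIV f" and g: "smooth_fun A UNIV g" and y: "y \<in> cimage c"
  shows "jacobi_bracket A B E f g (cinv c y) = biv_in A c B y (chart_diff c f y) (chart_diff c g y)
    + (f \<circ> cinv c) y * blinfun_apply (chart_diff c g y) (vf_in A c E y)
    - (g \<circ> cinv c) y * blinfun_apply (chart_diff c f y) (vf_in A c E y)"
  by (simp add: jacobi_bracket_def fun_differential_chart_diff[OF c f y] fun_differential_chart_diff[OF c g y]
      biv_in_def vf_in_def)

lemma smooth_on_blinfun_apply:
  fixes T :: "'b::euclidean_space \<Rightarrow> 'e \<Rightarrow>\<^sub>L 'c::real_normed_vector"
  assumes "open S" "\<And>i. smooth_on S (\<lambda>y. blinfun_apply (T y) i)" "smooth_on S X"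
  shows "smooth_on S (\<lambda>y. blinfun_apply (T y) (X y))"
proof -
  have "(\<lambda>y. blinfun_apply (T y) (X y)) = (\<lambda>y. \<Sum>i\<in>Basis. (X y \<bullet> i) *\<^sub>R blinfun_apply (T y) i)"
    by (rule ext) (rule blinfun_sum_basis)
  then show ?thesis
    by (simp only:) (intro smooth_on_sum assms smooth_on_scaleR smooth_on_inner_left)
qed

lemma jacobi_bracket_smooth:
  assumes B: "bivector_field A B" and E: "vector_field A UNIV E"
    and f: "smooth_fun A UNIV f" and g: "smooth_fun A UNIV g"
  shows "smooth_fun A UNIV (jacobi_bracket A B E f g)"
  unfolding smooth_fun_def
proof
  fix c assume c: "c \<in> A"
  note o = chart_image_open[OF c]
  have Es: "smooth_on (cimage c) (vf_in A c E)"
    using E c by (auto simp: vector_field_def)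
  note df = chart_diff_smooth[OF c f] and dg = chart_diff_smooth[OF c g]
  have "smooth_on (cimage c) (\<lambda>y. biv_in A c B y (chart_diff c f y) (chart_diff c g y)
    + (f \<circ> cinv c) y * blinfun_apply (chart_diff c g y) (vf_in A c E y)
    - (g \<circ> cinv c) y * blinfun_apply (chart_diff c f y) (vf_in A c E y))"
    by (rule smooth_on_diff[OF o smooth_on_add[OF o smooth_on_bilinear_covectors[OF o bilinear_biv_in[OF B] biv_in_smooth[OF B c] df dg]
          smooth_on_mult[OF o chart_fun_smooth[OF c f] smooth_on_blinfun_apply[OF o dg Es]]]
          smooth_on_mult[OF o chart_fun_smooth[OF c g] smooth_on_blinfun_apply[OF o df Es]]])
  then have "smooth_on (cimage c) (jacobi_bracket A B E f g \<circ> cinv c)"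
    by (rule smooth_on_eqI[OF o]) (simp add: jacobi_bracket_chart[OF c f g])
  then show "smooth_on (cmap c ` (UNIV \<inter> cdom c)) (jacobi_bracket A B E f g \<circ> cinv c)" by simp
qed

text \<open>Product rule in the preferred chart. The Hessians are kept as separate covectors so that
  their symmetry can remove them from the Jacobiator.\<close>

lemma fun_differential_bracket:
  fixes p
  defines "c \<equiv> ch p"
  defines "y0 \<equiv> cmap c p"
  assumes B: "bivector_field A B" and E: "vector_field A UNIV E"
    and f: "smooth_fun A UNIV f" and g: "smooth_fun A UNIV g"
  shows "blinfun_apply (fun_differential A (jacobi_bracket A B E f g) p) v =
      biv_deriv A B p v (fun_differential A f p) (fun_differential A g p)
    + B p (chart_hessian c f y0 v) (fun_differential A g p)
    + B p (fun_differential A f p) (chart_hessian c g y0 v)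
    + (blinfun_apply (fun_differential A f p) v * blinfun_apply (fun_differential A g p) (E p)
      + f p * (blinfun_apply (chart_hessian c g y0 v) (E p)
        + blinfun_apply (fun_differential A g p) (vf_deriv A E p v)))
    - (blinfun_apply (fun_differential A g p) v * blinfun_apply (fun_differential A f p) (E p)
      + g p * (blinfun_apply (chart_hessian c f y0 v) (E p)
        + blinfun_apply (fun_differential A f p) (vf_deriv A E p v)))"
proof -
  have c: "c \<in> A" "p \<in> cdom c" "smooth_chart A c" using chart_at chart_at_smooth by (auto simp: c_def)
  have y0: "y0 \<in> cimage c" using c by (simp add: y0_def)
  note o = chart_image_open[OF c(1)]
  have df: "fun_differential A f p = chart_diff c f y0" if f: "smooth_fun A UNIV f" for f
    unfolding fun_differential_def chart_diff_def c_def y0_def Let_def ..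
  have fd: "((f \<circ> cinv c) has_derivative blinfun_apply (chart_diff c f y0)) (at y0)" if f: "smooth_fun A UNIV f" for f
    unfolding chart_diff_apply[OF c(1) f y0]
    by (rule has_derivative_frechet[OF smooth_on_differentiable[OF chart_fun_smooth[OF c(1) f] y0]])
  have fp: "(f \<circ> cinv c) y0 = f p" for f :: "'a \<Rightarrow> real"
    using c by (simp add: y0_def smooth_chart_cinv)
  have Ed: "(vf_in A c E has_derivative vf_deriv A E p) (at y0)"
    using vf_in_has_derivative[OF E] by (simp add: c_def y0_def)
  have Ei: "((\<lambda>y. vf_in A c E y \<bullet> i) has_derivative (\<lambda>v. vf_deriv A E p v \<bullet> i)) (at y0)" for i
    by (intro has_derivative_inner_left Ed)
  have Ep: "vf_in A c E y0 = E p" by (simp add: c_def y0_def)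
  have dfE: "((\<lambda>y. blinfun_apply (chart_diff c f y) (vf_in A c E y)) has_derivative
      (\<lambda>v. blinfun_apply (chart_hessian c f y0 v) (E p) + blinfun_apply (chart_diff c f y0) (vf_deriv A E p v))) (at y0)"
    if f: "smooth_fun A UNIV f" for f
    using has_derivative_bilinear[OF coord_system_covector coord_system_vector bilinear_apply
        differentiable_const chart_diff_has_derivative[OF c(1) f y0] Ei]
    by (simp add: frechet_derivative_const Ep)
  have Bd: "(\<lambda>y. biv_in A c B y a b) differentiable (at y0)" for a b
    using biv_in_differentiable[OF B] by (simp add: c_def y0_def)
  define k where "k y = biv_in A c B y (chart_diff c f y) (chart_diff c g y)
    + (f \<circ> cinv c) y * blinfun_apply (chart_diff c g y) (vf_in A c E y)
    - (g \<circ> cinv c) y * blinfun_apply (chart_diff c f y) (vf_in A c E y)" for y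
  define k' where "k' v = (fderiv (\<lambda>y. biv_in A c B y (chart_diff c f y0) (chart_diff c g y0)) y0 v
    + biv_in A c B y0 (chart_hessian c f y0 v) (chart_diff c g y0)
    + biv_in A c B y0 (chart_diff c f y0) (chart_hessian c g y0 v))
    + ((f \<circ> cinv c) y0 * (blinfun_apply (chart_hessian c g y0 v) (E p) + blinfun_apply (chart_diff c g y0) (vf_deriv A E p v))
      + blinfun_apply (chart_diff c f y0) v * blinfun_apply (chart_diff c g y0) (vf_in A c E y0))
    - ((g \<circ> cinv c) y0 * (blinfun_apply (chart_hessian c f y0 v) (E p) + blinfun_apply (chart_diff c f y0) (vf_deriv A E p v))
      + blinfun_apply (chart_diff c g y0) v * blinfun_apply (chart_diff c f y0) (vf_in A c E y0))" for v
  have "(k has_derivative k') (at y0)"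
    unfolding k_def k'_def
    by (intro has_derivative_diff has_derivative_add has_derivative_mult fd[OF f] fd[OF g] dfE[OF f] dfE[OF g]
        has_derivative_bilinear_covectors[OF bilinear_biv_in[OF B] Bd
          chart_diff_has_derivative[OF c(1) f y0] chart_diff_has_derivative[OF c(1) g y0]])
  then have D: "((jacobi_bracket A B E f g \<circ> cinv c) has_derivative k') (at y0)"
    by (rule has_derivative_transform_within_open[OF _ o y0]) (simp add: k_def jacobi_bracket_chart[OF c(1) f g])
  have "blinfun_apply (fun_differential A (jacobi_bracket A B E f g) p) v
      = fderiv (jacobi_bracket A B E f g \<circ> cinv c) y0 v"
    unfolding df[OF jacobi_bracket_smooth[OF B E f g]] chart_diff_apply[OF c(1) jacobi_bracket_smooth[OF B E f g] y0] ..
  also have "\<dots> = (biv_deriv A B p v (chart_diff c f y0) (chart_diff c g y0)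
    + B p (chart_hessian c f y0 v) (chart_diff c g y0)
    + B p (chart_diff c f y0) (chart_hessian c g y0 v))
    + (f p * (blinfun_apply (chart_hessian c g y0 v) (E p) + blinfun_apply (chart_diff c g y0) (vf_deriv A E p v))
      + blinfun_apply (chart_diff c f y0) v * blinfun_apply (chart_diff c g y0) (E p))
    - (g p * (blinfun_apply (chart_hessian c f y0 v) (E p) + blinfun_apply (chart_diff c f y0) (vf_deriv A E p v))
      + blinfun_apply (chart_diff c g y0) v * blinfun_apply (chart_diff c f y0) (E p))"
    unfolding frechet_derivative_eqI[OF D] k'_def fp Ep
    by (simp add: biv_deriv_def Let_def c_def y0_def)
  finally show ?thesis
    unfolding df[OF f] df[OF g] by simp
qed

text \<open>Hessian terms cancel in pairs by symmetry, and so do the terms quadratic in the values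
  of the functions. The rest separates into a trivector on the differentials and a part linear in
  the values, whose coefficient is \<open>L_E B\<close>.\<close>

lemma jacobiator_eq:
  assumes B: "bivector_field A B" and E: "vector_field A UNIV E"
    and f: "smooth_fun A UNIV f" and g: "smooth_fun A UNIV g" and h: "smooth_fun A UNIV h"
    and a: "a = fun_differential A f p" and b: "b = fun_differential A g p" and c: "c = fun_differential A h p"
  defines "br \<equiv> jacobi_bracket A B E"
  shows "br (br f g) h p + br (br g h) f p + br (br h f) g p =
      half_schouten A B p a b c
      - (blinfun_apply a (E p) * B p b c + blinfun_apply b (E p) * B p c a + blinfun_apply c (E p) * B p a b)
      - (f p * lie_deriv_biv A E B p b c + g p * lie_deriv_biv A E B p c a + h p * lie_deriv_biv A E B p a b)"
proof -
  define Hs where "Hs f v = chart_hessian (ch p) f (org p) v" for f v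
  have Hs: "blinfun_apply (Hs f v) w = blinfun_apply (Hs f w) v" if "smooth_fun A UNIV f" for f v w
    unfolding Hs_def using chart_hessian_symmetric[OF chart_at(1) that] chart_at(2) by blast
  define sh where "sh = sharp (B p)"
  have sh: "B p x y = blinfun_apply y (sh x)" for x y
    using sharp_apply[OF bivector_fieldD(1)[OF B]] by (simp add: sh_def)
  have skew: "blinfun_apply y (sh x) = - blinfun_apply x (sh y)" for x y
    using bivector_fieldD(2)[OF B, of p x y] by (simp add: sh)
  note D = fun_differential_bracket[OF B E, where p = p, folded Hs_def]
  note L = lie_deriv_biv_eq[OF B E open_UNIV UNIV_I, folded sh_def]
  \<comment> \<open>Only the outer bracket is unfolded; the inner one enters through its value and
    its differential.\<close>
  have br1: "br (br f g) h p = - blinfun_apply (fun_differential A (br f g) p) (sh (fun_differential A h p))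
      + br f g p * blinfun_apply (fun_differential A h p) (E p)
      - h p * blinfun_apply (fun_differential A (br f g) p) (E p)" for f g h
    unfolding br_def by (subst jacobi_bracket_def) (simp add: sh skew[of "fun_differential A h p"])
  have br0: "br f g p = blinfun_apply (fun_differential A g p) (sh (fun_differential A f p))
      + f p * blinfun_apply (fun_differential A g p) (E p) - g p * blinfun_apply (fun_differential A f p) (E p)" for f g
    unfolding br_def by (simp add: jacobi_bracket_def sh)
  have Bl: "B p (Hs f v) x = - blinfun_apply (Hs f v) (sh x)" "B p x (Hs f v) = blinfun_apply (Hs f v) (sh x)" for f v x
    unfolding sh by (rule skew, rule refl)
  \<comment> \<open>These equations and \<open>sk\<close> orient every Hessian pairing and every
    pairing with a sharp in one fixed way, after which the cancellation is ring algebra.\<close>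
  have sym: "blinfun_apply (Hs f (sh b)) (sh c) = blinfun_apply (Hs f (sh c)) (sh b)"
    "blinfun_apply (Hs g (sh a)) (sh c) = blinfun_apply (Hs g (sh c)) (sh a)"
    "blinfun_apply (Hs h (sh a)) (sh b) = blinfun_apply (Hs h (sh b)) (sh a)"
    "blinfun_apply (Hs f (E p)) (sh b) = blinfun_apply (Hs f (sh b)) (E p)"
    "blinfun_apply (Hs f (E p)) (sh c) = blinfun_apply (Hs f (sh c)) (E p)"
    "blinfun_apply (Hs g (E p)) (sh a) = blinfun_apply (Hs g (sh a)) (E p)"
    "blinfun_apply (Hs g (E p)) (sh c) = blinfun_apply (Hs g (sh c)) (E p)"
    "blinfun_apply (Hs h (E p)) (sh b) = blinfun_apply (Hs h (sh b)) (E p)"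
    "blinfun_apply (Hs h (E p)) (sh a) = blinfun_apply (Hs h (sh a)) (E p)"
    by (rule Hs[OF f] Hs[OF g] Hs[OF h])+
  have sk: "blinfun_apply b (sh a) = - blinfun_apply a (sh b)" "blinfun_apply c (sh a) = - blinfun_apply a (sh c)"
    "blinfun_apply c (sh b) = - blinfun_apply b (sh c)"
    by (rule skew)+
  note Dfg = D[OF f g, folded br_def a b] and Dgh = D[OF g h, folded br_def b c] and Dhf = D[OF h f, folded br_def c a]
  show ?thesis
    unfolding br1
    unfolding Dfg Dgh Dhf a[symmetric] b[symmetric] c[symmetric] Bl
    unfolding br0 half_schouten_def L sh_def[symmetric] a[symmetric] b[symmetric] c[symmetric]
    unfolding sh sym sk
    by (simp add: algebra_simps)
qed

lemma fun_differential_const [simp]: "fun_differential A (\<lambda>_. r) p = 0"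
  by (simp add: fun_differential_def Let_def comp_def frechet_derivative_const zero_blinfun_def)

lemma fun_differential_combination:
  assumes "smooth_fun A UNIV f" "smooth_fun A UNIV g"
  shows "fun_differential A (\<lambda>q. r * f q + s * g q) p = r *\<^sub>R fun_differential A f p + s *\<^sub>R fun_differential A g p"
proof (rule blinfun_eqI)
  fix v
  define c where "c = ch p"
  have c: "c \<in> A" "p \<in> cdom c" "smooth_chart A c" using chart_at chart_at_smooth by (auto simp: c_def)
  note d = chart_fun_differentiable[OF _ open_UNIV UNIV_I c(1,2)]
  have D: "(((\<lambda>q. r * f q + s * g q) \<circ> cinv c) has_derivative
     (\<lambda>v. r * fderiv (f \<circ> cinv c) (cmap c p) v + s * fderiv (g \<circ> cinv c) (cmap c p) v)) (at (cmap c p))"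
    using has_derivative_frechet[OF d[OF assms(1)]] has_derivative_frechet[OF d[OF assms(2)]]
    unfolding comp_def by (intro has_derivative_add has_derivative_mult_right)
  show "blinfun_apply (fun_differential A (\<lambda>q. r * f q + s * g q) p) v
      = blinfun_apply (r *\<^sub>R fun_differential A f p + s *\<^sub>R fun_differential A g p) v"
    using fun_differential_chart[OF c(3,2) differentiableI[OF D]] frechet_derivative_eqI[OF D]
      fun_differential_chart[OF c(3,2) d[OF assms(1)]] fun_differential_chart[OF c(3,2) d[OF assms(2)]]
    by (simp add: blinfun.add_left blinfun.scaleR_left)
qed

lemma smooth_fun_const: "smooth_fun A U (\<lambda>_. r)"
  by (simp add: smooth_fun_def comp_def)

theorem jacobi_structure_iff:
  assumes B: "bivector_field A B" and E: "vector_field A UNIV E"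
  shows "jacobi_structure A B E \<longleftrightarrow>
    (\<forall>p a b c. half_schouten A B p a b c =
      blinfun_apply a (E p) * B p b c + blinfun_apply b (E p) * B p c a + blinfun_apply c (E p) * B p a b) \<and>
    (\<forall>p a b. lie_deriv_biv A E B p a b = 0)" (is "_ \<longleftrightarrow> ?T \<and> ?L")
proof
  assume J: "jacobi_structure A B E"
  note eq = jacobiator_eq[OF B E _ _ _ refl refl refl]
  have Jac: "jacobi_bracket A B E (jacobi_bracket A B E f g) h p + jacobi_bracket A B E (jacobi_bracket A B E g h) f p
      + jacobi_bracket A B E (jacobi_bracket A B E h f) g p = 0"
    if "smooth_fun A UNIV f" "smooth_fun A UNIV g" "smooth_fun A UNIV h" for f g h p
    using J that unfolding jacobi_structure_def lie_bracket_on_def by blast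
  have z: "B p x 0 = 0" "B p 0 x = 0" "biv_deriv A B p v x 0 = 0" "biv_deriv A B p v 0 x = 0"
      "biv_deriv A B p 0 x y = 0" for p x y v
    using bilinear_lzero[OF bivector_fieldD(1)[OF B]] bilinear_rzero[OF bivector_fieldD(1)[OF B]]
      bilinear_lzero[OF bilinear_biv_deriv[OF B]] bilinear_rzero[OF bilinear_biv_deriv[OF B]]
      linear_0[OF linear_biv_deriv[OF B]] by auto
  have sz: "sharp (B p) 0 = 0" for p
    by (rule sharp_eqI[OF bivector_fieldD(1)[OF B]]) (simp add: z)
  have vz: "vf_deriv A E p 0 = 0" for p
    using linear_0[OF has_derivative_linear[OF vf_in_has_derivative[OF E open_UNIV UNIV_I]]] .
  \<comment> \<open>The third function is the constant 1. Its differential is zero, so the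
    Jacobiator reduces to \<open>- L_E B\<close> on the first two differentials.\<close>
  have L: "lie_deriv_biv A E B p a b = 0" for p a b
  proof -
    obtain f where f: "smooth_fun A UNIV f" "fun_differential A f p = a"
      by (rule exists_function_with_differential)
    obtain g where g: "smooth_fun A UNIV g" "fun_differential A g p = b"
      by (rule exists_function_with_differential)
    show ?thesis
      using eq[OF f(1) g(1) smooth_fun_const[of _ 1], of p] Jac[OF f(1) g(1) smooth_fun_const[of _ 1], of p]
      by (simp add: f g half_schouten_def z sz vz lie_deriv_biv_eq[OF B E])
  qed
  have "half_schouten A B p a b c =
      blinfun_apply a (E p) * B p b c + blinfun_apply b (E p) * B p c a + blinfun_apply c (E p) * B p a b" for p a b c
  proof -
    obtain f where f: "smooth_fun A UNIV f" "fun_differential A f p = a"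
      by (rule exists_function_with_differential)
    obtain g where g: "smooth_fun A UNIV g" "fun_differential A g p = b"
      by (rule exists_function_with_differential)
    obtain h where h: "smooth_fun A UNIV h" "fun_differential A h p = c"
      by (rule exists_function_with_differential)
    show ?thesis
      using eq[OF f(1) g(1) h(1), of p] Jac[OF f(1) g(1) h(1), of p] by (simp add: f g h L)
  qed
  then show "?T \<and> ?L" using L by blast
next
  assume TL: "?T \<and> ?L"
  have Bl: "bilinear (B p)" for p by (rule bivector_fieldD(1)[OF B])
  have "lie_bracket_on {f. smooth_fun A UNIV f} (jacobi_bracket A B E)"
    unfolding lie_bracket_on_def
  proof (intro conjI ballI allI, goal_cases)
    case (1 f g)
    then show ?case using jacobi_bracket_smooth[OF B E] by blast
  next
    case (2 f g h r s p)
    then show ?case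
      by (simp add: jacobi_bracket_def fun_differential_combination bilinear_ladd[OF Bl] bilinear_lmul[OF Bl]
          blinfun.add_left blinfun.scaleR_left algebra_simps)
  next
    case (3 f g p)
    show ?case
      using bivector_fieldD(2)[OF B, of p "fun_differential A f p" "fun_differential A g p"]
      by (simp add: jacobi_bracket_def)
  next
    case (4 f g h p)
    then show ?case
      using jacobiator_eq[OF B E _ _ _ refl refl refl, of f g h p] TL by simp
  qed
  then show "jacobi_structure A B E" using B E by (simp add: jacobi_structure_def)
qed

text \<open>The case \<open>E = 0\<close> of Jacobi structures, for which both
  \<open>E \<and> B\<close> and \<open>L_E B\<close> are zero.\<close>

theorem poisson_structure_iff:
  assumes B: "bivector_field A B"
  shows "poisson_structure A B \<longleftrightarrow> (\<forall>p a b c. half_schouten A B p a b c = 0)"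
proof -
  have v0: "vf_in A c (\<lambda>_. 0) = (\<lambda>_. 0)" for c by (rule ext) (simp add: vf_in_def)
  have E: "vector_field A UNIV (\<lambda>_. 0)" by (simp add: vector_field_def v0)
  have "jacobi_bracket A B (\<lambda>_. 0) = (\<lambda>f g p. B p (fun_differential A f p) (fun_differential A g p))"
    by (intro ext) (simp add: jacobi_bracket_def)
  then have "poisson_structure A B \<longleftrightarrow> jacobi_structure A B (\<lambda>_. 0)"
    using B E by (simp add: poisson_structure_def jacobi_structure_def)
  moreover have "lie_deriv_biv A (\<lambda>_. 0) B p a b = 0" for p a b
    using linear_0[OF linear_biv_deriv[OF B]]
    by (simp add: lie_deriv_biv_eq[OF B E] vf_deriv_def v0 frechet_derivative_const)
  ultimately show ?thesis
    using jacobi_structure_iff[OF B E] by simp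
qed

end

section \<open>Differentiation along vector fields\<close>

lemma frechet_derivative_along_field:
  fixes \<xi> :: "'e::euclidean_space \<Rightarrow> real"
  assumes N: "open N" "y0 \<in> N" and \<xi>: "smooth_on N \<xi>" and X: "(X has_derivative X') (at y0)"
  shows "((\<lambda>y. fderiv \<xi> y (X y)) has_derivative
    (\<lambda>v. fderiv (\<lambda>y. fderiv \<xi> y (X y0)) y0 v
      + fderiv \<xi> y0 (X' v))) (at y0)"
proof -
  define d where "d i y = fderiv \<xi> y i" for i y
  have ex: "fderiv \<xi> y w = (\<Sum>i\<in>Basis. (w \<bullet> i) * d i y)" if "y \<in> N" for y w
    using frechet_derivative_basis[OF smooth_on_differentiable[OF \<xi> that], of w] by (simp add: d_def)
  have d: "(d i has_derivative fderiv (d i) y0) (at y0)" for i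
    unfolding d_def by (intro has_derivative_frechet smooth_on_differentiable[OF smooth_on_frechet[OF \<xi>] N(2)])
  have Xi: "((\<lambda>y. X y \<bullet> i) has_derivative (\<lambda>v. X' v \<bullet> i)) (at y0)" for i
    by (intro has_derivative_inner_left X)
  have "((\<lambda>y. \<Sum>i\<in>Basis. (X y0 \<bullet> i) * d i y) has_derivative
      (\<lambda>v. \<Sum>i\<in>Basis. (X y0 \<bullet> i) * fderiv (d i) y0 v)) (at y0)"
    by (intro has_derivative_sum has_derivative_mult_right d)
  then have "((\<lambda>y. fderiv \<xi> y (X y0)) has_derivative
      (\<lambda>v. \<Sum>i\<in>Basis. (X y0 \<bullet> i) * fderiv (d i) y0 v)) (at y0)"
    by (rule has_derivative_transform_within_open[OF _ N]) (simp add: ex)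
  note s = frechet_derivative_eqI[OF this]
  have "((\<lambda>y. \<Sum>i\<in>Basis. (X y \<bullet> i) * d i y) has_derivative
      (\<lambda>v. \<Sum>i\<in>Basis. (X y0 \<bullet> i) * fderiv (d i) y0 v + (X' v \<bullet> i) * d i y0)) (at y0)"
    by (intro has_derivative_sum has_derivative_mult d Xi)
  then have "((\<lambda>y. \<Sum>i\<in>Basis. (X y \<bullet> i) * d i y) has_derivative
    (\<lambda>v. fderiv (\<lambda>y. fderiv \<xi> y (X y0)) y0 v
      + fderiv \<xi> y0 (X' v))) (at y0)"
    by (simp add: s ex[OF N(2)] sum.distrib)
  then show ?thesis
    by (rule has_derivative_transform_within_open[OF _ N]) (simp add: ex)
qed

text \<open>Differentiate the constant \<open>D\<xi>(X)\<close>: seen through \<open>\<xi>\<close>,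
  the derivative of \<open>X\<close> is minus a Hessian term. Symmetry of the Hessian then makes
  antisymmetrized derivatives vanish, the source of both involutivity and projectability
  below.\<close>

lemma frechet_derivative_constant_along_field:
  fixes \<xi> :: "'e::euclidean_space \<Rightarrow> real"
  assumes "open N" "y0 \<in> N" "smooth_on N \<xi>" "(X has_derivative X') (at y0)"
    and "\<And>y. y \<in> N \<Longrightarrow> fderiv \<xi> y (X y) = k"
  shows "fderiv \<xi> y0 (X' v) = - fderiv (\<lambda>y. fderiv \<xi> y (X y0)) y0 v"
proof -
  have "((\<lambda>y. k) has_derivative (\<lambda>v. fderiv (\<lambda>y. fderiv \<xi> y (X y0)) y0 v
      + fderiv \<xi> y0 (X' v))) (at y0)"
    by (rule has_derivative_transform_within_open[OF frechet_derivative_along_field[OF assms(1-4)] assms(1,2)])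
      (simp add: assms(5))
  from frechet_derivative_eqI[OF this, of v] show ?thesis
    by (simp add: frechet_derivative_const)
qed

section \<open>Projections\<close>

text \<open>Uniqueness of the decomposition makes the \<open>THE\<close> meaningful and the map
  linear, hence bounded in finite dimension, so that \<open>Blinfun\<close> can be undone.\<close>

lemma proj_along_props:
  fixes S T :: "'e::euclidean_space set"
  assumes S: "subspace S" and T: "subspace T" and ST: "S \<inter> T = {0}" and sum: "{u + v | u v. u \<in> S \<and> v \<in> T} = UNIV"
  shows proj_along_mem: "proj_along S T v \<in> S"
    and proj_along_compl: "v - proj_along S T v \<in> T"
    and proj_along_eqI: "x \<in> S \<Longrightarrow> v - x \<in> T \<Longrightarrow> proj_along S T v = x"
proof -
  define f where "f v = (THE x. x \<in> S \<and> v - x \<in> T)" for v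
  have uniq: "x = x'" if "x \<in> S" "v - x \<in> T" "x' \<in> S" "v - x' \<in> T" for v x x'
  proof -
    have "x - x' \<in> S" using that S subspace_diff by blast
    moreover have "(v - x') - (v - x) \<in> T" using that T subspace_diff by blast
    ultimately have "x - x' \<in> S \<inter> T" by simp
    then show ?thesis using ST by simp
  qed
  have f: "f v \<in> S \<and> v - f v \<in> T" for v
  proof -
    have "v \<in> {u + v | u v. u \<in> S \<and> v \<in> T}" using sum by simp
    then obtain x y where xy: "v = x + y" "x \<in> S" "y \<in> T" by blast
    then have "\<exists>!x. x \<in> S \<and> v - x \<in> T" using uniq by (intro ex1I[of _ x]) auto
    then show ?thesis unfolding f_def by (rule theI')
  qed
  have feq: "f v = x" if "x \<in> S" "v - x \<in> T" for v x
    using uniq f that by blast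
  have "linear f"
  proof (rule linearI)
    fix v w r
    have "(v - f v) + (w - f w) \<in> T" using f subspace_add[OF T] by blast
    then show "f (v + w) = f v + f w"
      using f subspace_add[OF S] by (intro feq) (auto simp: algebra_simps)
    have "r *\<^sub>R (v - f v) \<in> T" using f subspace_scale[OF T] by blast
    then show "f (r *\<^sub>R v) = r *\<^sub>R f v"
      using f subspace_scale[OF S] by (intro feq) (auto simp: algebra_simps)
  qed
  then have "blinfun_apply (proj_along S T) = f"
    unfolding proj_along_def f_def[abs_def, symmetric]
    by (simp add: bounded_linear_Blinfun_apply linear_conv_bounded_linear)
  then show "proj_along S T v \<in> S" "v - proj_along S T v \<in> T"
    "x \<in> S \<Longrightarrow> v - x \<in> T \<Longrightarrow> proj_along S T v = x"
    using f feq by auto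
qed

section \<open>Foliations\<close>

lemma mem_subspace_iff_orthogonal:
  fixes V :: "'e::euclidean_space set"
  assumes "subspace V"
  shows "v \<in> V \<longleftrightarrow> (\<forall>w\<in>orthogonal_comp V. w \<bullet> v = 0)"
proof -
  have "v \<in> V \<longleftrightarrow> v \<in> orthogonal_comp (orthogonal_comp V)"
    using orthogonal_comp_self[OF assms] by simp
  then show ?thesis by (simp add: orthogonal_comp_def orthogonal_def)
qed

locale foliated_manifold = smooth_manifold A
  for A :: "('a::{t2_space,second_countable_topology}, 'e::euclidean_space) chart set" +
  fixes V :: "'e set" and \<Phi> :: "('a, 'e) chart set" and F :: "('a, 'e) distribution"
  assumes foliated: "foliated_atlas A V \<Phi>" and F_def: "F = tangent_distribution A V \<Phi>"
begin

lemma subspace_V: "subspace V"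
  using foliated by (simp add: foliated_atlas_def)

lemma foliated_chart: "\<phi> \<in> \<Phi> \<Longrightarrow> smooth_chart A \<phi>"
  using foliated by (auto simp: foliated_atlas_def)

lemma foliated_chart_exists: obtains \<phi> where "\<phi> \<in> \<Phi>" "p \<in> cdom \<phi>"
  using foliated unfolding foliated_atlas_def by blast

text \<open>Along the line through \<open>cmap \<phi> p\<close> in direction \<open>v\<close> the
  chart \<open>\<psi>\<close> moves, for small parameters, inside a translate of \<open>V\<close>.
  Hence its inner product with any \<open>w\<close> orthogonal to \<open>V\<close> is constant and
  has derivative zero.\<close>

lemma tangent_change_plaque:
  assumes \<phi>: "\<phi> \<in> \<Phi>" "p \<in> cdom \<phi>" and \<psi>: "\<psi> \<in> \<Phi>" "p \<in> cdom \<psi>" and v: "v \<in> V"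
  shows "tangent_change \<phi> \<psi> p v \<in> V"
  unfolding mem_subspace_iff_orthogonal[OF subspace_V]
proof
  fix w assume w: "w \<in> orthogonal_comp V"
  obtain W where W: "open W" "p \<in> W" "W \<subseteq> cdom \<phi> \<inter> cdom \<psi>"
    and pl: "\<And>x y. x \<in> W \<Longrightarrow> y \<in> W \<Longrightarrow> cmap \<phi> x - cmap \<phi> y \<in> V \<Longrightarrow> cmap \<psi> x - cmap \<psi> y \<in> V"
    using foliated \<phi> \<psi> unfolding foliated_atlas_def by (metis IntI)
  define T where "T = (\<lambda>t::real. cmap \<phi> p + t *\<^sub>R v) -` (cmap \<phi> ` W)"
  have "open T"
    unfolding T_def using W
    by (intro open_vimage smooth_chart_open_image[OF foliated_chart[OF \<phi>(1)]] continuous_intros) auto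
  have T0: "0 \<in> T" using W by (auto simp: T_def)
  have const: "w \<bullet> transition \<phi> \<psi> (cmap \<phi> p + t *\<^sub>R v) = w \<bullet> cmap \<psi> p" if t: "t \<in> T" for t
  proof -
    obtain x where x: "x \<in> W" "cmap \<phi> p + t *\<^sub>R v = cmap \<phi> x"
      using t unfolding T_def vimage_eq image_iff by blast
    have "cmap \<phi> x - cmap \<phi> p = t *\<^sub>R v" using x(2) by (simp add: algebra_simps)
    then have "cmap \<psi> x - cmap \<psi> p \<in> V" using pl[OF x(1) W(2)] v subspace_V by (simp add: subspace_scale)
    then have "w \<bullet> (cmap \<psi> x - cmap \<psi> p) = 0" using w mem_subspace_iff_orthogonal[OF subspace_V] by blast
    moreover have "transition \<phi> \<psi> (cmap \<phi> x) = cmap \<psi> x"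
      using x W by (intro transition_cmap[OF foliated_chart[OF \<phi>(1)]]) auto
    ultimately show ?thesis using x(2) by (simp add: inner_diff_right)
  qed
  have "((\<lambda>t. w \<bullet> transition \<phi> \<psi> (cmap \<phi> p + t *\<^sub>R v)) has_derivative
      (\<lambda>t. w \<bullet> tangent_change \<phi> \<psi> p (t *\<^sub>R v))) (at 0)"
    using transition_has_derivative[OF foliated_chart[OF \<phi>(1)] foliated_chart[OF \<psi>(1)] \<phi>(2) \<psi>(2)]
    by (intro has_derivative_inner_right has_derivative_compose[of "\<lambda>t. cmap \<phi> p + t *\<^sub>R v" _ 0 UNIV "transition \<phi> \<psi>"])
      (auto intro!: derivative_eq_intros)
  then have "((\<lambda>t. w \<bullet> cmap \<psi> p) has_derivative (\<lambda>t. w \<bullet> tangent_change \<phi> \<psi> p (t *\<^sub>R v))) (at 0)"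
    by (rule has_derivative_transform_within_open[OF _ \<open>open T\<close> T0]) (rule const)
  from frechet_derivative_eqI[OF this, of 1] show "w \<bullet> tangent_change \<phi> \<psi> p v = 0"
    by (simp add: frechet_derivative_const)
qed

text \<open>Membership in \<open>F p\<close> quantifies over all foliated charts at
  \<open>p\<close>; since changes of coordinates between them preserve \<open>V\<close>, a single
  one decides.\<close>

lemma F_iff_chart:
  assumes "\<phi> \<in> \<Phi>" "p \<in> cdom \<phi>"
  shows "v \<in> F p \<longleftrightarrow> to_chart A \<phi> p v \<in> V"
  using assms tangent_change_plaque[OF assms] to_chart_change[OF foliated_chart assms(2) foliated_chart]
  unfolding F_def tangent_distribution_def mem_Collect_eq by metis

lemma subspace_F: "subspace (F p)"
proof -
  obtain \<phi> where \<phi>: "\<phi> \<in> \<Phi>" "p \<in> cdom \<phi>" by (rule foliated_chart_exists)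
  show ?thesis
    using subspace_V by (auto simp: subspace_def F_iff_chart[OF \<phi>] blinfun.add_right blinfun.scaleR_right)
qed

text \<open>For \<open>w\<close> orthogonal to \<open>V\<close>, the functions \<open>first_integral \<phi> c w\<close> are constant on the leaves and their
  differentials span the annihilator of \<open>F\<close>.\<close>

definition first_integral :: "('a, 'e) chart \<Rightarrow> ('a, 'e) chart \<Rightarrow> 'e \<Rightarrow> 'e \<Rightarrow> real" where
  "first_integral \<phi> c w y = w \<bullet> transition c \<phi> y"

context
  fixes c \<phi>
  assumes c: "smooth_chart A c" and \<phi>: "\<phi> \<in> \<Phi>"
begin

lemma first_integral_smooth: "smooth_on (cmap c ` (cdom c \<inter> cdom \<phi>)) (first_integral \<phi> c w)"
  unfolding first_integral_def
  by (intro smooth_on_bounded_linear[OF transition_open[OF c foliated_chart[OF \<phi>]] bounded_linear_inner_right]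
      transition_smooth c foliated_chart \<phi>)

lemma frechet_first_integral:
  assumes "q \<in> cdom c" "q \<in> cdom \<phi>"
  shows "fderiv (first_integral \<phi> c w) (cmap c q) v = w \<bullet> to_chart A \<phi> q (from_chart A c q v)"
  unfolding first_integral_def
  by (intro frechet_derivative_eqI has_derivative_inner_right)
    (simp add: to_from_chart[OF c assms(1) foliated_chart[OF \<phi>] assms(2)]
      transition_has_derivative[OF c foliated_chart[OF \<phi>] assms])

lemma F_iff_first_integral:
  assumes "q \<in> cdom c" "q \<in> cdom \<phi>"
  shows "v \<in> F q \<longleftrightarrow> (\<forall>w\<in>orthogonal_comp V. fderiv (first_integral \<phi> c w) (cmap c q) (to_chart A c q v) = 0)"
  unfolding F_iff_chart[OF \<phi> assms(2)] mem_subspace_iff_orthogonal[OF subspace_V] frechet_first_integral[OF assms]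
  using c assms by simp

end

end

section \<open>Coupling pairs\<close>

locale coupling_pair = foliated_manifold A V \<Phi> F
  for A :: "('a::{t2_space,second_countable_topology}, 'e::euclidean_space) chart set"
    and V \<Phi> and F :: "('a, 'e) distribution" +
  fixes H :: "('a, 'e) distribution" and \<Lambda> :: "('a, 'e) bivfield" and E :: "('a, 'e) vfield"
    and \<sigma> :: "('a, 'e) form2"
  assumes coupling: "coupling_second_kind A F \<Lambda> E" and H_def: "H = sharp_ann F \<Lambda>"
    and equivalent: "equivalent_form_mod A F (biv_part H F \<Lambda>) \<sigma>"
begin

abbreviation \<Lambda>' :: "('a, 'e) bivfield" where "\<Lambda>' \<equiv> biv_part H F \<Lambda>"

abbreviation \<Lambda>'' :: "('a, 'e) bivfield" where "\<Lambda>'' \<equiv> biv_part F H \<Lambda>"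

lemma \<Lambda>: "bivector_field A \<Lambda>" and E: "vector_field A UNIV E"
  using coupling by (auto simp: coupling_second_kind_def)

lemma bilinear_\<Lambda>: "bilinear (\<Lambda> p)"
  by (rule bivector_fieldD(1)[OF \<Lambda>])

lemma \<Lambda>_skew: "\<Lambda> p a b = - \<Lambda> p b a"
  by (rule bivector_fieldD(2)[OF \<Lambda>])

definition sh :: "'a \<Rightarrow> ('e \<Rightarrow>\<^sub>L real) \<Rightarrow> 'e" where "sh p = sharp (\<Lambda> p)"

lemma sh: "blinfun_apply b (sh p a) = \<Lambda> p a b"
  unfolding sh_def by (rule sharp_apply[OF bilinear_\<Lambda>])

definition PF :: "'a \<Rightarrow> 'e \<Rightarrow>\<^sub>L 'e" where "PF p = proj_along (F p) (H p)"
definition PH :: "'a \<Rightarrow> 'e \<Rightarrow>\<^sub>L 'e" where "PH p = proj_along (H p) (F p)"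

lemma splitting: "subspace (H p)" "H p \<inter> F p = {0}" "{u + v | u v. u \<in> H p \<and> v \<in> F p} = UNIV"
  using coupling by (auto simp: coupling_second_kind_def normal_bundle_def smooth_subbundle_def H_def)

lemma splitting': "F p \<inter> H p = {0}" "{u + v | u v. u \<in> F p \<and> v \<in> H p} = UNIV"
proof -
  show "F p \<inter> H p = {0}" using splitting(2) by blast
  have "{u + v | u v. u \<in> F p \<and> v \<in> H p} = {u + v | u v. u \<in> H p \<and> v \<in> F p}"
    by (auto; metis add.commute)
  then show "{u + v | u v. u \<in> F p \<and> v \<in> H p} = UNIV" using splitting(3) by simp
qed

lemma PH_mem: "PH p v \<in> H p"
  unfolding PH_def by (rule proj_along_mem[OF splitting(1) subspace_F splitting(2,3)])

lemma PF_mem: "PF p v \<in> F p"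
  unfolding PF_def by (rule proj_along_mem[OF subspace_F splitting(1) splitting'])

lemma PF_eqI: "x \<in> F p \<Longrightarrow> v - x \<in> H p \<Longrightarrow> (PF p) v = x"
  unfolding PF_def by (rule proj_along_eqI[OF subspace_F splitting(1) splitting'])

lemma PH_eq: "PH p v = v - PF p v"
  unfolding PH_def
proof (rule proj_along_eqI[OF splitting(1) subspace_F splitting(2,3)])
  show "v - PF p v \<in> H p"
    unfolding PF_def by (rule proj_along_compl[OF subspace_F splitting(1) splitting'])
  show "v - (v - PF p v) \<in> F p" using PF_mem by simp
qed

lemma PF_F: "v \<in> F p \<Longrightarrow> PF p v = v"
  using subspace_0[OF splitting(1)] by (intro PF_eqI) auto

lemma PF_H: "v \<in> H p \<Longrightarrow> PF p v = 0"
  using subspace_0[OF subspace_F] by (intro PF_eqI) auto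

lemma PH_F: "v \<in> F p \<Longrightarrow> PH p v = 0" and PH_H: "v \<in> H p \<Longrightarrow> PH p v = v"
  by (simp_all add: PH_eq PF_F PF_H)

lemma F_iff: "v \<in> F p \<longleftrightarrow> PH p v = 0"
  using PH_F PF_mem[of p v] by (auto simp: PH_eq)

lemma ann_F: "a \<in> ann (F p) \<Longrightarrow> blinfun_apply a (PF p v) = 0" "a \<in> ann (F p) \<Longrightarrow> blinfun_apply a (PH p v) = blinfun_apply a v"
  using PF_mem by (auto simp: ann_def PH_eq blinfun.diff_right)

lemma ann_H: "a \<in> ann (H p) \<Longrightarrow> blinfun_apply a (PH p v) = 0" "a \<in> ann (H p) \<Longrightarrow> blinfun_apply a (PF p v) = blinfun_apply a v"
proof -
  show *: "a \<in> ann (H p) \<Longrightarrow> blinfun_apply a (PH p v) = 0" using PH_mem by (auto simp: ann_def)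
  show "a \<in> ann (H p) \<Longrightarrow> blinfun_apply a (PF p v) = blinfun_apply a v" using * by (simp add: PH_eq blinfun.diff_right)
qed

lemma ann_F_compose: "a \<in> ann (F p) \<Longrightarrow> a o\<^sub>L PH p = a" "a \<in> ann (F p) \<Longrightarrow> a o\<^sub>L PF p = 0"
  by (auto intro!: blinfun_eqI simp: ann_F)

lemma ann_H_compose: "a \<in> ann (H p) \<Longrightarrow> a o\<^sub>L PF p = a" "a \<in> ann (H p) \<Longrightarrow> a o\<^sub>L PH p = 0"
  by (auto intro!: blinfun_eqI simp: ann_H)

lemma compose_PH_ann: "a o\<^sub>L PH p \<in> ann (F p)"
  by (simp add: ann_def PH_F)

lemma compose_PF_ann: "a o\<^sub>L PF p \<in> ann (H p)"
  by (simp add: ann_def PF_H)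

lemma covector_split: "a = (a o\<^sub>L PH p) + (a o\<^sub>L PF p)"
  by (rule blinfun_eqI) (simp add: PH_eq blinfun.add_left blinfun.diff_right)

lemma sh_ann_F: "a \<in> ann (F p) \<Longrightarrow> sh p a \<in> H p"
  by (auto simp: H_def sharp_ann_def sh_def)

lemma H_obtain:
  assumes "v \<in> H p"
  obtains a where "a \<in> ann (F p)" "v = sh p a"
  using assms by (auto simp: H_def sharp_ann_def sh_def)

text \<open>The component of type (1,1) vanishes because \<open>H\<close> is by definition
  \<open>\<sharp>(ann F)\<close>, on which covectors from \<open>ann H\<close> are zero.\<close>

lemma \<Lambda>_mixed: "a \<in> ann (F p) \<Longrightarrow> l \<in> ann (H p) \<Longrightarrow> \<Lambda> p a l = 0" "a \<in> ann (F p) \<Longrightarrow> l \<in> ann (H p) \<Longrightarrow> \<Lambda> p l a = 0"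
proof -
  assume a: "a \<in> ann (F p)" and l: "l \<in> ann (H p)"
  have "blinfun_apply l (sh p a) = 0" using l sh_ann_F[OF a] by (auto simp: ann_def)
  then show "\<Lambda> p a l = 0" by (simp add: sh)
  then show "\<Lambda> p l a = 0" using \<Lambda>_skew[of p l a] by simp
qed

lemma sh_ann_H: "l \<in> ann (H p) \<Longrightarrow> sh p l \<in> F p"
  unfolding F_iff
proof (rule covector_separates)
  fix b :: "'e \<Rightarrow>\<^sub>L real"
  assume l: "l \<in> ann (H p)"
  show "blinfun_apply b (PH p (sh p l)) = blinfun_apply b 0"
    using \<Lambda>_mixed(2)[OF compose_PH_ann l, of b] sh[of "b o\<^sub>L PH p" p l] by simp
qed

lemma two_form_\<sigma>: "two_form A \<sigma>"
  using equivalent by (simp add: equivalent_form_mod_def)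

lemma bilinear_\<sigma>: "bilinear (\<sigma> p)"
  using two_form_\<sigma> by (simp add: two_form_def)

lemma \<sigma>_skew: "\<sigma> p v w = - \<sigma> p w v"
  by (rule bilinear_alternating_skew[OF bilinear_\<sigma>]) (use two_form_\<sigma> in \<open>simp add: two_form_def\<close>)

text \<open>The hypothesis on \<open>\<sigma>\<close> concerns two sharps of
  \<open>\<Lambda>'\<close> only. It extends to all \<open>v\<close> because
  \<open>\<Lambda>\<close> and \<open>\<Lambda>'\<close> have the same sharp on
  \<open>ann F\<close>, every vector of \<open>H\<close> is such a sharp, and \<open>F\<close> lies
  in the kernel of \<open>\<sigma>\<close>. The sign is that of
  \<open>\<Lambda>(a,b) = - a(\<sharp>b)\<close>; later signs derive from it.\<close>

lemma \<sigma>_sh: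
  assumes a: "a \<in> ann (F p)"
  shows "\<sigma> p (sh p a) v = - blinfun_apply a v"
proof -
  have bil: "bilinear (\<Lambda>' p)"
  proof -
    have "\<Lambda>' p = (\<lambda>a b. \<Lambda> p (a o\<^sub>L PH p) (b o\<^sub>L PH p))"
      by (intro ext) (simp add: biv_part_def PH_def)
    then show ?thesis
      using bilinear_compose[OF bilinear_\<Lambda> blinfun_compose_linear blinfun_compose_linear] by simp
  qed
  have s: "sharp (\<Lambda>' p) a = sh p a" if a: "a \<in> ann (F p)" for a
  proof (rule sharp_eqI[OF bil])
    fix b :: "'e \<Rightarrow>\<^sub>L real"
    have "\<Lambda>' p a b = \<Lambda> p a (b o\<^sub>L PH p)"
      using ann_F_compose(1)[OF a] by (simp add: biv_part_def PH_def)
    also have "\<dots> = blinfun_apply b (sh p a)"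
      using sh[of "b o\<^sub>L PH p" p a] PH_H[OF sh_ann_F[OF a]] by simp
    finally show "blinfun_apply b (sh p a) = \<Lambda>' p a b" by simp
  qed
  obtain b where b: "b \<in> ann (F p)" "PH p v = sh p b" using H_obtain[OF PH_mem] by blast
  have "\<sigma> p (sh p a) (sh p b) = \<Lambda>' p a b"
    using equivalent a b(1) s[OF a] s[OF b(1)] unfolding equivalent_form_mod_def by metis
  also have "\<dots> = \<Lambda> p a b"
    using ann_F_compose(1)[OF a] ann_F_compose(1)[OF b(1)] by (simp add: biv_part_def PH_def)
  also have "\<dots> = - blinfun_apply a (PH p v)" using \<Lambda>_skew[of p a b] b(2) by (simp add: sh)
  also have "\<dots> = - blinfun_apply a v" using ann_F(2)[OF a] by simp
  finally have "\<sigma> p (sh p a) (PH p v) = - blinfun_apply a v" using b(2) by simp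
  moreover have "\<sigma> p (sh p a) (PF p v) = 0"
    using equivalent PF_mem \<sigma>_skew[of p "sh p a"] by (simp add: equivalent_form_mod_def)
  ultimately have "\<sigma> p (sh p a) (PH p v + PF p v) = - blinfun_apply a v"
    by (simp add: bilinear_radd[OF bilinear_\<sigma>])
  then show ?thesis by (simp add: PH_eq)
qed

lemma \<sigma>_F: "u \<in> F p \<Longrightarrow> \<sigma> p u v = 0" "u \<in> F p \<Longrightarrow> \<sigma> p v u = 0"
proof -
  show *: "u \<in> F p \<Longrightarrow> \<sigma> p u v = 0" using equivalent by (simp add: equivalent_form_mod_def)
  show "u \<in> F p \<Longrightarrow> \<sigma> p v u = 0" using * \<sigma>_skew[of p v u] by simp
qed

text \<open>Writing the \<open>H\<close>-part of \<open>v\<close> as \<open>\<sharp>a\<close>,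
  \<open>\<sigma>_sh\<close> identifies the flat \<open>s\<close> of \<open>v\<close> with
  \<open>- a\<close>.\<close>

lemma PH_eq_sharp_flat:
  assumes "\<And>w. blinfun_apply s w = \<sigma> p v w"
  shows "PH p v = - sh p s"
proof -
  obtain a where a: "a \<in> ann (F p)" "PH p v = sh p a" using H_obtain[OF PH_mem] by blast
  have "s = - a"
  proof (rule blinfun_eqI)
    fix w
    have "\<sigma> p (PH p v + PF p v) w = - blinfun_apply a w"
      using \<sigma>_sh[OF a(1), of w] a(2) \<sigma>_F(1)[OF PF_mem, of p v w] by (simp add: bilinear_ladd[OF bilinear_\<sigma>])
    then show "blinfun_apply s w = blinfun_apply (- a) w" using assms by (simp add: PH_eq blinfun.minus_left)
  qed
  then have "blinfun_apply b (PH p v) = blinfun_apply b (- sh p s)" for b :: "'e \<Rightarrow>\<^sub>L real"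
    using a(2) by (simp add: sh blinfun.minus_right bilinear_lneg[OF bilinear_\<Lambda>])
  then show ?thesis by (rule covector_separates)
qed

section \<open>Smoothness of the projections\<close>

definition PF_in :: "('a, 'e) chart \<Rightarrow> 'e \<Rightarrow> 'e \<Rightarrow>\<^sub>L 'e" where
  "PF_in c y = to_chart A c (cinv c y) o\<^sub>L PF (cinv c y) o\<^sub>L from_chart A c (cinv c y)"

definition PH_in :: "('a, 'e) chart \<Rightarrow> 'e \<Rightarrow> 'e \<Rightarrow>\<^sub>L 'e" where
  "PH_in c y = to_chart A c (cinv c y) o\<^sub>L PH (cinv c y) o\<^sub>L from_chart A c (cinv c y)"

lemma form2_in_smooth:
  "c \<in> A \<Longrightarrow> smooth_on (cimage c) (\<lambda>y. form2_in A c \<sigma> y v w)"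
  using two_form_\<sigma> by (simp add: two_form_def)

lemma bilinear_form2_in: "bilinear (form2_in A c \<sigma> y)"
proof -
  have "form2_in A c \<sigma> y = (\<lambda>v w. \<sigma> (cinv c y) (from_chart A c (cinv c y) v) (from_chart A c (cinv c y) w))"
    by (intro ext) (simp add: form2_in_def)
  then show ?thesis
    using bilinear_compose[OF bilinear_\<sigma> bounded_linear.linear[OF blinfun.bounded_linear_right]
        bounded_linear.linear[OF blinfun.bounded_linear_right]] by simp
qed

context
  fixes c
  assumes c: "c \<in> A"
begin

lemma PH_in_eq:
  assumes y: "y \<in> cimage c"
  shows "PH_in c y v = v - PF_in c y v"
  using to_from_chart_id[OF atlas_smooth_chart[OF c] cinv_mem[OF y]]
  by (simp add: PH_in_def PF_in_def PH_eq blinfun.diff_right)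

text \<open>The formula \<open>PH = - \<sharp> \<circ> \<flat>\<close> shows that the projections are smooth.\<close>

lemma PH_in_eq_sum:
  assumes y: "y \<in> cimage c"
  shows "blinfun_apply b (PH_in c y v) = - biv_in A c \<Lambda> y (\<Sum>i\<in>Basis. form2_in A c \<sigma> y v i *\<^sub>R blinfun_inner_right i) b"
proof -
  define q where "q = cinv c y"
  define T where "T = to_chart A c q"
  define R where "R = from_chart A c q"
  define s where "s = (\<Sum>i\<in>Basis. form2_in A c \<sigma> y v i *\<^sub>R blinfun_inner_right i)"
  note TR = from_to_chart_id[OF atlas_smooth_chart[OF c] cinv_mem[OF y], folded q_def T_def R_def]
  have "blinfun_apply s w = form2_in A c \<sigma> y v w" for w
  proof -
    have "form2_in A c \<sigma> y v w = form2_in A c \<sigma> y v (\<Sum>i\<in>Basis. (w \<bullet> i) *\<^sub>R i)"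
      by (simp add: euclidean_representation)
    also have "\<dots> = (\<Sum>i\<in>Basis. (w \<bullet> i) * form2_in A c \<sigma> y v i)"
      using bilinear_form2_in[of c y] by (simp add: bilinear_def linear_sum linear_scale)
    finally show ?thesis
      by (simp add: s_def blinfun.sum_left blinfun.scaleR_left inner_commute mult.commute)
  qed
  then have "blinfun_apply (s o\<^sub>L T) w = \<sigma> q (R v) w" for w
    using TR by (simp add: form2_in_def q_def[symmetric] T_def[symmetric] R_def[symmetric])
  then have "PH q (R v) = - sh q (s o\<^sub>L T)" by (rule PH_eq_sharp_flat)
  then have "blinfun_apply (b o\<^sub>L T) (PH q (R v)) = - \<Lambda> q (s o\<^sub>L T) (b o\<^sub>L T)"
    by (simp only: blinfun.minus_right sh)
  then show ?thesis
    by (simp add: PH_in_def biv_in_def s_def q_def T_def R_def)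
qed

lemma PH_in_smooth: "smooth_on (cimage c) (\<lambda>y. PH_in c y v)"
proof -
  note o = chart_image_open[OF c]
  define s where "s y = (\<Sum>i\<in>Basis. form2_in A c \<sigma> y v i *\<^sub>R blinfun_inner_right i)" for y
  have "blinfun_apply (s y) i = form2_in A c \<sigma> y v i" if "i \<in> Basis" for i y
    unfolding s_def by (rule covector_of_components[OF that])
  then have s: "smooth_on (cimage c) (\<lambda>y. blinfun_apply (s y) i)" if "i \<in> Basis" for i
    using form2_in_smooth[OF c] that by simp
  have "smooth_on (cimage c) (\<lambda>y. - biv_in A c \<Lambda> y (s y) (blinfun_inner_right j))" for j
    by (rule smooth_on_minus[OF o smooth_on_bilinear_covectors[OF o bilinear_biv_in[OF \<Lambda>] biv_in_smooth[OF \<Lambda> c] s]]) auto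
  then have "smooth_on (cimage c) (\<lambda>y. \<Sum>j\<in>Basis. (- biv_in A c \<Lambda> y (s y) (blinfun_inner_right j)) *\<^sub>R j)"
    by (intro smooth_on_sum o smooth_on_scaleR smooth_on_const)
  then show ?thesis
  proof (rule smooth_on_eqI[OF o])
    fix y assume y: "y \<in> cimage c"
    have "PH_in c y v = (\<Sum>j\<in>Basis. (PH_in c y v \<bullet> j) *\<^sub>R j)" by (simp add: euclidean_representation)
    then show "PH_in c y v = (\<Sum>j\<in>Basis. (- biv_in A c \<Lambda> y (s y) (blinfun_inner_right j)) *\<^sub>R j)"
      using PH_in_eq_sum[OF y, of "blinfun_inner_right _" v] by (simp add: s_def inner_commute)
  qed
qed

lemma PF_in_smooth: "smooth_on (cimage c) (\<lambda>y. PF_in c y v)"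
proof (rule smooth_on_eqI[OF chart_image_open[OF c]])
  show "smooth_on (cimage c) (\<lambda>y. v - PH_in c y v)"
    by (rule smooth_on_diff[OF chart_image_open[OF c] smooth_on_const PH_in_smooth])
qed (simp add: PH_in_eq)

end

lemma vf_in_PF: "c \<in> A \<Longrightarrow> y \<in> cimage c \<Longrightarrow> vf_in A c (\<lambda>q. PF q (X q)) y = PF_in c y (vf_in A c X y)"
  and vf_in_PH: "c \<in> A \<Longrightarrow> y \<in> cimage c \<Longrightarrow> vf_in A c (\<lambda>q. PH q (X q)) y = PH_in c y (vf_in A c X y)"
  by (simp_all add: vf_in_def PF_in_def PH_in_def from_to_chart_id[OF atlas_smooth_chart cinv_mem])

lemma vector_field_PF:
  assumes X: "vector_field A U X" and U: "open U"
  shows "vector_field A U (\<lambda>q. PF q (X q))"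
  unfolding vector_field_def
proof
  fix c assume c: "c \<in> A"
  have o: "open (cmap c ` (U \<inter> cdom c))"
    using U atlas_smooth_chart[OF c] by (intro smooth_chart_open_image) auto
  have "smooth_on (cmap c ` (U \<inter> cdom c)) (\<lambda>y. PF_in c y (vf_in A c X y))"
  proof (rule smooth_on_blinfun_apply[OF o])
    show "smooth_on (cmap c ` (U \<inter> cdom c)) (vf_in A c X)"
      using X c by (simp add: vector_field_def)
    show "smooth_on (cmap c ` (U \<inter> cdom c)) (\<lambda>y. PF_in c y v)" for v
      by (rule smooth_on_subset[OF PF_in_smooth[OF c]]) auto
  qed
  then show "smooth_on (cmap c ` (U \<inter> cdom c)) (vf_in A c (\<lambda>q. PF q (X q)))"
    by (rule smooth_on_eqI[OF o]) (rule vf_in_PF[OF c], auto)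
qed

lemma one_form_compose_PH:
  assumes f: "smooth_fun A UNIV f"
  shows "one_form A (\<lambda>q. fun_differential A f q o\<^sub>L PH q)" "one_form A (\<lambda>q. fun_differential A f q o\<^sub>L PF q)"
proof -
  have *: "one_form A (\<lambda>q. fun_differential A f q o\<^sub>L P q)"
    if P: "\<And>c v. c \<in> A \<Longrightarrow> smooth_on (cimage c) (\<lambda>y. (to_chart A c (cinv c y) o\<^sub>L P (cinv c y) o\<^sub>L from_chart A c (cinv c y)) v)" for P
    unfolding one_form_def
  proof (intro ballI allI)
    fix c v assume c: "c \<in> A"
    show "smooth_on (cimage c) (\<lambda>y. form1_in A c (\<lambda>q. fun_differential A f q o\<^sub>L P q) y v)"
      by (rule smooth_on_eqI[OF chart_image_open[OF c]
            smooth_on_blinfun_apply[OF chart_image_open[OF c] chart_diff_smooth[OF c f] P[OF c, of v]]])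
        (simp add: form1_in_def fun_differential_chart_diff[OF c f])
  qed
  show "one_form A (\<lambda>q. fun_differential A f q o\<^sub>L PH q)" "one_form A (\<lambda>q. fun_differential A f q o\<^sub>L PF q)"
    using *[OF PH_in_smooth[unfolded PH_in_def]] *[OF PF_in_smooth[unfolded PF_in_def]] by blast+
qed

text \<open>A differential with value \<open>a\<close> at \<open>p\<close>, composed with the smooth
  projection, annihilates \<open>F\<close> everywhere and keeps its value at \<open>p\<close>.
  Conditions on global forms thus become conditions on covectors.\<close>

lemma exists_one_form_ann_F:
  assumes "a \<in> ann (F p)"
  obtains \<alpha> where "\<alpha> \<in> one_forms_ann A F" "\<alpha> p = a"
proof -
  obtain f where f: "smooth_fun A UNIV f" "fun_differential A f p = a" by (rule exists_function_with_differential)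
  show thesis
    by (rule that[of "\<lambda>q. fun_differential A f q o\<^sub>L PH q"])
      (use assms f one_form_compose_PH[OF f(1)] in \<open>auto simp: one_forms_ann_def compose_PH_ann ann_F_compose\<close>)
qed

lemma exists_one_form_ann_H:
  assumes "a \<in> ann (H p)"
  obtains \<alpha> where "\<alpha> \<in> one_forms_ann A H" "\<alpha> p = a"
proof -
  obtain f where f: "smooth_fun A UNIV f" "fun_differential A f p = a" by (rule exists_function_with_differential)
  show thesis
    by (rule that[of "\<lambda>q. fun_differential A f q o\<^sub>L PF q"])
      (use assms f one_form_compose_PH[OF f(1)] in \<open>auto simp: one_forms_ann_def compose_PF_ann ann_H_compose\<close>)
qed

section \<open>First-order jets at a point\<close>

text \<open>The first vector is the direction of differentiation, the second the one being
  projected.\<close>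

definition dPF :: "'a \<Rightarrow> 'e \<Rightarrow> 'e \<Rightarrow>\<^sub>L 'e" where
  "dPF p u = Blinfun (\<lambda>v. fderiv (\<lambda>y. PF_in (ch p) y v) (org p) u)"

definition d\<sigma> :: "'a \<Rightarrow> 'e \<Rightarrow> 'e \<Rightarrow> 'e \<Rightarrow> real" where
  "d\<sigma> p u v w = fderiv (\<lambda>y. form2_in A (ch p) \<sigma> y v w) (org p) u"

lemma chart_at_image: "org p \<in> cimage (ch p)"
  using chart_at(2) by blast

lemma PF_in_at [simp]: "PF_in (ch p) (org p) = PF p"
  by (rule blinfun_eqI) (simp add: PF_in_def)

lemma PH_in_at [simp]: "PH_in (ch p) (org p) = PH p"
  by (rule blinfun_eqI) (simp add: PH_in_def)

lemma form2_in_at [simp]: "form2_in A (ch p) \<sigma> (org p) v w = \<sigma> p v w"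
  by (simp add: form2_in_def)

lemma PF_in_has_derivative:
  "((\<lambda>y. PF_in (ch p) y v) has_derivative (\<lambda>u. dPF p u v)) (at (org p))"
proof -
  define c where "c = ch p"
  define y0 where "y0 = cmap c p"
  have d: "((\<lambda>y. PF_in c y v) has_derivative
      fderiv (\<lambda>y. PF_in c y v) y0) (at y0)" for v
    unfolding c_def y0_def
    by (intro has_derivative_frechet smooth_on_differentiable[OF PF_in_smooth[OF chart_at(1)] chart_at_image])
  have "linear (\<lambda>v. fderiv (\<lambda>y. PF_in c y v) y0 u)" for u
    by (rule linear_frechet_derivative_family) (auto intro: bounded_linear.linear[OF blinfun.bounded_linear_right] differentiableI[OF d])
  then have "(dPF p u) v = fderiv (\<lambda>y. PF_in c y v) y0 u" for u
    by (simp add: dPF_def c_def y0_def bounded_linear_Blinfun_apply linear_conv_bounded_linear)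
  then show ?thesis using d by (simp add: c_def y0_def)
qed

lemma PH_in_has_derivative:
  "((\<lambda>y. PH_in (ch p) y v) has_derivative (\<lambda>u. - dPF p u v)) (at (org p))"
proof -
  have "((\<lambda>y. v - PF_in (ch p) y v) has_derivative (\<lambda>u. 0 - dPF p u v)) (at (org p))"
    by (intro has_derivative_diff has_derivative_const PF_in_has_derivative)
  then have "((\<lambda>y. PH_in (ch p) y v) has_derivative (\<lambda>u. 0 - dPF p u v)) (at (org p))"
    by (rule has_derivative_transform_within_open[OF _ chart_image_open[OF chart_at(1)] chart_at_image])
      (simp add: PH_in_eq[OF chart_at(1)])
  then show ?thesis by simp
qed

lemma PF_in_field_has_derivative:
  assumes X: "(X has_derivative X') (at (org p))"
  shows "((\<lambda>y. PF_in (ch p) y (X y)) has_derivative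
    (\<lambda>u. dPF p u (X (org p)) + PF p (X' u))) (at (org p))"
proof -
  define c where "c = ch p"
  define y0 where "y0 = cmap c p"
  have "((\<lambda>y. \<Sum>i\<in>Basis. (X y \<bullet> i) *\<^sub>R PF_in c y i) has_derivative
      (\<lambda>u. \<Sum>i\<in>Basis. (X y0 \<bullet> i) *\<^sub>R dPF p u i + (X' u \<bullet> i) *\<^sub>R (PF_in c y0) i)) (at y0)"
    unfolding c_def y0_def
    by (intro has_derivative_sum has_derivative_scaleR has_derivative_inner_left X PF_in_has_derivative)
  moreover have "(\<Sum>i\<in>Basis. (X y0 \<bullet> i) *\<^sub>R dPF p u i + (X' u \<bullet> i) *\<^sub>R (PF_in c y0) i)
      = dPF p u (X y0) + PF p (X' u)" for u
    unfolding sum.distrib blinfun_sum_basis[symmetric] by (simp add: c_def y0_def)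
  ultimately show ?thesis
    unfolding c_def y0_def by (simp add: blinfun_sum_basis[symmetric])
qed

lemma biv_in_compose_has_derivative:
  fixes R S :: "'e \<Rightarrow> 'e \<Rightarrow>\<^sub>L 'e" and p :: 'a
  defines "c \<equiv> ch p"
  assumes R: "\<And>v. ((\<lambda>y. blinfun_apply (R y) v) has_derivative (\<lambda>u. blinfun_apply (R' u) v)) (at (cmap c p))"
    and S: "\<And>v. ((\<lambda>y. blinfun_apply (S y) v) has_derivative (\<lambda>u. blinfun_apply (S' u) v)) (at (cmap c p))"
  shows "((\<lambda>y. biv_in A c \<Lambda> y (a o\<^sub>L R y) (b o\<^sub>L S y)) has_derivative
    (\<lambda>u. biv_deriv A \<Lambda> p u (a o\<^sub>L R (cmap c p)) (b o\<^sub>L S (cmap c p))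
      + \<Lambda> p (a o\<^sub>L R' u) (b o\<^sub>L S (cmap c p)) + \<Lambda> p (a o\<^sub>L R (cmap c p)) (b o\<^sub>L S' u))) (at (cmap c p))"
proof -
  have r: "((\<lambda>y. blinfun_apply (a o\<^sub>L R y) i) has_derivative (\<lambda>u. blinfun_apply (a o\<^sub>L R' u) i)) (at (cmap c p))" for i
    using bounded_linear.has_derivative[OF blinfun.bounded_linear_right R] by simp
  have s: "((\<lambda>y. blinfun_apply (b o\<^sub>L S y) i) has_derivative (\<lambda>u. blinfun_apply (b o\<^sub>L S' u) i)) (at (cmap c p))" for i
    using bounded_linear.has_derivative[OF blinfun.bounded_linear_right S] by simp
  show ?thesis
    using has_derivative_bilinear_covectors[OF bilinear_biv_in[OF \<Lambda>] biv_in_differentiable[OF \<Lambda>] r[unfolded c_def] s[unfolded c_def]]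
    by (simp add: c_def biv_deriv_def Let_def)
qed

lemma compose_uminus: "a o\<^sub>L (- R) = - (a o\<^sub>L R)" for a :: "'e \<Rightarrow>\<^sub>L real" and R :: "'e \<Rightarrow>\<^sub>L 'e"
  by (rule blinfun_eqI) (simp add: blinfun.minus_left blinfun.minus_right)

lemma \<Lambda>_uminus: "\<Lambda> p (- a) b = - \<Lambda> p a b" "\<Lambda> p a (- b) = - \<Lambda> p a b"
  by (simp_all add: bilinear_lneg[OF bilinear_\<Lambda>] bilinear_rneg[OF bilinear_\<Lambda>])

lemma PH_in_has_derivative':
  "((\<lambda>y. PH_in (ch p) y v) has_derivative (\<lambda>u. (- dPF p u) v)) (at (org p))"
  using PH_in_has_derivative by (simp add: blinfun.minus_left)

text \<open>Expresses the mixed components of the derivative of \<open>\<Lambda>\<close> by the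
  derivative of the projection; the two signs differ because \<open>PH_in\<close> has derivative
  \<open>- dPF\<close>.\<close>

lemma deriv_mixed:
  "biv_deriv A \<Lambda> p u (a o\<^sub>L PF p) (b o\<^sub>L PH p) =
     \<Lambda> p (a o\<^sub>L PF p) (b o\<^sub>L dPF p u) - \<Lambda> p (a o\<^sub>L dPF p u) (b o\<^sub>L PH p)"
proof -
  define c where "c = ch p"
  have z: "biv_in A c \<Lambda> y (a o\<^sub>L PF_in c y) (b o\<^sub>L PH_in c y) = 0" if y: "y \<in> cimage c" for y
  proof -
    define q where "q = cinv c y"
  define T where "T = to_chart A c q"
  define R where "R = from_chart A c q"
    have RT: "blinfun_apply R (blinfun_apply T v) = v" for v
      using from_to_chart_id[OF chart_at_smooth[of p, folded c_def] cinv_mem[OF y]] by (simp add: q_def T_def R_def)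
    have "a o\<^sub>L PF_in c y o\<^sub>L T = (a o\<^sub>L T) o\<^sub>L PF q" "b o\<^sub>L PH_in c y o\<^sub>L T = (b o\<^sub>L T) o\<^sub>L PH q"
      by (auto intro!: blinfun_eqI simp: PF_in_def PH_in_def q_def[symmetric] T_def[symmetric] R_def[symmetric] RT)
    then show ?thesis
      using \<Lambda>_mixed(2)[OF compose_PH_ann compose_PF_ann] by (simp add: biv_in_def q_def T_def)
  qed
  have "((\<lambda>y. 0) has_derivative (\<lambda>u. biv_deriv A \<Lambda> p u (a o\<^sub>L PF p) (b o\<^sub>L PH p)
      + \<Lambda> p (a o\<^sub>L dPF p u) (b o\<^sub>L PH p) + \<Lambda> p (a o\<^sub>L PF p) (b o\<^sub>L (- dPF p u)))) (at (cmap c p))"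
    unfolding c_def
    by (rule has_derivative_transform_within_open[OF
          biv_in_compose_has_derivative[OF PF_in_has_derivative PH_in_has_derivative', of p a b, unfolded PF_in_at PH_in_at]
          chart_image_open[OF chart_at(1)] chart_at_image])
      (simp add: z[unfolded c_def])
  from frechet_derivative_eqI[OF this, of u] show ?thesis
    by (simp add: frechet_derivative_const compose_uminus \<Lambda>_uminus)
qed

lemma biv_part_in:
  assumes y: "y \<in> cimage c" and c: "c \<in> A"
  shows "biv_in A c \<Lambda>'' y a b = biv_in A c \<Lambda> y (a o\<^sub>L PF_in c y) (b o\<^sub>L PF_in c y)"
    "biv_in A c \<Lambda>' y a b = biv_in A c \<Lambda> y (a o\<^sub>L PH_in c y) (b o\<^sub>L PH_in c y)"
proof -
  define q where "q = cinv c y"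
  define T where "T = to_chart A c q"
  define R where "R = from_chart A c q"
  have RT: "blinfun_apply R (blinfun_apply T v) = v" for v
    using from_to_chart_id[OF atlas_smooth_chart[OF c] cinv_mem[OF y]] by (simp add: q_def T_def R_def)
  have "a o\<^sub>L PF_in c y o\<^sub>L T = (a o\<^sub>L T) o\<^sub>L PF q" "a o\<^sub>L PH_in c y o\<^sub>L T = (a o\<^sub>L T) o\<^sub>L PH q" for a :: "'e \<Rightarrow>\<^sub>L real"
    by (auto intro!: blinfun_eqI simp: PF_in_def PH_in_def q_def[symmetric] T_def[symmetric] R_def[symmetric] RT)
  then show "biv_in A c \<Lambda>'' y a b = biv_in A c \<Lambda> y (a o\<^sub>L PF_in c y) (b o\<^sub>L PF_in c y)"
    "biv_in A c \<Lambda>' y a b = biv_in A c \<Lambda> y (a o\<^sub>L PH_in c y) (b o\<^sub>L PH_in c y)"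
    by (simp_all add: biv_in_def biv_part_def PF_def[symmetric] PH_def[symmetric] q_def[symmetric] T_def[symmetric])
qed

lemma biv_part_apply:
  "\<Lambda>'' p a b = \<Lambda> p (a o\<^sub>L PF p) (b o\<^sub>L PF p)"
  "\<Lambda>' p a b = \<Lambda> p (a o\<^sub>L PH p) (b o\<^sub>L PH p)"
  by (simp_all add: biv_part_def PF_def PH_def)

lemma bivector_field_biv_part: "bivector_field A \<Lambda>''" "bivector_field A \<Lambda>'"
proof -
  have *: "bivector_field A B"
    if B: "\<And>p a b. B p a b = \<Lambda> p (a o\<^sub>L R p) (b o\<^sub>L R p)"
      and Bin: "\<And>c y a b. c \<in> A \<Longrightarrow> y \<in> cimage c \<Longrightarrow> biv_in A c B y a b = biv_in A c \<Lambda> y (a o\<^sub>L S c y) (b o\<^sub>L S c y)"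
      and S: "\<And>c v. c \<in> A \<Longrightarrow> smooth_on (cimage c) (\<lambda>y. blinfun_apply (S c y) v)" for B R S
    unfolding bivector_field_def
  proof (intro conjI allI ballI)
    fix p a
    have "B p = (\<lambda>a b. \<Lambda> p (a o\<^sub>L R p) (b o\<^sub>L R p))" by (intro ext) (rule B)
    then show "bilinear (B p)"
      using bilinear_compose[OF bilinear_\<Lambda> blinfun_compose_linear blinfun_compose_linear] by simp
    show "B p a a = 0" using \<Lambda>_skew[of p "a o\<^sub>L R p" "a o\<^sub>L R p"] by (simp add: B)
  next
    fix c a b assume c: "c \<in> A"
    have s: "smooth_on (cimage c) (\<lambda>y. blinfun_apply (a o\<^sub>L S c y) i)" for a :: "'e \<Rightarrow>\<^sub>L real" and i
      using smooth_on_bounded_linear[OF chart_image_open[OF c] blinfun.bounded_linear_right S[OF c]] by simp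
    show "smooth_on (cimage c) (\<lambda>y. biv_in A c B y a b)"
      by (rule smooth_on_eqI[OF chart_image_open[OF c] smooth_on_bilinear_covectors[OF chart_image_open[OF c]
            bilinear_biv_in[OF \<Lambda>] biv_in_smooth[OF \<Lambda> c] s s]]) (use Bin[OF c] in auto)
  qed
  show "bivector_field A \<Lambda>''"
    by (rule *[of _ PF PF_in]) (auto simp: biv_part_apply biv_part_in PF_in_smooth)
  show "bivector_field A \<Lambda>'"
    by (rule *[of _ PH PH_in]) (auto simp: biv_part_apply biv_part_in PH_in_smooth)
qed

lemma biv_deriv_part_F:
  "biv_deriv A \<Lambda>'' p u a b = biv_deriv A \<Lambda> p u (a o\<^sub>L PF p) (b o\<^sub>L PF p)
    + \<Lambda> p (a o\<^sub>L dPF p u) (b o\<^sub>L PF p) + \<Lambda> p (a o\<^sub>L PF p) (b o\<^sub>L dPF p u)"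
proof -
  have D: "((\<lambda>y. biv_in A (ch p) \<Lambda>'' y a b) has_derivative
      (\<lambda>u. biv_deriv A \<Lambda> p u (a o\<^sub>L PF p) (b o\<^sub>L PF p)
        + \<Lambda> p (a o\<^sub>L dPF p u) (b o\<^sub>L PF p) + \<Lambda> p (a o\<^sub>L PF p) (b o\<^sub>L dPF p u)))
      (at (org p))"
    by (rule has_derivative_transform_within_open[OF
          biv_in_compose_has_derivative[OF PF_in_has_derivative PF_in_has_derivative, of p a b, unfolded PF_in_at]
          chart_image_open[OF chart_at(1)] chart_at_image])
      (simp add: biv_part_in(1)[OF _ chart_at(1)])
  show ?thesis
    unfolding biv_deriv_def[of A "\<Lambda>''"] Let_def frechet_derivative_eqI[OF D] by simp
qed

lemma biv_deriv_part_H: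
  "biv_deriv A \<Lambda>' p u a b = biv_deriv A \<Lambda> p u (a o\<^sub>L PH p) (b o\<^sub>L PH p)
    - \<Lambda> p (a o\<^sub>L dPF p u) (b o\<^sub>L PH p) - \<Lambda> p (a o\<^sub>L PH p) (b o\<^sub>L dPF p u)"
proof -
  have D: "((\<lambda>y. biv_in A (ch p) \<Lambda>' y a b) has_derivative
      (\<lambda>u. biv_deriv A \<Lambda> p u (a o\<^sub>L PH p) (b o\<^sub>L PH p)
        + \<Lambda> p (a o\<^sub>L (- dPF p u)) (b o\<^sub>L PH p) + \<Lambda> p (a o\<^sub>L PH p) (b o\<^sub>L (- dPF p u))))
      (at (org p))"
    by (rule has_derivative_transform_within_open[OF
          biv_in_compose_has_derivative[OF PH_in_has_derivative' PH_in_has_derivative', of p a b, unfolded PH_in_at]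
          chart_image_open[OF chart_at(1)] chart_at_image])
      (simp add: biv_part_in(2)[OF _ chart_at(1)])
  show ?thesis
    unfolding biv_deriv_def[of A "\<Lambda>'"] Let_def frechet_derivative_eqI[OF D]
    by (simp add: compose_uminus \<Lambda>_uminus)
qed

text \<open>The derivative of the idempotency of the projection. In consequence each
  \<open>dPF p u\<close> sends \<open>F\<close> into \<open>H\<close>.\<close>

lemma dPF_projection: "dPF p u (PF p v) + PF p (dPF p u v) = dPF p u v"
proof -
  define c where "c = ch p"
  have idem: "PF_in c y (PF_in c y v) = PF_in c y v" if y: "y \<in> cimage c" for y
    using from_to_chart_id[OF chart_at_smooth[of p, folded c_def] cinv_mem[OF y]]
    by (simp add: PF_in_def PF_F[OF PF_mem])
  have "((\<lambda>y. PF_in c y v) has_derivative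
      (\<lambda>u. dPF p u (PF_in c (cmap c p) v) + PF p (dPF p u v))) (at (cmap c p))"
    unfolding c_def
    by (rule has_derivative_transform_within_open[OF PF_in_field_has_derivative[OF PF_in_has_derivative]
          chart_image_open[OF chart_at(1)] chart_at_image]) (rule idem[unfolded c_def])
  from frechet_derivative_eqI[OF this, of u] frechet_derivative_eqI[OF PF_in_has_derivative[of p v], of u]
  show ?thesis by (simp add: c_def)
qed

lemma dPF_F: "w \<in> F p \<Longrightarrow> PF p (dPF p u w) = 0"
  using dPF_projection[of p u w] by (simp add: PF_F)

text \<open>Differentials of first integrals vanish on \<open>PF_in c y v\<close> for each fixed
  \<open>v\<close>. Differentiating this replaces \<open>dPF p u v\<close> by minus their Hessian in
  \<open>u\<close> and \<open>v\<close>, which is symmetric.\<close>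

lemma dPF_involutive:
  assumes u: "u \<in> F p" and v: "v \<in> F p"
  shows "dPF p u v - dPF p v u \<in> F p"
proof -
  define c where "c = ch p"
  have c: "smooth_chart A c" "p \<in> cdom c" using chart_at chart_at_smooth by (auto simp: c_def)
  obtain \<phi> where \<phi>: "\<phi> \<in> \<Phi>" "p \<in> cdom \<phi>" by (rule foliated_chart_exists)
  define N where "N = cmap c ` (cdom c \<inter> cdom \<phi>)"
  have N: "open N" "cmap c p \<in> N"
    using transition_open[OF c(1) foliated_chart[OF \<phi>(1)]] c \<phi> by (auto simp: N_def)
  have smooth: "smooth_on N (first_integral \<phi> c w)" for w
    unfolding N_def by (rule first_integral_smooth[OF c(1) \<phi>(1)])
  have "fderiv (first_integral \<phi> c w) (cmap c p) (dPF p u v - dPF p v u) = 0"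
    if w: "w \<in> orthogonal_comp V" for w
  proof -
    define \<xi> where "\<xi> = first_integral \<phi> c w"
    have z: "fderiv \<xi> y (PF_in c y v) = 0" if y: "y \<in> N" for y v
    proof -
      obtain q where q: "q \<in> cdom c" "q \<in> cdom \<phi>" "y = cmap c q" using y by (auto simp: N_def)
      show ?thesis
        using iffD1[OF F_iff_first_integral[OF c(1) \<phi>(1) q(1,2)] PF_mem, rule_format, OF w] q c
        by (simp add: PF_in_def smooth_chart_cinv \<xi>_def)
    qed
    have D: "fderiv \<xi> (cmap c p) (dPF p u v)
        = - fderiv (\<lambda>y. fderiv \<xi> y v) (cmap c p) u" if "v \<in> F p" for u v
      using frechet_derivative_constant_along_field[OF N smooth[of w, folded \<xi>_def] PF_in_has_derivative[of p v, folded c_def] z]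
      by (simp add: c_def PF_F that)
    have "linear (fderiv \<xi> (cmap c p))"
      unfolding \<xi>_def by (rule linear_frechet_derivative[OF smooth_on_differentiable[OF smooth N(2)]])
    then show ?thesis
      using D[OF u] D[OF v] symmetric_second_derivative[OF N smooth[of w], of u v]
      by (simp add: linear_diff \<xi>_def)
  qed
  then show ?thesis
    using F_iff_first_integral[OF c(1) \<phi>(1) c(2) \<phi>(2), of "dPF p u v - dPF p v u"] by (simp add: c_def)
qed

lemma form2_in_differentiable:
  "(\<lambda>y. form2_in A (ch p) \<sigma> y v w) differentiable (at (org p))"
  by (rule smooth_on_differentiable[OF form2_in_smooth[OF chart_at(1)] chart_at_image])

text \<open>Differentiate \<open>\<sigma>(\<sharp>a, v) = - a(v)\<close>.\<close>

lemma d\<sigma>_sh: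
  assumes a: "a \<in> ann (F p)" and b: "b \<in> ann (F p)"
  shows "d\<sigma> p u (sh p a) (sh p b) = - biv_deriv A \<Lambda> p u a b"
proof -
  define c where "c = ch p"
  define v where "v = sh p b"
  \<comment> \<open>Extends \<open>\<sharp>a\<close> to the chart. Composing \<open>a\<close> with
    \<open>PH_in\<close> keeps the covector in the annihilator of \<open>F\<close> at every nearby
    point, where \<open>\<sigma>_sh\<close> applies; \<open>v\<close> stays constant in
    coordinates.\<close>
  define S where "S y = sharp (biv_in A c \<Lambda> y) (a o\<^sub>L PH_in c y)" for y
  define S' where "S' u = sharp (biv_deriv A \<Lambda> p u) a - sh p (a o\<^sub>L dPF p u)" for u
  have Si: "S y \<bullet> i = biv_in A c \<Lambda> y (a o\<^sub>L PH_in c y) (blinfun_inner_right i)" for y i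
    using sharp_apply[OF bilinear_biv_in[OF \<Lambda>], of "blinfun_inner_right i"] by (simp add: S_def inner_commute)
  have S'i: "x (S' u) = biv_deriv A \<Lambda> p u a x - \<Lambda> p (a o\<^sub>L dPF p u) x" for x :: "'e \<Rightarrow>\<^sub>L real" and u
    using sharp_apply[OF bilinear_biv_deriv[OF \<Lambda>], of x] by (simp add: S'_def blinfun.diff_right sh)
  have idd: "((\<lambda>y. blinfun_apply id_blinfun v) has_derivative (\<lambda>u. blinfun_apply 0 v)) (at y)" for v y :: 'e
    by simp
  have comp: "x o\<^sub>L id_blinfun = x" "x o\<^sub>L (0 :: 'e \<Rightarrow>\<^sub>L 'e) = 0" for x :: "'e \<Rightarrow>\<^sub>L real"
    by (auto intro!: blinfun_eqI)
  have d: "((\<lambda>y. biv_in A c \<Lambda> y (a o\<^sub>L PH_in c y) x) has_derivative (\<lambda>u. blinfun_apply x (S' u))) (at (cmap c p))" for x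
    using biv_in_compose_has_derivative[OF PH_in_has_derivative' idd, of p a x]
    by (simp add: comp c_def S'i ann_F_compose[OF a] compose_uminus \<Lambda>_uminus bilinear_rzero[OF bilinear_\<Lambda>])
  have Sd: "((\<lambda>y. S y \<bullet> i) has_derivative (\<lambda>u. S' u \<bullet> i)) (at (cmap c p))" for i
    unfolding Si using d[of "blinfun_inner_right i"] by (simp add: inner_commute)
  have S0: "S (cmap c p) = sh p a"
    unfolding S_def sh_def
  proof (rule sharp_eqI[OF bilinear_biv_in[OF \<Lambda>]])
    fix x :: "'e \<Rightarrow>\<^sub>L real"
    show "blinfun_apply x (sharp (\<Lambda> p) a) = biv_in A c \<Lambda> (cmap c p) (a o\<^sub>L PH_in c (cmap c p)) x"
      using sh[of x p a] by (simp add: c_def ann_F_compose[OF a] sh_def)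
  qed
  have eq: "form2_in A c \<sigma> y (S y) v = - blinfun_apply a (PH_in c y v)" if y: "y \<in> cimage c" for y
  proof -
    define q where "q = cinv c y"
    define T where "T = to_chart A c q"
    define R where "R = from_chart A c q"
    have RT: "blinfun_apply R (blinfun_apply T v) = v" for v
      using from_to_chart_id[OF chart_at_smooth[of p, folded c_def] cinv_mem[OF y]] by (simp add: q_def T_def R_def)
    define \<alpha> where "\<alpha> = (a o\<^sub>L T) o\<^sub>L PH q"
    have "a o\<^sub>L PH_in c y o\<^sub>L T = \<alpha>"
      by (rule blinfun_eqI) (simp add: \<alpha>_def PH_in_def q_def[symmetric] T_def[symmetric] R_def[symmetric] RT)
    then have "S y = T (sh q \<alpha>)"
      unfolding S_def
      by (intro sharp_eqI[OF bilinear_biv_in[OF \<Lambda>]])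
        (use sh in \<open>simp add: biv_in_def q_def[symmetric] T_def[symmetric] sh[symmetric]\<close>)
    then have "form2_in A c \<sigma> y (S y) v = \<sigma> q (sh q \<alpha>) (R v)"
      by (simp add: form2_in_def q_def[symmetric] R_def[symmetric] RT)
    also have "\<dots> = - \<alpha> (R v)"
      by (rule \<sigma>_sh) (simp add: \<alpha>_def compose_PH_ann)
    finally show ?thesis by (simp add: \<alpha>_def PH_in_def q_def T_def R_def)
  qed
  have "((\<lambda>y. form2_in A c \<sigma> y (S y) v) has_derivative
      (\<lambda>u. d\<sigma> p u (S (cmap c p)) v + form2_in A c \<sigma> (cmap c p) (S' u) v + form2_in A c \<sigma> (cmap c p) (S (cmap c p)) 0)) (at (cmap c p))"
    unfolding d\<sigma>_def c_def[symmetric]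
    by (rule has_derivative_bilinear_vectors[OF bilinear_form2_in form2_in_differentiable[of p, folded c_def] Sd]) auto
  then have "((\<lambda>y. form2_in A c \<sigma> y (S y) v) has_derivative (\<lambda>u. d\<sigma> p u (sh p a) v + \<sigma> p (S' u) v)) (at (cmap c p))"
    by (simp add: S0 bilinear_rzero[OF bilinear_form2_in]) (simp add: c_def)
  then have d1: "((\<lambda>y. - blinfun_apply a (PH_in c y v)) has_derivative (\<lambda>u. d\<sigma> p u (sh p a) v + \<sigma> p (S' u) v)) (at (cmap c p))"
    unfolding c_def
    by (rule has_derivative_transform_within_open[OF _ chart_image_open[OF chart_at(1)] chart_at_image])
      (rule eq[unfolded c_def])
  have d2: "((\<lambda>y. - blinfun_apply a (PH_in c y v)) has_derivative (\<lambda>u. - blinfun_apply a (- dPF p u v))) (at (cmap c p))"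
    unfolding c_def
    by (intro has_derivative_minus bounded_linear.has_derivative[OF blinfun.bounded_linear_right] PH_in_has_derivative)
  \<comment> \<open>The term \<open>a (dPF p u v)\<close> arises here from differentiating
    \<open>PH_in\<close>; it reappears in \<open>b (S' u)\<close>, and the two cancel.\<close>
  have "d\<sigma> p u (sh p a) v + \<sigma> p (S' u) v = a (dPF p u v)"
    using frechet_derivative_eqI[OF d1, of u] frechet_derivative_eqI[OF d2, of u]
    by (simp add: blinfun.minus_right)
  moreover have "\<sigma> p (S' u) v = b (S' u)"
    using \<sigma>_sh[OF b, of "S' u"] \<sigma>_skew[of p "S' u"] by (simp add: v_def)
  moreover have "b (S' u) = biv_deriv A \<Lambda> p u a b + a (dPF p u v)"
    using S'i[of b u] \<Lambda>_skew[of p "a o\<^sub>L dPF p u" b] sh[of "a o\<^sub>L dPF p u" p b] by (simp add: v_def)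
  ultimately show ?thesis by (simp add: v_def)
qed

section \<open>Projectable vector fields\<close>

lemma vf_bracket_eq: "vf_bracket A X Y p = vf_deriv A Y p (X p) - vf_deriv A X p (Y p)"
  by (simp add: vf_bracket_def vf_deriv_def Let_def)

text \<open>A field with constant coefficients in a foliated chart is projected to \<open>H\<close>.
  Differentials of first integrals do not see the removed \<open>F\<close>-part, so they stay
  constant on \<open>X\<close>, while they vanish on fields tangent to \<open>F\<close>; symmetry of
  the Hessian then makes them vanish on the bracket.\<close>

lemma exists_projectable:
  assumes x: "x \<in> H p"
  obtains U X where "open U" "p \<in> U" "projectable A F H U X" "X p = x"
proof -
  obtain \<phi> where \<phi>: "\<phi> \<in> \<Phi>" "p \<in> cdom \<phi>" by (rule foliated_chart_exists)
  note \<phi>s = foliated_chart[OF \<phi>(1)]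
  define z where "z = to_chart A \<phi> p x"
  define Z where "Z q = from_chart A \<phi> q z" for q
  define U where "U = cdom \<phi>"
  define X where "X q = PH q (Z q)" for q
  have U: "open U" using \<phi>s by (simp add: U_def)
  have Xsm: "vector_field A U X"
  proof (rule vector_field_localI)
    fix q assume q: "q \<in> U"
    define c where "c = ch q"
    have c: "c \<in> A" "smooth_chart A c" "q \<in> cdom c" using chart_at chart_at_smooth by (auto simp: c_def)
    define N where "N = cdom c \<inter> cdom \<phi>"
    have N: "open N" "q \<in> N" "N \<subseteq> cdom c" "N \<subseteq> cdom \<phi>"
      using c \<phi>s q by (auto simp: N_def U_def)
    have o: "open (cmap c ` N)" "open (cmap \<phi> ` N)"
      using smooth_chart_open_image[OF c(2) N(1,3)] smooth_chart_open_image[OF \<phi>s N(1,4)] by auto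
    have t: "smooth_on (cmap \<phi> ` N) (transition \<phi> c)" "smooth_on (cmap c ` N) (transition c \<phi>)"
      using transition_smooth[OF c(2) \<phi>s] transition_smooth[OF \<phi>s c(2)] by (auto simp: N_def Int_commute)
    have into: "transition c \<phi> ` cmap c ` N \<subseteq> cmap \<phi> ` N"
      using N by (auto simp: transition_cmap[OF c(2)])
    have Zs: "smooth_on (cmap c ` N) (vf_in A c Z)"
    proof (rule smooth_on_eqI[OF o(1) smooth_on_compose[OF o into smooth_on_frechet[OF t(1), of z] t(2)]])
      fix y assume "y \<in> cmap c ` N"
      then obtain r where r: "r \<in> cdom c" "r \<in> cdom \<phi>" "y = cmap c r" by (auto simp: N_def)
      show "vf_in A c Z y = fderiv (transition \<phi> c) (transition c \<phi> y) z"
        unfolding r(3) transition_cmap[OF c(2) r(1)] frechet_derivative_transition[OF \<phi>s c(2) r(2,1)]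
        by (simp add: vf_in_def Z_def smooth_chart_cinv[OF c(2) r(1)] to_from_chart[OF \<phi>s r(2) c(2) r(1)])
    qed
    have "smooth_on (cmap c ` N) (\<lambda>y. PH_in c y (vf_in A c Z y))"
      by (rule smooth_on_blinfun_apply[OF o(1) smooth_on_subset[OF PH_in_smooth[OF c(1)]] Zs]) (use N in auto)
    then have "smooth_on (cmap c ` N) (vf_in A c X)"
      by (rule smooth_on_eqI[OF o(1)]) (use N vf_in_PH[OF c(1), of _ Z] in \<open>auto simp: X_def[abs_def]\<close>)
    then show "\<exists>c N. smooth_chart A c \<and> open N \<and> q \<in> N \<and> N \<subseteq> cdom c \<and> N \<subseteq> U \<and> smooth_on (cmap c ` N) (vf_in A c X)"
      using c N unfolding U_def by blast
  qed
  have "vf_bracket A Y X q \<in> F q"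
    if Y: "vector_field A U Y" and YF: "\<forall>q\<in>U. Y q \<in> F q" and q: "q \<in> U" for Y q
  proof -
    define c where "c = ch q"
    have c: "smooth_chart A c" "q \<in> cdom c" using chart_at chart_at_smooth by (auto simp: c_def)
    have q\<phi>: "q \<in> cdom \<phi>" using q by (simp add: U_def)
    define N where "N = cmap c ` (cdom c \<inter> cdom \<phi>)"
    have N: "open N" "cmap c q \<in> N" using transition_open[OF c(1) \<phi>s] c q\<phi> by (auto simp: N_def)
    have "fderiv (first_integral \<phi> c w) (cmap c q) (vf_bracket A Y X q) = 0"
      if w: "w \<in> orthogonal_comp V" for w
    proof -
      define \<xi> where "\<xi> = first_integral \<phi> c w"
      have smooth: "smooth_on N \<xi>"
        unfolding N_def \<xi>_def by (rule first_integral_smooth[OF c(1) \<phi>(1)])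
      have zY: "fderiv \<xi> y (vf_in A c Y y) = 0" if y: "y \<in> N" for y
      proof -
        obtain r where r: "r \<in> cdom c" "r \<in> cdom \<phi>" "y = cmap c r" using y by (auto simp: N_def)
        show ?thesis
          using iffD1[OF F_iff_first_integral[OF c(1) \<phi>(1) r(1,2)], of "Y r", rule_format, OF _ w] YF r c
          by (simp add: vf_in_def smooth_chart_cinv \<xi>_def U_def)
      qed
      have zX: "fderiv \<xi> y (vf_in A c X y) = w \<bullet> z" if y: "y \<in> N" for y
      proof -
        obtain r where r: "r \<in> cdom c" "r \<in> cdom \<phi>" "y = cmap c r" using y by (auto simp: N_def)
        have "w \<bullet> to_chart A \<phi> r (PF r (Z r)) = 0"
          using PF_mem[of r "Z r"] w unfolding F_iff_chart[OF \<phi>(1) r(2)] mem_subspace_iff_orthogonal[OF subspace_V] by blast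
        moreover have "to_chart A \<phi> r (Z r) = z" using \<phi>s r by (simp add: Z_def)
        ultimately have "w \<bullet> to_chart A \<phi> r (X r) = w \<bullet> z"
          by (simp add: X_def PH_eq blinfun.diff_right inner_diff_right)
        then show ?thesis
          using r c frechet_first_integral[OF c(1) \<phi>(1) r(1,2)] by (simp add: vf_in_def smooth_chart_cinv \<xi>_def)
      qed
      note dX = vf_in_has_derivative[OF Xsm U q, folded c_def] and dY = vf_in_has_derivative[OF Y U q, folded c_def]
      have "fderiv \<xi> (cmap c q) (vf_deriv A X q (Y q))
          = - fderiv (\<lambda>y. fderiv \<xi> y (X q)) (cmap c q) (Y q)"
        using frechet_derivative_constant_along_field[OF N smooth dX zX] by (simp add: c_def)
      moreover have "fderiv \<xi> (cmap c q) (vf_deriv A Y q (X q))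
          = - fderiv (\<lambda>y. fderiv \<xi> y (Y q)) (cmap c q) (X q)"
        using frechet_derivative_constant_along_field[OF N smooth dY zY] by (simp add: c_def)
      moreover have "linear (fderiv \<xi> (cmap c q))"
        by (rule linear_frechet_derivative[OF smooth_on_differentiable[OF smooth N(2)]])
      ultimately show ?thesis
        using symmetric_second_derivative[OF N smooth, of "X q" "Y q"]
        by (simp add: vf_bracket_eq linear_diff \<xi>_def)
    qed
    then show ?thesis
      using F_iff_first_integral[OF c(1) \<phi>(1) c(2) q\<phi>, of "vf_bracket A Y X q"] by (simp add: c_def)
  qed
  then have "projectable A F H U X"
    using Xsm by (auto simp: projectable_def X_def PH_mem)
  moreover have "X p = x" using \<phi> \<phi>s x by (simp add: X_def Z_def z_def PH_H)
  ultimately show thesis using that U \<phi>(2) by (simp add: U_def)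
qed

context
  fixes U X p
  assumes U: "open U" "p \<in> U" and X: "projectable A F H U X"
begin

lemma projectable_vector_field: "vector_field A U X" and projectable_mem: "X p \<in> H p"
  using X U by (auto simp: projectable_def)

lemmas projectable_has_derivative = vf_in_has_derivative[OF projectable_vector_field U]

text \<open>Differentiates the identity that the \<open>F\<close>-part of \<open>X\<close> is
  zero.\<close>

lemma PF_vf_deriv_projectable: "PF p (vf_deriv A X p v) = - dPF p v (X p)"
proof -
  define c where "c = ch p"
  have c: "c \<in> A" "smooth_chart A c" "p \<in> cdom c" using chart_at chart_at_smooth by (auto simp: c_def)
  have o: "open (cmap c ` (U \<inter> cdom c))" using U c by (intro smooth_chart_open_image[OF c(2)]) auto
  have y0: "cmap c p \<in> cmap c ` (U \<inter> cdom c)" using U c by auto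
  have z: "PF_in c y (vf_in A c X y) = 0" if y: "y \<in> cmap c ` (U \<inter> cdom c)" for y
  proof -
    obtain q where q: "q \<in> U" "q \<in> cdom c" "y = cmap c q" using y by auto
    have "PF q (X q) = 0" using X q by (auto simp: projectable_def intro: PF_H)
    then show ?thesis using q c by (simp add: PF_in_def vf_in_def smooth_chart_cinv)
  qed
  have "((\<lambda>y. 0) has_derivative (\<lambda>v. dPF p v (vf_in A c X (cmap c p)) + PF p (vf_deriv A X p v))) (at (cmap c p))"
    unfolding c_def
    by (rule has_derivative_transform_within_open[OF PF_in_field_has_derivative[OF projectable_has_derivative]
          o[unfolded c_def] y0[unfolded c_def]]) (rule z[unfolded c_def])
  from frechet_derivative_eqI[OF this, of v] have "dPF p v (X p) + PF p (vf_deriv A X p v) = 0"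
    by (simp add: frechet_derivative_const c_def)
  then show ?thesis by (simp add: eq_neg_iff_add_eq_0 add.commute)
qed

text \<open>Projectability is tested on \<open>Y = PF W\<close> with \<open>W p = u\<close>. Modulo
  \<open>F\<close> the derivative of \<open>Y\<close> along \<open>X\<close> is that of the
  projection alone, so the result does not depend on the extension \<open>W\<close>.\<close>

lemma PH_vf_deriv_projectable:
  assumes u: "u \<in> F p"
  shows "PH p (vf_deriv A X p u) = PH p (dPF p (X p) u)"
proof -
  obtain W where W: "vector_field A UNIV W" "W p = u" by (rule exists_vector_field_through)
  then have WU: "vector_field A U W" unfolding vector_field_def by (auto intro: smooth_on_subset)
  define Y where "Y q = PF q (W q)" for q
  have Y: "vector_field A U Y"
    using vector_field_PF[OF WU U(1)] by (simp add: Y_def[abs_def])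
  have "vf_bracket A Y X p \<in> F p"
    using X U Y PF_mem unfolding projectable_def by (auto simp: Y_def)
  moreover have Yp: "Y p = u" using W u by (simp add: Y_def PF_F)
  ultimately have "PH p (vf_deriv A X p u - vf_deriv A Y p (X p)) = 0"
    by (simp add: vf_bracket_eq F_iff)
  moreover have "vf_deriv A Y p (X p) = dPF p (X p) u + PF p (vf_deriv A W p (X p))"
  proof -
    define c where "c = ch p"
    have c: "c \<in> A" using chart_at by (simp add: c_def)
    have "(vf_in A c Y has_derivative (\<lambda>v. dPF p v (vf_in A c W (cmap c p)) + PF p (vf_deriv A W p v))) (at (cmap c p))"
      unfolding c_def
      by (rule has_derivative_transform_within_open[OF PF_in_field_has_derivative[OF vf_in_has_derivative[OF WU U]]
            chart_image_open[OF chart_at(1)] chart_at_image])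
        (use vf_in_PF[OF chart_at(1), of _ _ W] in \<open>simp add: Y_def[abs_def]\<close>)
    from frechet_derivative_eqI[OF this, of "X p"] show ?thesis
      by (simp add: vf_deriv_def[of A Y] Let_def c_def W)
  qed
  ultimately show ?thesis
    by (simp add: blinfun.diff_right blinfun.add_right PH_F[OF PF_mem])
qed

end

text \<open>Restricting is not immediate, since fewer fields \<open>Y\<close> are available on the larger set; the
  condition is however determined by the first-order jets of \<open>X\<close>.\<close>

lemma projectable_subset:
  assumes X: "projectable A F H U X" and U: "open U" "W \<subseteq> U" and W: "open W"
  shows "projectable A F H W X"
proof -
  have "vf_bracket A Y X p \<in> F p"
    if Y: "vector_field A W Y" "\<forall>p\<in>W. Y p \<in> F p" and p: "p \<in> W" for Y p
  proof -
    have pU: "p \<in> U" using p U by blast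
    define c where "c = ch p"
    have c: "c \<in> A" "smooth_chart A c" "p \<in> cdom c" using chart_at chart_at_smooth by (auto simp: c_def)
    have o: "open (cmap c ` (W \<inter> cdom c))" using W c by (intro smooth_chart_open_image[OF c(2)]) auto
    have y0: "cmap c p \<in> cmap c ` (W \<inter> cdom c)" using p c by auto
    \<comment> \<open>Differentiating \<open>PF Y = Y\<close> determines the derivative of
      \<open>Y\<close> modulo \<open>F\<close>, which is then compared with that of
      \<open>X\<close>.\<close>
    have eq: "PF_in c y (vf_in A c Y y) = vf_in A c Y y" if y: "y \<in> cmap c ` (W \<inter> cdom c)" for y
    proof -
      obtain q where q: "q \<in> W" "q \<in> cdom c" "y = cmap c q" using y by auto
      then show ?thesis using Y(2) c PF_F by (simp add: PF_in_def vf_in_def smooth_chart_cinv)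
    qed
    have "(vf_in A c Y has_derivative (\<lambda>v. dPF p v (vf_in A c Y (cmap c p)) + PF p (vf_deriv A Y p v))) (at (cmap c p))"
      unfolding c_def
      by (rule has_derivative_transform_within_open[OF PF_in_field_has_derivative[OF vf_in_has_derivative[OF Y(1) W p]]
            o[unfolded c_def] y0[unfolded c_def]]) (rule eq[unfolded c_def])
    from frechet_derivative_eqI[OF this, of "X p"]
    have "vf_deriv A Y p (X p) = dPF p (X p) (Y p) + PF p (vf_deriv A Y p (X p))"
      by (simp add: vf_deriv_def[of A Y] Let_def c_def)
    then have "PH p (vf_deriv A Y p (X p)) = PH p (dPF p (X p) (Y p))"
      by (metis PH_F[OF PF_mem] add.right_neutral blinfun.add_right)
    then show ?thesis
      using PH_vf_deriv_projectable[OF U(1) pU X, of "Y p"] Y(2) p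
      by (simp add: F_iff vf_bracket_eq blinfun.diff_right)
  qed
  moreover have "vector_field A W X"
    using X U(2) unfolding projectable_def vector_field_def by (auto intro: smooth_on_subset)
  ultimately show ?thesis using X U(2) unfolding projectable_def by blast
qed

lemma fun_differential_\<sigma>:
  assumes U: "open U" "p \<in> U" and X: "vector_field A U X" and Y: "vector_field A U Y"
  shows "fun_differential A (\<lambda>q. \<sigma> q (X q) (Y q)) p u =
    d\<sigma> p u (X p) (Y p) + \<sigma> p (vf_deriv A X p u) (Y p) + \<sigma> p (X p) (vf_deriv A Y p u)"
proof -
  define c where "c = ch p"
  have c: "c \<in> A" "smooth_chart A c" "p \<in> cdom c" using chart_at chart_at_smooth by (auto simp: c_def)
  have o: "open (cmap c ` (U \<inter> cdom c))" using U c by (intro smooth_chart_open_image[OF c(2)]) auto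
  have y0: "cmap c p \<in> cmap c ` (U \<inter> cdom c)" using U c by auto
  define f where "f = (\<lambda>q. \<sigma> q (X q) (Y q))"
  define k where "k y = form2_in A c \<sigma> y (vf_in A c X y) (vf_in A c Y y)" for y
  define k' where "k' u = fderiv (\<lambda>y. form2_in A c \<sigma> y (vf_in A c X (cmap c p)) (vf_in A c Y (cmap c p))) (cmap c p) u
        + form2_in A c \<sigma> (cmap c p) (vf_deriv A X p u) (vf_in A c Y (cmap c p))
        + form2_in A c \<sigma> (cmap c p) (vf_in A c X (cmap c p)) (vf_deriv A Y p u)" for u
  have "(k has_derivative k') (at (cmap c p))"
    unfolding k_def k'_def c_def
    by (intro has_derivative_bilinear_vectors[OF bilinear_form2_in form2_in_differentiable]
        has_derivative_inner_left vf_in_has_derivative[OF X U] vf_in_has_derivative[OF Y U])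
  then have D: "((f \<circ> cinv c) has_derivative k') (at (cmap c p))"
    by (rule has_derivative_transform_within_open[OF _ o y0])
      (use c in \<open>auto simp: k_def f_def form2_in_def vf_in_def smooth_chart_cinv\<close>)
  show ?thesis
    using fun_differential_chart[OF c(2,3) differentiableI[OF D], of u] frechet_derivative_eqI[OF D, of u]
    by (simp add: f_def[symmetric] k'_def c_def d\<sigma>_def)
qed

section \<open>The type components of the Jacobi conditions\<close>

text \<open>Cyclic rotation brings each of the eight triples of pure covectors to one of the four
  listed orders; splitting the slots one after another then reaches arbitrary covectors.\<close>

lemma trilinear_vanish_by_type:
  fixes R :: "('e \<Rightarrow>\<^sub>L real) \<Rightarrow> ('e \<Rightarrow>\<^sub>L real) \<Rightarrow> ('e \<Rightarrow>\<^sub>L real) \<Rightarrow> real"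
  assumes add: "\<And>a a' b c. R (a + a') b c = R a b c + R a' b c" and cyc: "\<And>a b c. R a b c = R b c a"
    and FFF: "\<And>a b c. a \<in> ann (F p) \<Longrightarrow> b \<in> ann (F p) \<Longrightarrow> c \<in> ann (F p) \<Longrightarrow> R a b c = 0"
    and FFH: "\<And>a b c. a \<in> ann (F p) \<Longrightarrow> b \<in> ann (F p) \<Longrightarrow> c \<in> ann (H p) \<Longrightarrow> R a b c = 0"
    and FHH: "\<And>a b c. a \<in> ann (F p) \<Longrightarrow> b \<in> ann (H p) \<Longrightarrow> c \<in> ann (H p) \<Longrightarrow> R a b c = 0"
    and HHH: "\<And>a b c. a \<in> ann (H p) \<Longrightarrow> b \<in> ann (H p) \<Longrightarrow> c \<in> ann (H p) \<Longrightarrow> R a b c = 0"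
  shows "R a b c = 0"
proof -
  define N where "N = ann (F p) \<union> ann (H p)"
  have t: "R a b c = 0" if "a \<in> N" "b \<in> N" "c \<in> N" for a b c
    using that FFF[of a b c] FFH[of a b c] FHH[of a b c] HHH[of a b c] FFH[of c a b] FFH[of b c a]
      FHH[of b c a] FHH[of c a b] cyc[of a b c] cyc[of b c a] unfolding N_def by auto
  have split: "\<exists>x y. x \<in> N \<and> y \<in> N \<and> a = x + y" for a
    using covector_split[of a p] compose_PH_ann[of a p] compose_PF_ann[of a p] unfolding N_def by blast
  have 1: "R a b c = 0" if "b \<in> N" "c \<in> N" for a b c
  proof -
    obtain x y where "x \<in> N" "y \<in> N" "a = x + y" using split by blast
    then show ?thesis using that t by (simp add: add)
  qed
  have 2: "R a b c = 0" if "c \<in> N" for a b c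
  proof -
    obtain x y where "x \<in> N" "y \<in> N" "b = x + y" using split by blast
    then show ?thesis using that 1 cyc[of a x c] cyc[of a y c] cyc[of a "x + y" c] by (simp add: add)
  qed
  obtain x y where "x \<in> N" "y \<in> N" "c = x + y" using split by blast
  then show ?thesis
    using 2 cyc[of x a b] cyc[of y a b] cyc[of "x + y" a b] by (simp add: add)
qed

lemma E_mem: "E p \<in> H p"
  using coupling by (simp add: coupling_second_kind_def H_def)

lemma ann_H_E: "l \<in> ann (H p) \<Longrightarrow> blinfun_apply l (E p) = 0"
  using E_mem by (auto simp: ann_def)

lemma ann_H_eqI:
  assumes "v \<in> F p" "w \<in> F p" "\<And>l. l \<in> ann (H p) \<Longrightarrow> blinfun_apply l v = blinfun_apply l w"
  shows "v = w"
proof (rule covector_separates)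
  fix b :: "'e \<Rightarrow>\<^sub>L real"
  show "blinfun_apply b v = blinfun_apply b w"
    using assms(3)[OF compose_PF_ann, of b] PF_F[OF assms(1)] PF_F[OF assms(2)] by simp
qed

lemma \<Lambda>_compose_PF: "\<Lambda> p (a o\<^sub>L PF p) b = \<Lambda> p (a o\<^sub>L PF p) (b o\<^sub>L PF p)"
  and \<Lambda>_compose_PH: "\<Lambda> p (a o\<^sub>L PH p) b = \<Lambda> p (a o\<^sub>L PH p) (b o\<^sub>L PH p)"
  by (subst covector_split[of b p], simp add: bilinear_radd[OF bilinear_\<Lambda>] \<Lambda>_mixed compose_PH_ann compose_PF_ann)+

lemma sharp_part_F: "sharp (\<Lambda>'' p) a = sh p (a o\<^sub>L PF p)"
  by (rule sharp_eqI[OF bivector_fieldD(1)[OF bivector_field_biv_part(1)]])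
    (simp add: sh biv_part_apply \<Lambda>_compose_PF[symmetric])

lemma sharp_part_H: "sharp (\<Lambda>' p) a = sh p (a o\<^sub>L PH p)"
  by (rule sharp_eqI[OF bivector_fieldD(1)[OF bivector_field_biv_part(2)]])
    (simp add: sh biv_part_apply \<Lambda>_compose_PH[symmetric])

lemma sh_0 [simp]: "sh p 0 = 0"
  by (rule covector_separates) (simp add: sh bilinear_lzero[OF bilinear_\<Lambda>])

lemma sh_skew: "blinfun_apply b (sh p a) = - blinfun_apply a (sh p b)"
  unfolding sh by (rule \<Lambda>_skew)

lemma deriv_mixed_ann:
  assumes a: "a \<in> ann (F p)" and l: "l \<in> ann (H p)"
  shows "biv_deriv A \<Lambda> p u l a = a (dPF p u (sh p l)) + l (dPF p u (sh p a))"
    "biv_deriv A \<Lambda> p u a l = - (a (dPF p u (sh p l)) + l (dPF p u (sh p a)))"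
proof -
  show *: "biv_deriv A \<Lambda> p u l a = a (dPF p u (sh p l)) + l (dPF p u (sh p a))"
    using deriv_mixed[of p u l a] sh[of "a o\<^sub>L dPF p u" p l] sh[of a p "l o\<^sub>L dPF p u"] sh_skew[of a p "l o\<^sub>L dPF p u"]
    by (simp add: ann_F_compose[OF a] ann_H_compose[OF l])
  show "biv_deriv A \<Lambda> p u a l = - (a (dPF p u (sh p l)) + l (dPF p u (sh p a)))"
    using * biv_deriv_skew[OF \<Lambda>, of p u a l] by simp
qed

lemma biv_deriv_part_F_ann:
  "l \<in> ann (H p) \<Longrightarrow> m \<in> ann (H p) \<Longrightarrow> biv_deriv A \<Lambda>'' p u l m = biv_deriv A \<Lambda> p u l m"
  "a \<in> ann (F p) \<Longrightarrow> biv_deriv A \<Lambda>'' p u a b = - a (dPF p u (sh p (b o\<^sub>L PF p)))"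
proof -
  assume l: "l \<in> ann (H p)" and m: "m \<in> ann (H p)"
  \<comment> \<open>The vector \<open>\<sharp>x\<close> lies in \<open>F\<close>, and
    \<open>dPF p u\<close> sends it into \<open>H\<close>, where \<open>y\<close> vanishes.\<close>
  have z: "\<Lambda> p x (y o\<^sub>L dPF p u) = 0" if "x \<in> ann (H p)" "y \<in> ann (H p)" for x y
    using sh[of "y o\<^sub>L dPF p u" p x] dPF_F[OF sh_ann_H[OF that(1)], of u] ann_H(2)[OF that(2), of "dPF p u (sh p x)"] by simp
  show "biv_deriv A \<Lambda>'' p u l m = biv_deriv A \<Lambda> p u l m"
    using z[OF l m] z[OF m l] \<Lambda>_skew[of p "l o\<^sub>L dPF p u" m]
    by (simp add: biv_deriv_part_F ann_H_compose[OF l] ann_H_compose[OF m])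
next
  assume a: "a \<in> ann (F p)"
  show "biv_deriv A \<Lambda>'' p u a b = - a (dPF p u (sh p (b o\<^sub>L PF p)))"
    using sh[of "b o\<^sub>L PF p" p "a o\<^sub>L dPF p u"] sh_skew[of "b o\<^sub>L PF p" p "a o\<^sub>L dPF p u"]
    by (simp add: biv_deriv_part_F ann_F_compose[OF a] bilinear_lzero[OF bilinear_biv_deriv[OF \<Lambda>]] bilinear_lzero[OF bilinear_\<Lambda>])
qed

lemma biv_deriv_part_H_ann:
  "l \<in> ann (H p) \<Longrightarrow> m \<in> ann (H p) \<Longrightarrow> biv_deriv A \<Lambda>' p u l m = 0"
  by (simp add: biv_deriv_part_H ann_H_compose bilinear_lzero[OF bilinear_biv_deriv[OF \<Lambda>]]
      bilinear_lzero[OF bilinear_\<Lambda>] bilinear_rzero[OF bilinear_\<Lambda>])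

lemma dPF_symmetric_mod_F:
  assumes "a \<in> ann (F p)" "u \<in> F p" "v \<in> F p"
  shows "blinfun_apply a (dPF p u v) = blinfun_apply a (dPF p v u)"
  using dPF_involutive[OF assms(2,3)] assms(1) by (auto simp: ann_def blinfun.diff_right)

subsection \<open>Type (0,3)\<close>

lemma half_schouten_part_F:
  assumes "l \<in> ann (H p)" "m \<in> ann (H p)" "n \<in> ann (H p)"
  shows "half_schouten A \<Lambda>'' p l m n = half_schouten A \<Lambda> p l m n"
  by (simp add: half_schouten_def sharp_part_F ann_H_compose assms biv_deriv_part_F_ann) (simp add: sh_def)

text \<open>Involutivity: the bracket of a leaf-tangent bivector with itself is leaf-tangent. One
  summand vanishes since the sharp of \<open>a\<close> is zero for \<open>\<Lambda>''\<close>; the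
  other two cancel by symmetry of \<open>dPF\<close> modulo \<open>F\<close>.\<close>

lemma half_schouten_part_F_ann_F:
  assumes a: "a \<in> ann (F p)"
  shows "half_schouten A \<Lambda>'' p a b c = 0"
proof -
  have "biv_deriv A \<Lambda>'' p (sharp (\<Lambda>'' p) a) b c = 0"
    using linear_0[OF linear_biv_deriv[OF bivector_field_biv_part(1)]]
    by (simp add: sharp_part_F ann_F_compose[OF a])
  moreover have "biv_deriv A \<Lambda>'' p (sharp (\<Lambda>'' p) c) a b
      = - biv_deriv A \<Lambda>'' p (sharp (\<Lambda>'' p) b) c a"
    unfolding biv_deriv_skew[OF bivector_field_biv_part(1), of _ _ c a]
    by (simp add: biv_deriv_part_F_ann(2)[OF a] sharp_part_F
        dPF_symmetric_mod_F[OF a sh_ann_H[OF compose_PF_ann] sh_ann_H[OF compose_PF_ann], of c b])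
  ultimately show ?thesis by (simp add: half_schouten_def)
qed

text \<open>The bracket of \<open>\<Lambda>''\<close> with itself has only its component of type
  (0,3), and this agrees with the same component of the bracket of \<open>\<Lambda>\<close>.\<close>

lemma leaf_tangent_poisson_iff:
  "leaf_tangent_poisson A F \<Lambda>'' \<longleftrightarrow>
    (\<forall>p. \<forall>l\<in>ann (H p). \<forall>m\<in>ann (H p). \<forall>n\<in>ann (H p). half_schouten A \<Lambda> p l m n = 0)" (is "_ \<longleftrightarrow> ?R")
proof -
  note bf = bivector_field_biv_part(1)
  have "\<forall>p. \<forall>a\<in>ann (F p). \<forall>b. \<Lambda>'' p a b = 0"
    by (simp add: biv_part_apply ann_F_compose bilinear_lzero[OF bilinear_\<Lambda>])
  then have "leaf_tangent_poisson A F \<Lambda>'' \<longleftrightarrow> (\<forall>p a b c. half_schouten A \<Lambda>'' p a b c = 0)"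
    by (simp add: leaf_tangent_poisson_def poisson_structure_iff[OF bf])
  also have "\<dots> \<longleftrightarrow> ?R"
  proof
    assume "\<forall>p a b c. half_schouten A \<Lambda>'' p a b c = 0"
    then show ?R using half_schouten_part_F by metis
  next
    assume ?R
    show "\<forall>p a b c. half_schouten A \<Lambda>'' p a b c = 0"
    proof (intro allI)
      fix p a b c
      show "half_schouten A \<Lambda>'' p a b c = 0"
        by (rule trilinear_vanish_by_type[of "half_schouten A \<Lambda>'' p" p,
              OF half_schouten_add[OF bf] half_schouten_cyclic])
          (use \<open>?R\<close> in \<open>simp_all add: half_schouten_part_F_ann_F half_schouten_part_F\<close>)
    qed
  qed
  finally show ?thesis .
qed

subsection \<open>Type (1,2)\<close>

context
  fixes U X p a
  assumes U: "open U" "p \<in> U" and X: "projectable A F H U X" and a: "a \<in> ann (F p)" and Xa: "X p = sh p a"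
begin

lemma vf_deriv_ann_F:
  assumes "b \<in> ann (F p)" "u \<in> F p"
  shows "blinfun_apply b (vf_deriv A X p u) = b (dPF p (X p) u)"
  using PH_vf_deriv_projectable[OF U X assms(2)] ann_F(2)[OF assms(1)] by metis

lemma vf_deriv_ann_H:
  assumes "l \<in> ann (H p)"
  shows "blinfun_apply l (vf_deriv A X p u) = - l (dPF p u (X p))"
  using PF_vf_deriv_projectable[OF U X, of u] ann_H(2)[OF assms, of "vf_deriv A X p u"] by (simp add: blinfun.minus_right)

lemma lie_deriv_part_F:
  "lie_deriv_biv A X \<Lambda>'' p b c = biv_deriv A \<Lambda>'' p (X p) b c
    + blinfun_apply b (vf_deriv A X p (sh p (c o\<^sub>L PF p))) - blinfun_apply c (vf_deriv A X p (sh p (b o\<^sub>L PF p)))"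
  using lie_deriv_biv_eq[OF bivector_field_biv_part(1) projectable_vector_field[OF U X] U]
  by (simp add: sharp_part_F)

lemma vf_deriv_0: "vf_deriv A X p 0 = 0"
  by (rule linear_0[OF has_derivative_linear[OF projectable_has_derivative[OF U X]]])

text \<open>The infinitesimal form of the fact that the flow of a projectable field preserves
  \<open>F\<close>: modulo \<open>F\<close> the derivative of \<open>X\<close> cancels that of the
  projection, so \<open>L_X \<Lambda>''\<close> stays leaf-tangent.\<close>

lemma lie_deriv_part_F_ann_F:
  assumes b: "b \<in> ann (F p)"
  shows "lie_deriv_biv A X \<Lambda>'' p b c = 0"
  by (simp add: lie_deriv_part_F ann_F_compose[OF b] vf_deriv_0 biv_deriv_part_F_ann(2)[OF b]
      vf_deriv_ann_F[OF b sh_ann_H[OF compose_PF_ann]])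

text \<open>The summand along \<open>\<sharp>a\<close> is the derivative of \<open>\<Lambda>\<close>
  along \<open>X\<close>. In the two mixed summands the parts seen by \<open>a\<close> cancel by
  symmetry modulo \<open>F\<close>, and the parts seen by \<open>l\<close> and \<open>m\<close> are
  the terms with the derivative of \<open>X\<close>.\<close>

lemma lie_deriv_part_F_ann_H:
  assumes l: "l \<in> ann (H p)" and m: "m \<in> ann (H p)"
  shows "lie_deriv_biv A X \<Lambda>'' p l m = - half_schouten A \<Lambda> p a l m"
  using dPF_symmetric_mod_F[OF a sh_ann_H[OF l] sh_ann_H[OF m]]
  by (simp add: lie_deriv_part_F ann_H_compose[OF l] ann_H_compose[OF m] biv_deriv_part_F_ann(1)[OF l m]
      vf_deriv_ann_H[OF l] vf_deriv_ann_H[OF m] half_schouten_def sh_def[symmetric]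
      deriv_mixed_ann(1)[OF a m] deriv_mixed_ann(2)[OF a l] Xa)

lemma lie_deriv_part_F_iff:
  "(\<forall>b c. lie_deriv_biv A X \<Lambda>'' p b c = \<sigma> p (X p) (E p) * \<Lambda>'' p b c) \<longleftrightarrow>
    (\<forall>l\<in>ann (H p). \<forall>m\<in>ann (H p). half_schouten A \<Lambda> p a l m = blinfun_apply a (E p) * \<Lambda> p l m)" (is "?L \<longleftrightarrow> ?R")
proof -
  \<comment> \<open>This minus sign matches the one in \<open>lie_deriv_part_F_ann_H\<close>, so
    none is left in the equivalence.\<close>
  have \<sigma>E: "\<sigma> p (X p) (E p) = - blinfun_apply a (E p)"
    unfolding Xa by (rule \<sigma>_sh[OF a])
  show ?thesis
  proof
    assume L: ?L
    show ?R
    proof (intro ballI)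
      fix l m assume l: "l \<in> ann (H p)" and m: "m \<in> ann (H p)"
      show "half_schouten A \<Lambda> p a l m = blinfun_apply a (E p) * \<Lambda> p l m"
        using L[rule_format, of l m] by (simp add: lie_deriv_part_F_ann_H[OF l m] \<sigma>E biv_part_apply ann_H_compose l m)
    qed
  next
    assume R: ?R
    define D where "D b c = lie_deriv_biv A X \<Lambda>'' p b c - \<sigma> p (X p) (E p) * \<Lambda>'' p b c" for b c
    have bil: "bilinear (\<Lambda>'' p)" "bilinear (biv_deriv A \<Lambda>'' p v)" for v
      by (rule bivector_fieldD(1)[OF bivector_field_biv_part(1)], rule bilinear_biv_deriv[OF bivector_field_biv_part(1)])
    have skew: "D b c = - D c b" for b c
      using biv_deriv_skew[OF bivector_field_biv_part(1), of p "X p" b c] bivector_fieldD(2)[OF bivector_field_biv_part(1), of p b c]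
      by (simp add: D_def lie_deriv_part_F)
    have sadd: "sh p ((b + b') o\<^sub>L PF p) = sh p (b o\<^sub>L PF p) + sh p (b' o\<^sub>L PF p)" for b b'
      by (rule covector_separates)
        (simp add: sh blinfun.add_right linear_add[OF blinfun_compose_linear] bilinear_ladd[OF bilinear_\<Lambda>])
    have add: "D (b + b') c = D b c + D b' c" for b b' c
      by (simp add: D_def lie_deriv_part_F bilinear_ladd[OF bil(1)] bilinear_ladd[OF bil(2)] blinfun.add_left blinfun.add_right sadd
          linear_add[OF has_derivative_linear[OF projectable_has_derivative[OF U X]]] algebra_simps)
    have F0: "D b c = 0" if "b \<in> ann (F p)" for b c
      using that by (simp add: D_def lie_deriv_part_F_ann_F biv_part_apply ann_F_compose bilinear_lzero[OF bilinear_\<Lambda>])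
    have H0: "D l m = 0" if "l \<in> ann (H p)" "m \<in> ann (H p)" for l m
      using R that by (simp add: D_def lie_deriv_part_F_ann_H \<sigma>E biv_part_apply ann_H_compose)
    have H1: "D l c = 0" if l: "l \<in> ann (H p)" for l c
      using add[of "c o\<^sub>L PH p" "c o\<^sub>L PF p" l] covector_split[of c p] F0[OF compose_PH_ann, of c l] H0[OF compose_PF_ann l, of c]
        skew[of l c] by simp
    have "D b c = 0" for b c
      using add[of "b o\<^sub>L PH p" "b o\<^sub>L PF p" c] covector_split[of b p] F0[OF compose_PH_ann, of b c] H1[OF compose_PF_ann, of b c]
      by simp
    then show ?L by (simp add: D_def)
  qed
qed

end

text \<open>Passage from fields to covectors: every \<open>\<sharp>a\<close> with \<open>a\<close>
  in \<open>ann F\<close> is the value of a local projectable field, and every value of such a field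
  is of this form.\<close>

lemma lie_deriv_projectable_iff:
  "(\<forall>U X. open U \<and> projectable A F H U X \<longrightarrow>
      (\<forall>p\<in>U. \<forall>b c. lie_deriv_biv A X \<Lambda>'' p b c = \<sigma> p (X p) (E p) * \<Lambda>'' p b c)) \<longleftrightarrow>
   (\<forall>p. \<forall>a\<in>ann (F p). \<forall>l\<in>ann (H p). \<forall>m\<in>ann (H p). half_schouten A \<Lambda> p a l m = blinfun_apply a (E p) * \<Lambda> p l m)" (is "?L \<longleftrightarrow> ?R")
proof
  assume L: ?L
  show ?R
  proof (intro allI ballI)
    fix p a l m assume a: "a \<in> ann (F p)" and lm: "l \<in> ann (H p)" "m \<in> ann (H p)"
    obtain U X where UX: "open U" "p \<in> U" "projectable A F H U X" "X p = sh p a"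
      by (rule exists_projectable[OF sh_ann_F[OF a]])
    then show "half_schouten A \<Lambda> p a l m = blinfun_apply a (E p) * \<Lambda> p l m"
      using L lie_deriv_part_F_iff[OF UX(1-3) a UX(4)] lm by blast
  qed
next
  assume R: ?R
  show ?L
  proof (intro allI impI ballI)
    fix U X p b c assume UX: "open U \<and> projectable A F H U X" and p: "p \<in> U"
    obtain a where a: "a \<in> ann (F p)" "X p = sh p a"
      using H_obtain[OF projectable_mem[of U p X]] UX p by blast
    show "lie_deriv_biv A X \<Lambda>'' p b c = \<sigma> p (X p) (E p) * \<Lambda>'' p b c"
      using R a lie_deriv_part_F_iff[of U p X a] UX p by blast
  qed
qed

subsection \<open>Type (2,1)\<close>

text \<open>Put \<open>u = \<sharp>l\<close>. The derivative of \<open>\<Lambda>\<close> along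
  \<open>u\<close>, with those parts of the two mixed summands that \<open>a\<close> and
  \<open>b\<close> see, is \<open>d[\<sigma>(X,Y)](u)\<close>; the parts seen by \<open>l\<close>
  form the bracket of \<open>X\<close> and \<open>Y\<close>. Skewness moves \<open>\<sharp>\<close>
  from \<open>l\<close> to the differential.\<close>

lemma half_schouten_curvature:
  assumes U: "open U" "p \<in> U" and X: "projectable A F H U X" and Y: "projectable A F H U Y"
    and a: "a \<in> ann (F p)" "X p = sh p a" and b: "b \<in> ann (F p)" "Y p = sh p b" and l: "l \<in> ann (H p)"
  shows "half_schouten A \<Lambda> p a b l = - l (sharp (\<Lambda>'' p) (fun_differential A (\<lambda>q. \<sigma> q (X q) (Y q)) p))
    - l (vf_bracket A X Y p)"
proof -
  define df where "df = fun_differential A (\<lambda>q. \<sigma> q (X q) (Y q)) p"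
  define u where "u = sh p l"
  have u: "u \<in> F p" unfolding u_def by (rule sh_ann_H[OF l])
  have "l (sharp (\<Lambda>'' p) df) = - df (sh p l)"
    using sh_skew[of l p "df o\<^sub>L PF p"] PF_F[OF sh_ann_H[OF l]] by (simp add: sharp_part_F)
  moreover have "df u = - biv_deriv A \<Lambda> p u a b + b (dPF p (X p) u) - a (dPF p (Y p) u)"
  proof -
    have "df u = d\<sigma> p u (sh p a) (sh p b) + \<sigma> p (vf_deriv A X p u) (sh p b) + \<sigma> p (sh p a) (vf_deriv A Y p u)"
      unfolding df_def fun_differential_\<sigma>[OF U projectable_vector_field[OF U X] projectable_vector_field[OF U Y]] a(2) b(2) ..
    then show ?thesis
      using \<sigma>_skew[of p "vf_deriv A X p u" "sh p b"]
      by (simp add: d\<sigma>_sh[OF a(1) b(1)] \<sigma>_sh[OF a(1)] \<sigma>_sh[OF b(1)]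
          vf_deriv_ann_F[OF U X a b(1) u] vf_deriv_ann_F[OF U Y b a(1) u])
  qed
  moreover have "l (vf_bracket A X Y p) = l (dPF p (Y p) (X p)) - l (dPF p (X p) (Y p))"
    by (simp add: vf_bracket_eq blinfun.diff_right vf_deriv_ann_H[OF U X a l] vf_deriv_ann_H[OF U Y b l])
  ultimately show ?thesis
    by (simp add: half_schouten_def sh_def[symmetric] deriv_mixed_ann(1)[OF a(1) l] deriv_mixed_ann(2)[OF b(1) l]
        df_def[symmetric] u_def a(2)[symmetric] b(2)[symmetric])
qed

lemma curvature_iff:
  "(\<forall>U X Y. open U \<and> projectable A F H U X \<and> projectable A F H U Y \<longrightarrow>
      (\<forall>p\<in>U. - (PF p) (vf_bracket A X Y p) =
         sharp (\<Lambda>'' p) (fun_differential A (\<lambda>q. \<sigma> q (X q) (Y q)) p))) \<longleftrightarrow>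
   (\<forall>p. \<forall>a\<in>ann (F p). \<forall>b\<in>ann (F p). \<forall>l\<in>ann (H p). half_schouten A \<Lambda> p a b l = 0)" (is "?L \<longleftrightarrow> ?R")
proof
  assume L: ?L
  show ?R
  proof (intro allI ballI)
    fix p a b l assume a: "a \<in> ann (F p)" and b: "b \<in> ann (F p)" and l: "l \<in> ann (H p)"
    obtain U X where UX: "open U" "p \<in> U" "projectable A F H U X" "X p = sh p a"
      by (rule exists_projectable[OF sh_ann_F[OF a]])
    obtain W Y where WY: "open W" "p \<in> W" "projectable A F H W Y" "Y p = sh p b"
      by (rule exists_projectable[OF sh_ann_F[OF b]])
    have UW: "open (U \<inter> W)" "p \<in> U \<inter> W" using UX WY by auto
    \<comment> \<open>The two fields come with separate domains, so both are restricted to the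
      intersection.\<close>
    have X': "projectable A F H (U \<inter> W) X" and Y': "projectable A F H (U \<inter> W) Y"
      using projectable_subset[OF UX(3) UX(1), of "U \<inter> W"] projectable_subset[OF WY(3) WY(1), of "U \<inter> W"] UW by auto
    have "- PF p (vf_bracket A X Y p) = sharp (\<Lambda>'' p) (fun_differential A (\<lambda>q. \<sigma> q (X q) (Y q)) p)"
      using L UW X' Y' by blast
    then have "l (sharp (\<Lambda>'' p) (fun_differential A (\<lambda>q. \<sigma> q (X q) (Y q)) p)) = - l (vf_bracket A X Y p)"
      by (metis ann_H(2)[OF l] blinfun.minus_right)
    then show "half_schouten A \<Lambda> p a b l = 0"
      using half_schouten_curvature[OF UW X' Y' a UX(4) b WY(4) l] by simp
  qed
next
  assume R: ?R
  show ?L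
  proof (intro allI impI ballI)
    fix U X Y p assume UXY: "open U \<and> projectable A F H U X \<and> projectable A F H U Y" and p: "p \<in> U"
    then have U: "open U" and X: "projectable A F H U X" and Y: "projectable A F H U Y" by auto
    obtain a where a: "a \<in> ann (F p)" "X p = sh p a" by (rule H_obtain[OF projectable_mem[OF U p X]])
    obtain b where b: "b \<in> ann (F p)" "Y p = sh p b" by (rule H_obtain[OF projectable_mem[OF U p Y]])
    show "- PF p (vf_bracket A X Y p) = sharp (\<Lambda>'' p) (fun_differential A (\<lambda>q. \<sigma> q (X q) (Y q)) p)"
    \<comment> \<open>Both sides lie in \<open>F\<close>, where covectors from \<open>ann H\<close>
      separate vectors.\<close>
    proof (rule ann_H_eqI)
      show "- PF p (vf_bracket A X Y p) \<in> F p" using PF_mem subspace_F subspace_neg by blast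
      show "sharp (\<Lambda>'' p) (fun_differential A (\<lambda>q. \<sigma> q (X q) (Y q)) p) \<in> F p"
        unfolding sharp_part_F by (rule sh_ann_H[OF compose_PF_ann])
      fix l assume l: "l \<in> ann (H p)"
      show "l (- PF p (vf_bracket A X Y p)) = l (sharp (\<Lambda>'' p) (fun_differential A (\<lambda>q. \<sigma> q (X q) (Y q)) p))"
        using half_schouten_curvature[OF U p X Y a b l] R a(1) b(1) l ann_H(2)[OF l] by (simp add: blinfun.minus_right)
    qed
  qed
qed

subsection \<open>Type (3,0)\<close>

text \<open>By \<open>d\<sigma>_sh\<close> each of the three derivatives of \<open>\<sigma>\<close>
  is minus one of \<open>\<Lambda>\<close>, which is the sign built into
  \<open>half_schouten\<close>.\<close>

lemma ext_deriv2_sh: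
  assumes "a \<in> ann (F p)" "b \<in> ann (F p)" "c \<in> ann (F p)"
  shows "ext_deriv2 A \<sigma> p (sh p a) (sh p b) (sh p c) = half_schouten A \<Lambda> p a b c"
  using d\<sigma>_sh[OF assms(1,2), of "sh p c"] d\<sigma>_sh[OF assms(2,3), of "sh p a"] d\<sigma>_sh[OF assms(3,1), of "sh p b"]
  by (simp add: ext_deriv2_def Let_def d\<sigma>_def half_schouten_def sh_def)

text \<open>Skewness removes the sign of \<open>\<sigma>_sh\<close> in each factor:
  \<open>\<sigma>(E, \<sharp>a) = a(E)\<close> and
  \<open>\<sigma>(\<sharp>b, \<sharp>c) = \<Lambda>(b, c)\<close>.\<close>

lemma wedge12_flat_sh:
  assumes "a \<in> ann (F p)" "b \<in> ann (F p)" "c \<in> ann (F p)"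
  shows "wedge12 (flat \<sigma> E) \<sigma> p (sh p a) (sh p b) (sh p c) =
    blinfun_apply a (E p) * \<Lambda> p b c + blinfun_apply b (E p) * \<Lambda> p c a + blinfun_apply c (E p) * \<Lambda> p a b"
  using \<sigma>_skew[of p "E p"] \<Lambda>_skew[of p b c] \<Lambda>_skew[of p c a] \<Lambda>_skew[of p a b]
  by (simp add: wedge12_def flat_def \<sigma>_sh[OF assms(1)] \<sigma>_sh[OF assms(2)] \<sigma>_sh[OF assms(3)] sh)

lemma \<sigma>_PH: "\<sigma> p (PH p v) w = \<sigma> p v w" "\<sigma> p v (PH p w) = \<sigma> p v w"
  by (simp_all add: PH_eq bilinear_lsub[OF bilinear_\<sigma>] bilinear_rsub[OF bilinear_\<sigma>] \<sigma>_F PF_mem)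

lemma d_prime_iff:
  "d_prime2 A H F \<sigma> = wedge12 (flat \<sigma> E) \<sigma> \<longleftrightarrow>
   (\<forall>p. \<forall>a\<in>ann (F p). \<forall>b\<in>ann (F p). \<forall>c\<in>ann (F p). half_schouten A \<Lambda> p a b c =
      blinfun_apply a (E p) * \<Lambda> p b c + blinfun_apply b (E p) * \<Lambda> p c a + blinfun_apply c (E p) * \<Lambda> p a b)" (is "?L \<longleftrightarrow> ?R")
proof
  assume L: ?L
  show ?R
  proof (intro allI ballI)
    fix p a b c assume abc: "a \<in> ann (F p)" "b \<in> ann (F p)" "c \<in> ann (F p)"
    have "d_prime2 A H F \<sigma> p (sh p a) (sh p b) (sh p c) = wedge12 (flat \<sigma> E) \<sigma> p (sh p a) (sh p b) (sh p c)"
      by (simp add: L)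
    then show "half_schouten A \<Lambda> p a b c =
      blinfun_apply a (E p) * \<Lambda> p b c + blinfun_apply b (E p) * \<Lambda> p c a + blinfun_apply c (E p) * \<Lambda> p a b"
      using abc by (simp add: d_prime2_def Let_def PH_def[symmetric] PH_H sh_ann_F ext_deriv2_sh wedge12_flat_sh)
  qed
next
  assume R: ?R
  show ?L
  proof (intro ext)
    fix p u v w
    obtain a where a: "a \<in> ann (F p)" "PH p u = sh p a" by (rule H_obtain[OF PH_mem])
    obtain b where b: "b \<in> ann (F p)" "PH p v = sh p b" by (rule H_obtain[OF PH_mem])
    obtain c where c: "c \<in> ann (F p)" "PH p w = sh p c" by (rule H_obtain[OF PH_mem])
    have "d_prime2 A H F \<sigma> p u v w = ext_deriv2 A \<sigma> p (PH p u) (PH p v) (PH p w)"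
      by (simp add: d_prime2_def Let_def PH_def)
    also have "\<dots> = wedge12 (flat \<sigma> E) \<sigma> p (PH p u) (PH p v) (PH p w)"
      using R a(1) b(1) c(1) by (simp add: a(2) b(2) c(2) ext_deriv2_sh wedge12_flat_sh)
    \<comment> \<open>\<open>F\<close> lies in the kernel of \<open>\<sigma>\<close> and hence of
      its contraction with \<open>E\<close>, so the wedge product ignores the projections.\<close>
    also have "\<dots> = wedge12 (flat \<sigma> E) \<sigma> p u v w"
      by (simp add: wedge12_def flat_def \<sigma>_PH)
    finally show "d_prime2 A H F \<sigma> p u v w = wedge12 (flat \<sigma> E) \<sigma> p u v w" .
  qed
qed

subsection \<open>The Lie derivative along \<open>E\<close>\<close>

lemma lie_deriv_E_sum:
  "lie_deriv_biv A E \<Lambda> p a b = lie_deriv_biv A E \<Lambda>' p a b + lie_deriv_biv A E \<Lambda>'' p a b"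
proof -
  have split: "\<Lambda> q a b = \<Lambda>' q a b + \<Lambda>'' q a b" for q a b
    unfolding biv_part_apply \<Lambda>_compose_PF[symmetric] \<Lambda>_compose_PH[symmetric]
    by (subst covector_split[of a q]) (simp add: bilinear_ladd[OF bilinear_\<Lambda>])
  have dsum: "biv_deriv A \<Lambda> p u a b = biv_deriv A \<Lambda>' p u a b + biv_deriv A \<Lambda>'' p u a b" for u
  proof -
    have "(\<lambda>y. biv_in A (ch p) \<Lambda> y a b) =
      (\<lambda>y. biv_in A (ch p) \<Lambda>' y a b + biv_in A (ch p) \<Lambda>'' y a b)"
      by (rule ext) (simp add: biv_in_def split)
    moreover have "((\<lambda>y. biv_in A (ch p) \<Lambda>' y a b + biv_in A (ch p) \<Lambda>'' y a b)
      has_derivative (\<lambda>u. biv_deriv A \<Lambda>' p u a b + biv_deriv A \<Lambda>'' p u a b)) (at (org p))"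
      unfolding biv_deriv_def Let_def
      by (intro has_derivative_add has_derivative_frechet biv_in_differentiable bivector_field_biv_part)
    ultimately show ?thesis
      using frechet_derivative_eqI by (simp add: biv_deriv_def[of A \<Lambda>] Let_def)
  qed
  have shs: "sh p c = sh p (c o\<^sub>L PH p) + sh p (c o\<^sub>L PF p)" for c
    by (rule covector_separates)
      (subst covector_split[of c p], simp add: sh blinfun.add_right bilinear_ladd[OF bilinear_\<Lambda>] del: covector_split)
  show ?thesis
    using dsum[of "E p"] shs[of a] shs[of b] linear_add[OF has_derivative_linear[OF vf_in_has_derivative[OF E open_UNIV UNIV_I]], of p]
    by (simp add: lie_deriv_biv_eq[OF _ E open_UNIV UNIV_I] \<Lambda> bivector_field_biv_part sharp_part_F sharp_part_H
        sh_def[symmetric] blinfun.add_right)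
qed

lemma vf_deriv_E_0: "vf_deriv A E p 0 = 0"
  by (rule linear_0[OF has_derivative_linear[OF vf_in_has_derivative[OF E open_UNIV UNIV_I]]])

text \<open>Near \<open>p\<close> fixed covectors enter \<open>\<Lambda>''\<close> through their
  \<open>F\<close>-parts, and both of these vanish at \<open>p\<close>, so the product rule leaves
  nothing.\<close>

lemma lie_deriv_E_part_F:
  assumes a: "a \<in> ann (F p)" and b: "b \<in> ann (F p)"
  shows "lie_deriv_biv A E \<Lambda>'' p a b = 0"
  by (simp add: lie_deriv_biv_eq[OF bivector_field_biv_part(1) E open_UNIV UNIV_I] sharp_part_F ann_F_compose[OF a]
      ann_F_compose[OF b] biv_deriv_part_F_ann(2)[OF a] vf_deriv_E_0)

lemma lie_deriv_E_part_H:
  assumes l: "l \<in> ann (H p)" and m: "m \<in> ann (H p)"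
  shows "lie_deriv_biv A E \<Lambda>' p l m = 0"
  by (simp add: lie_deriv_biv_eq[OF bivector_field_biv_part(2) E open_UNIV UNIV_I] sharp_part_H ann_H_compose[OF l]
      ann_H_compose[OF m] biv_deriv_part_H_ann[OF l m] vf_deriv_E_0)

lemma lie_deriv_E_skew:
  "bivector_field A B \<Longrightarrow> lie_deriv_biv A E B p a b = - lie_deriv_biv A E B p b a"
  using biv_deriv_skew[of B p "E p" a b] by (simp add: lie_deriv_biv_eq[OF _ E open_UNIV UNIV_I])

lemma lie_deriv_E_add:
  "lie_deriv_biv A E \<Lambda> p (a + a') b = lie_deriv_biv A E \<Lambda> p a b + lie_deriv_biv A E \<Lambda> p a' b"
proof -
  have "sh p (a + a') = sh p a + sh p a'"
    by (rule covector_separates) (simp add: sh blinfun.add_right bilinear_ladd[OF bilinear_\<Lambda>])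
  then show ?thesis
    using linear_add[OF has_derivative_linear[OF vf_in_has_derivative[OF E open_UNIV UNIV_I]], of p]
    by (simp add: lie_deriv_biv_eq[OF \<Lambda> E open_UNIV UNIV_I] sh_def[symmetric] bilinear_ladd[OF bilinear_biv_deriv[OF \<Lambda>]]
        blinfun.add_left blinfun.add_right)
qed

lemma lie_deriv_E_iff:
  "(\<forall>p a b. lie_deriv_biv A E \<Lambda> p a b = 0) \<longleftrightarrow>
    (\<forall>\<alpha>\<in>one_forms_ann A F. \<forall>\<beta>\<in>one_forms_ann A F. \<forall>p. lie_deriv_biv A E \<Lambda>' p (\<alpha> p) (\<beta> p) = 0) \<and>
    (\<forall>l\<in>one_forms_ann A H. \<forall>m\<in>one_forms_ann A H. \<forall>p. lie_deriv_biv A E \<Lambda>'' p (l p) (m p) = 0) \<and>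
    (\<forall>\<alpha>\<in>one_forms_ann A F. \<forall>l\<in>one_forms_ann A H. \<forall>p.
       lie_deriv_biv A E \<Lambda>' p (\<alpha> p) (l p) = lie_deriv_biv A E \<Lambda>'' p (l p) (\<alpha> p))"
  (is "?Z \<longleftrightarrow> ?FF \<and> ?HH \<and> ?FH")
proof -
  let ?L' = "lie_deriv_biv A E \<Lambda>'" and ?L'' = "lie_deriv_biv A E \<Lambda>''" and ?L = "lie_deriv_biv A E \<Lambda>"
  have annF: "\<alpha> p \<in> ann (F p)" if "\<alpha> \<in> one_forms_ann A F" for \<alpha> p using that by (simp add: one_forms_ann_def)
  have annH: "\<alpha> p \<in> ann (H p)" if "\<alpha> \<in> one_forms_ann A H" for \<alpha> p using that by (simp add: one_forms_ann_def)
  \<comment> \<open>Skewness turns the sum of the two mixed values into a difference, which gives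
    the third condition its form.\<close>
  have mixed: "?L p a l = ?L' p a l - ?L'' p l a" for p a l
    using lie_deriv_E_sum[of p a l] lie_deriv_E_skew[OF bivector_field_biv_part(1), of p a l] by simp
  show ?thesis
  proof
    assume Z: ?Z
    have ?FF
      using lie_deriv_E_sum lie_deriv_E_part_F[OF annF annF] Z by (metis add.right_neutral)
    moreover have ?HH
      using lie_deriv_E_sum lie_deriv_E_part_H[OF annH annH] Z by (metis add.left_neutral)
    moreover have ?FH using mixed Z by simp
    ultimately show "?FF \<and> ?HH \<and> ?FH" by blast
  next
    assume C: "?FF \<and> ?HH \<and> ?FH"
    have FF: "?L p a b = 0" if ab: "a \<in> ann (F p)" "b \<in> ann (F p)" for p a b
    proof -
      obtain \<alpha> where "\<alpha> \<in> one_forms_ann A F" "\<alpha> p = a" by (rule exists_one_form_ann_F[OF ab(1)])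
      moreover obtain \<beta> where "\<beta> \<in> one_forms_ann A F" "\<beta> p = b" by (rule exists_one_form_ann_F[OF ab(2)])
      ultimately have "?L' p a b = 0" using C by blast
      then show ?thesis using lie_deriv_E_sum lie_deriv_E_part_F[OF ab] by simp
    qed
    have HH: "?L p a b = 0" if ab: "a \<in> ann (H p)" "b \<in> ann (H p)" for p a b
    proof -
      obtain \<alpha> where "\<alpha> \<in> one_forms_ann A H" "\<alpha> p = a" by (rule exists_one_form_ann_H[OF ab(1)])
      moreover obtain \<beta> where "\<beta> \<in> one_forms_ann A H" "\<beta> p = b" by (rule exists_one_form_ann_H[OF ab(2)])
      ultimately have "?L'' p a b = 0" using C by blast
      then show ?thesis using lie_deriv_E_sum lie_deriv_E_part_H[OF ab] by simp
    qed
    have FH: "?L p a l = 0" if al: "a \<in> ann (F p)" "l \<in> ann (H p)" for p a l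
    proof -
      obtain \<alpha> where "\<alpha> \<in> one_forms_ann A F" "\<alpha> p = a" by (rule exists_one_form_ann_F[OF al(1)])
      moreover obtain \<beta> where "\<beta> \<in> one_forms_ann A H" "\<beta> p = l" by (rule exists_one_form_ann_H[OF al(2)])
      ultimately have "?L' p a l = ?L'' p l a" using C by blast
      then show ?thesis by (simp add: mixed)
    qed
    have sk: "?L p a b = - ?L p b a" for p a b by (rule lie_deriv_E_skew[OF \<Lambda>])
    have 1: "?L p a b = 0" if "b \<in> ann (F p) \<union> ann (H p)" for p a b
      using lie_deriv_E_add[of p "a o\<^sub>L PH p" "a o\<^sub>L PF p" b] covector_split[of a p] that
        FF[OF compose_PH_ann, of b p a] FH[OF compose_PH_ann, of b p a] HH[OF compose_PF_ann, of b p a]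
        FH[of b p "a o\<^sub>L PF p", OF _ compose_PF_ann] sk[of p "a o\<^sub>L PF p" b] by auto
    show ?Z
    proof (intro allI)
      fix p a b
      show "?L p a b = 0"
        using lie_deriv_E_add[of p "b o\<^sub>L PH p" "b o\<^sub>L PF p" a] covector_split[of b p]
          1[of "b o\<^sub>L PH p" p a] 1[of "b o\<^sub>L PF p" p a] compose_PH_ann[of b p] compose_PF_ann[of b p]
          sk[of p a b] sk[of p "b o\<^sub>L PH p" a] sk[of p "b o\<^sub>L PF p" a] by auto
    qed
  qed
qed

section \<open>Assembly of the type components\<close>

theorem jacobi_structure_coupling_iff:
  "jacobi_structure A \<Lambda> E \<longleftrightarrow>
    leaf_tangent_poisson A F \<Lambda>'' \<and>
    (\<forall>p a b. lie_deriv_biv A E \<Lambda> p a b = 0) \<and>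
    d_prime2 A H F \<sigma> = wedge12 (flat \<sigma> E) \<sigma> \<and>
    (\<forall>U X. open U \<and> projectable A F H U X \<longrightarrow>
      (\<forall>p\<in>U. \<forall>b c. lie_deriv_biv A X \<Lambda>'' p b c = \<sigma> p (X p) (E p) * \<Lambda>'' p b c)) \<and>
    (\<forall>U X Y. open U \<and> projectable A F H U X \<and> projectable A F H U Y \<longrightarrow>
      (\<forall>p\<in>U. - (PF p) (vf_bracket A X Y p) =
         sharp (\<Lambda>'' p) (fun_differential A (\<lambda>q. \<sigma> q (X q) (Y q)) p)))"
proof -
  define R where "R p a b c = half_schouten A \<Lambda> p a b c - (blinfun_apply a (E p) * \<Lambda> p b c
    + blinfun_apply b (E p) * \<Lambda> p c a + blinfun_apply c (E p) * \<Lambda> p a b)" for p a b c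
  have add: "R p (a + a') b c = R p a b c + R p a' b c" for p a a' b c
    by (simp add: R_def half_schouten_add[OF \<Lambda>] bilinear_ladd[OF bilinear_\<Lambda>] bilinear_radd[OF bilinear_\<Lambda>]
        blinfun.add_left algebra_simps)
  have cyc: "R p a b c = R p b c a" for p a b c
    by (simp add: R_def half_schouten_cyclic[of \<Lambda> p a])
  \<comment> \<open>\<open>E \<and> \<Lambda>\<close> contributes nothing here: two of its summands
    contain a mixed pairing of \<open>\<Lambda>\<close>, the third the factor
    \<open>l (E p) = 0\<close>.\<close>
  have FFH: "R p a b l = half_schouten A \<Lambda> p a b l" if "a \<in> ann (F p)" "b \<in> ann (F p)" "l \<in> ann (H p)" for p a b l
    using that by (simp add: R_def ann_H_E \<Lambda>_mixed)
  \<comment> \<open>The only summand of \<open>E \<and> \<Lambda>\<close> that survives is the one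
    in which \<open>E\<close> meets \<open>a\<close>.\<close>
  have FHH: "R p a l m = half_schouten A \<Lambda> p a l m - blinfun_apply a (E p) * \<Lambda> p l m"
    if "a \<in> ann (F p)" "l \<in> ann (H p)" "m \<in> ann (H p)" for p a l m
    using that by (simp add: R_def ann_H_E)
  have HHH: "R p l m n = half_schouten A \<Lambda> p l m n" if "l \<in> ann (H p)" "m \<in> ann (H p)" "n \<in> ann (H p)" for p l m n
    using that by (simp add: R_def ann_H_E)
  have "(\<forall>p a b c. R p a b c = 0) \<longleftrightarrow>
    (\<forall>p. \<forall>l\<in>ann (H p). \<forall>m\<in>ann (H p). \<forall>n\<in>ann (H p). R p l m n = 0) \<and>
    (\<forall>p. \<forall>a\<in>ann (F p). \<forall>b\<in>ann (F p). \<forall>c\<in>ann (F p). R p a b c = 0) \<and>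
    (\<forall>p. \<forall>a\<in>ann (F p). \<forall>l\<in>ann (H p). \<forall>m\<in>ann (H p). R p a l m = 0) \<and>
    (\<forall>p. \<forall>a\<in>ann (F p). \<forall>b\<in>ann (F p). \<forall>l\<in>ann (H p). R p a b l = 0)" (is "?all \<longleftrightarrow> ?types")
  proof
    assume ?all
    then show ?types by blast
  next
    assume T: ?types
    show ?all
    proof (intro allI)
      fix p a b c
      show "R p a b c = 0"
        by (rule trilinear_vanish_by_type[of "R p" p, OF add cyc]) (use T in blast)+
    qed
  qed
  moreover have "jacobi_structure A \<Lambda> E \<longleftrightarrow> (\<forall>p a b c. R p a b c = 0) \<and> (\<forall>p a b. lie_deriv_biv A E \<Lambda> p a b = 0)"
    unfolding jacobi_structure_iff[OF \<Lambda> E] by (simp add: R_def)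
  ultimately show ?thesis
    unfolding leaf_tangent_poisson_iff d_prime_iff lie_deriv_projectable_iff curvature_iff
    by (simp add: FFH FHH HHH) (simp add: R_def conj_ac)
qed

end

theorem proposition5p4:
  fixes A \<Phi> :: "('a::{t2_space,second_countable_topology}, 'e::euclidean_space) chart set"
    and V :: "'e set"
    and F H :: "('a, 'e) distribution"
    and \<Lambda> \<Lambda>' \<Lambda>'' :: "('a, 'e) bivfield"
    and E :: "('a, 'e) vfield"
    and \<sigma> :: "('a, 'e) form2"
  assumes "smooth_atlas A"
    and "foliated_atlas A V \<Phi>"
    and "F = tangent_distribution A V \<Phi>"
    and "coupling_second_kind A F \<Lambda> E"
    and "H = sharp_ann F \<Lambda>"
    and "\<Lambda>' = biv_part H F \<Lambda>"
    and "\<Lambda>'' = biv_part F H \<Lambda>"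
    and "equivalent_form_mod A F \<Lambda>' \<sigma>"
  shows "jacobi_structure A \<Lambda> E \<longleftrightarrow>
    leaf_tangent_poisson A F \<Lambda>'' \<and>
    (\<forall>\<alpha>\<in>one_forms_ann A F. \<forall>\<beta>\<in>one_forms_ann A F. \<forall>p.
       lie_deriv_biv A E \<Lambda>' p (\<alpha> p) (\<beta> p) = 0) \<and>
    (\<forall>l\<in>one_forms_ann A H. \<forall>m\<in>one_forms_ann A H. \<forall>p.
       lie_deriv_biv A E \<Lambda>'' p (l p) (m p) = 0) \<and>
    (\<forall>\<alpha>\<in>one_forms_ann A F. \<forall>l\<in>one_forms_ann A H. \<forall>p.
       lie_deriv_biv A E \<Lambda>' p (\<alpha> p) (l p) = lie_deriv_biv A E \<Lambda>'' p (l p) (\<alpha> p)) \<and>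
    d_prime2 A H F \<sigma> = wedge12 (flat \<sigma> E) \<sigma> \<and>
    (\<forall>U X. open U \<and> projectable A F H U X \<longrightarrow>
       (\<forall>p\<in>U. \<forall>a b. lie_deriv_biv A X \<Lambda>'' p a b = \<sigma> p (X p) (E p) * \<Lambda>'' p a b)) \<and>
    (\<forall>U X Y. open U \<and> projectable A F H U X \<and> projectable A F H U Y \<longrightarrow>
       (\<forall>p\<in>U. - blinfun_apply (proj_along (F p) (H p)) (vf_bracket A X Y p) =
          sharp (\<Lambda>'' p) (fun_differential A (\<lambda>q. \<sigma> q (X q) (Y q)) p)))"
proof -
  interpret coupling_pair A V \<Phi> F H \<Lambda> E \<sigma>
    by unfold_locales (use assms in simp_all)
  show ?thesis
    unfolding assms(6,7) jacobi_structure_coupling_iff lie_deriv_E_iff PF_def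
    by (simp only: conj_assoc)
qed

end
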